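(* Let $\mathbb{G}$ be a commutative one-dimensional formal group over a formal scheme $S$ with coordinate $x$, and let $d_0,d_1,r\ge 0$ be integers with $r\le\min(d_0,d_1)$. The ring $\mathcal{O}_{\mathrm{Int}_r(d_0,d_1)}$ is freely generated as a module over $$\mathcal{O}_S[[c_{0i}\mid 0<i\le d_0-r]][[c_{1j}\mid 0<j\le d_1]]$$ by the monomials $$c_0^\alpha:=\prod_{i=d_0-r+1}^{d_0}c_{0i}^{\alpha_i}$$ for which $\sum_i\alpha_i\le d_1-r$. Moreover, if $\pi:\mathrm{Sub}_r(d_0,d_1)\to\mathrm{Int}_r(d_0,d_1)$ is the usual projection, then the corresponding ring map $\pi^*:\mathcal{O}_{\mathrm{Int}_r(d_0,d_1)}\to\mathcal{O}_{\mathrm{Sub}_r(d_0,d_1)}$ is a split monomorphism of modules over $\mathcal{O}_{\mathrm{Div}_{d_1}^+}$ (so $\pi$ itself is dominant).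
   Context: A divisor of degree $d$ on $\mathbb{G}$ over a base $T$ is a closed subscheme $D=\mathrm{spf}(\mathcal{O}_T[[x]]/f(x))$ with $f$ monic of degree $d$ and congruent to $x^d$ modulo (topologically) nilpotent elements; $f$ is its equation. The scheme $\mathrm{Div}_d^+=\mathbb{G}^d/\Sigma_d$ of such divisors has $\mathcal{O}_{\mathrm{Div}_d^+}=\mathcal{O}_S[[c_1,\dots,c_d]]$, the tautological divisor having equation $\sum_{i=0}^dc_ix^{d-i}$ with $c_0=1$. Let $R=\mathcal{O}_{\mathrm{Div}_{d_0}^+\times\mathrm{Div}_{d_1}^+}=\mathcal{O}_S[[c_{01},\dots,c_{0d_0},c_{11},\dots,c_{1d_1}]]$ and $f_i(x)=\sum_{j=0}^{d_i}c_{ij}x^{d_i-j}$ with $c_{i0}=1$ ($i=0,1$). Let $A$ be the $(d_0+d_1)\times(d_0+d_1)$ matrix whose columns are the coefficient vectors, with respect to $1,x,\dots,x^{d_0+d_1-1}$, of $x^jf_0(x)$ ($0\le j<d_1$) and $x^jf_1(x)$ ($0\le j<d_0$). Let $I\le R$ be the ideal generated by the minors of $A$ of size $d_0+d_1-r+1$. Then $\mathrm{Int}_r(d_0,d_1)=\mathrm{spf}(R/I)$, so $\mathcal{O}_{\mathrm{Int}_r(d_0,d_1)}=R/I$. (It classifies pairs of divisors of degrees $d_0,d_1$ with intersection multiplicity at least $r$.) $\mathrm{Sub}_r(d_0,d_1)$ is the scheme of triples $(D,D_0,D_1)$ of divisors of degrees $r,d_0,d_1$ with $D\le D_0$ and $D\le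 D_1$ (i.e. the equation of $D$ divides those of $D_0$ and $D_1$). It is isomorphic to $\mathrm{Div}_r^+\times\mathrm{Div}_{d_0-r}^+\times\mathrm{Div}_{d_1-r}^+$, so its ring is $\mathcal{O}_S[[a_1,\dots,a_{d_0-r},b_1,\dots,b_{d_1-r},c_1,\dots,c_r]]$. With $f=\sum_i a_ix^{d_0-r-i}$, $g=\sum_i b_ix^{d_1-r-i}$, $h=\sum_i c_ix^{r-i}$ ($a_0=b_0=c_0=1$), the map $\pi$ sends $(D,D_0,D_1)$ to $(D_0,D_1)$, and $\pi^*$ is determined by $f_0\mapsto fh$, $f_1\mapsto gh$ (coefficientwise); this annihilates $I$. Module structures over $\mathcal{O}_{\mathrm{Div}_{d_1}^+}=\mathcal{O}_S[[c_{11},\dots,c_{1d_1}]]$ are via the divisor $D_1$. *)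

theory Defs
  imports
    "HOL-Library.Poly_Mapping"
    "HOL-Computational_Algebra.Polynomial"
    "HOL-Algebra.QuotRing"
    "HOL-Algebra.Module"
    "Jordan_Normal_Form.Determinant"
    "Jordan_Normal_Form.DL_Submatrix"
begin

section \<open>Formal power series in several variables\<close>

text \<open>
  A series over \<open>'a\<close> in variables of type \<open>'v\<close> is an arbitrary family of coefficients, indexed by
  the monomials \<open>'v \<Rightarrow>\<^sub>0 nat\<close>.  Series in a prescribed set of variables form a subring
  (\<open>psring\<close> below), so that iterated power series rings such as \<open>k[[x]][[y]]\<close> and \<open>k[[x,y]]\<close> are
  literally equal.
\<close>

typedef ('v, 'a) mfps = "UNIV :: (('v \<Rightarrow>\<^sub>0 nat) \<Rightarrow> 'a) set"
  morphisms mcoeff Abs_mfps ..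

setup_lifting type_definition_mfps

lemma mfps_eqI: "(\<And>m. mcoeff F m = mcoeff G m) \<Longrightarrow> F = G"
  by transfer auto

lemma finite_mono_sums: "finite {(p, q). p + q = (m :: 'v \<Rightarrow>\<^sub>0 nat)}"
proof -
  let ?S = "{(p, q). p + q = m}"
  let ?f = "\<lambda>p. restrict (Poly_Mapping.lookup p) (Poly_Mapping.keys m)"
  have le: "Poly_Mapping.lookup p v \<le> Poly_Mapping.lookup m v" if "p + q = m" for p q v
    using that by (auto simp: Poly_Mapping.lookup_add)
  have "inj_on (\<lambda>(p, q). ?f p) ?S"
  proof (rule inj_onI, clarsimp)
    fix p q p' q' :: "'v \<Rightarrow>\<^sub>0 nat"
    assume m: "m = p + q" and eq: "p' + q' = p + q"
      and r: "restrict (Poly_Mapping.lookup p) (Poly_Mapping.keys (p + q)) = restrict (Poly_Mapping.lookup p') (Poly_Mapping.keys (p + q))"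
    have "Poly_Mapping.lookup p v = Poly_Mapping.lookup p' v" for v
    proof (cases "v \<in> Poly_Mapping.keys (p + q)")
      case True
      then show ?thesis using fun_cong[OF r, of v] by simp
    next
      case False
      then have "Poly_Mapping.lookup (p + q) v = 0" "Poly_Mapping.lookup (p' + q') v = 0"
        by (simp_all add: Poly_Mapping.in_keys_iff eq)
      then show ?thesis by (simp add: Poly_Mapping.lookup_add)
    qed
    then have "p = p'" by (rule poly_mapping_eqI)
    with eq show "p = p' \<and> q = q'" by simp
  qed
  moreover have "(\<lambda>(p, q). ?f p) ` ?S \<subseteq> (\<Pi>\<^sub>E v\<in>Poly_Mapping.keys m. {..Poly_Mapping.lookup m v})"
    using le by (auto simp: PiE_iff)
  then have "finite ((\<lambda>(p, q). ?f p) ` ?S)"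
    by (rule finite_subset) (auto intro: finite_PiE)
  ultimately show ?thesis
    using finite_imageD by blast
qed

instantiation mfps :: (type, comm_ring_1) comm_ring_1
begin

lift_definition zero_mfps :: "('a, 'b) mfps" is "\<lambda>_. 0" .
lift_definition one_mfps :: "('a, 'b) mfps" is "\<lambda>m. if m = 0 then 1 else 0" .
lift_definition plus_mfps :: "('a, 'b) mfps \<Rightarrow> ('a, 'b) mfps \<Rightarrow> ('a, 'b) mfps"
  is "\<lambda>F G m. F m + G m" .
lift_definition uminus_mfps :: "('a, 'b) mfps \<Rightarrow> ('a, 'b) mfps"
  is "\<lambda>F m. - F m" .
lift_definition minus_mfps :: "('a, 'b) mfps \<Rightarrow> ('a, 'b) mfps \<Rightarrow> ('a, 'b) mfps"
  is "\<lambda>F G m. F m - G m" .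
lift_definition times_mfps :: "('a, 'b) mfps \<Rightarrow> ('a, 'b) mfps \<Rightarrow> ('a, 'b) mfps"
  is "\<lambda>F G m. \<Sum>(p, q) \<in> {(p, q). p + q = m}. F p * G q" .

instance
proof
  fix F G H :: "('a, 'b) mfps"
  show "F * G * H = F * (G * H)"
  proof transfer
    fix F G H :: "('a \<Rightarrow>\<^sub>0 nat) \<Rightarrow> 'b"
    show "(\<lambda>m. \<Sum>(s, r) \<in> {(s, r). s + r = m}. (\<Sum>(p, q) \<in> {(p, q). p + q = s}. F p * G q) * H r)
        = (\<lambda>m. \<Sum>(p, s) \<in> {(p, s). p + s = m}. F p * (\<Sum>(q, r) \<in> {(q, r). q + r = s}. G q * H r))"
    proof
      fix m
      have "(\<Sum>(s, r) \<in> {(s, r). s + r = m}. (\<Sum>(p, q) \<in> {(p, q). p + q = s}. F p * G q) * H r)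
        = (\<Sum>x \<in> {(s, r). s + r = m}. \<Sum>y \<in> {(p, q). p + q = fst x}. F (fst y) * G (snd y) * H (snd x))"
        by (simp add: sum_distrib_right case_prod_unfold)
      also have "\<dots> = (\<Sum>(x, y) \<in> (SIGMA x : {(s, r). s + r = m}. {(p, q). p + q = fst x}).
          F (fst y) * G (snd y) * H (snd x))"
        by (rule sum.Sigma) (auto intro: finite_mono_sums)
      also have "\<dots> = (\<Sum>(x, y) \<in> (SIGMA x : {(p, s). p + s = m}. {(q, r). q + r = snd x}).
          F (fst x) * (G (fst y) * H (snd y)))"
        by (rule sum.reindex_bij_witness
            [where j = "\<lambda>((s, r), (p, q)). ((p, q + r), (q, r))"
               and i = "\<lambda>((p, s), (q, r)). ((p + q, r), (p, q))"])
           (auto simp: ac_simps)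
      also have "\<dots> = (\<Sum>x \<in> {(p, s). p + s = m}. \<Sum>y \<in> {(q, r). q + r = snd x}.
          F (fst x) * (G (fst y) * H (snd y)))"
        by (rule sum.Sigma[symmetric]) (auto intro: finite_mono_sums)
      also have "\<dots> = (\<Sum>(p, s) \<in> {(p, s). p + s = m}. F p * (\<Sum>(q, r) \<in> {(q, r). q + r = s}. G q * H r))"
        by (simp add: sum_distrib_left case_prod_unfold)
      finally show "(\<Sum>(s, r) \<in> {(s, r). s + r = m}. (\<Sum>(p, q) \<in> {(p, q). p + q = s}. F p * G q) * H r)
        = (\<Sum>(p, s) \<in> {(p, s). p + s = m}. F p * (\<Sum>(q, r) \<in> {(q, r). q + r = s}. G q * H r))" .
    qed
  qed
  show "F * G = G * F"
    by transfer (auto simp: fun_eq_iff mult.commute ac_simps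
        intro!: sum.reindex_bij_witness[where i = "\<lambda>(p, q). (q, p)" and j = "\<lambda>(p, q). (q, p)"])
  show "1 * F = F"
  proof transfer
    fix F :: "('a \<Rightarrow>\<^sub>0 nat) \<Rightarrow> 'b"
    show "(\<lambda>m. \<Sum>(p, q) \<in> {(p, q). p + q = m}. (if p = 0 then 1 else 0) * F q) = F"
    proof
      fix m
      have "(\<Sum>(p, q) \<in> {(p, q). p + q = m}. (if p = 0 then 1 else 0) * F q)
          = (\<Sum>(p, q) \<in> {(0 :: 'a \<Rightarrow>\<^sub>0 nat, m)}. (if p = 0 then 1 else 0) * F q)"
        by (rule sum.mono_neutral_right) (auto intro: finite_mono_sums split: if_splits)
      then show "(\<Sum>(p, q) \<in> {(p, q). p + q = m}. (if p = 0 then 1 else 0) * F q) = F m"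
        by simp
    qed
  qed
  show "(F + G) * H = F * H + G * H"
    by transfer (auto simp: fun_eq_iff case_prod_unfold algebra_simps sum.distrib)
  show "(0 :: ('a, 'b) mfps) \<noteq> 1"
    by transfer (metis zero_neq_one)
qed (transfer; simp add: fun_eq_iff algebra_simps)+

end

lift_definition mvar :: "'v \<Rightarrow> ('v, 'a::comm_ring_1) mfps"
  is "\<lambda>v m. if m = Poly_Mapping.single v 1 then 1 else 0" .

definition mfps_vars :: "('v, 'a::comm_ring_1) mfps \<Rightarrow> 'v set" where
  "mfps_vars F = (\<Union>m \<in> {m. mcoeff F m \<noteq> 0}. Poly_Mapping.keys m)"

text \<open>The ring \<open>'a[[v | v \<in> V]]\<close>; it is only used for finite \<open>V\<close>.\<close>

definition psring :: "'v set \<Rightarrow> ('v, 'a::comm_ring_1) mfps ring" where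
  "psring V = \<lparr>carrier = {F. mfps_vars F \<subseteq> V}, monoid.mult = (*), one = 1,
     ring.zero = 0, add = (+)\<rparr>"

text \<open>
  The series \<open>F(\<phi>)\<close>, obtained by substituting \<open>\<phi> v\<close> for each variable \<open>v\<close> of \<open>F\<close>.  If \<open>F\<close> involves
  finitely many variables, and \<open>\<phi> v\<close> has zero constant term for each of them, then for every \<open>m\<close>
  only finitely many summands are nonzero, and \<open>F \<mapsto> F(\<phi>)\<close> is the unique continuous
  \<open>'a\<close>-algebra map sending \<open>v\<close> to \<open>\<phi> v\<close>.
\<close>

definition msubst :: "('v \<Rightarrow> ('w, 'a::comm_ring_1) mfps) \<Rightarrow> ('v, 'a) mfps \<Rightarrow> ('w, 'a) mfps" where
  "msubst \<phi> F = Abs_mfps (\<lambda>m. Sum_any (\<lambda>n. mcoeff F n *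
     mcoeff (\<Prod>v\<in>Poly_Mapping.keys n. \<phi> v ^ Poly_Mapping.lookup n v) m))"

section \<open>Formal groups with a coordinate\<close>

text \<open>
  A commutative one-dimensional formal group over \<open>S\<close> with coordinate \<open>x\<close> amounts to a commutative
  formal group law over \<open>'a = \<O>\<^sub>S\<close>.  (Inverses exist automatically.)  The topology of \<open>\<O>\<^sub>S\<close> plays no
  role: the rings below depend only on the underlying ring, and \<open>\<O>\<^sub>S[[x]]\<close> consists of all series.
\<close>

definition formal_group_law :: "(nat, 'a::comm_ring_1) mfps \<Rightarrow> bool" where
  "formal_group_law F \<longleftrightarrow>
     F \<in> carrier (psring {0, 1}) \<and>
     msubst ((\<lambda>_. 0)(0 := mvar 0)) F = (mvar 0 :: (nat, 'a) mfps) \<and>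
     msubst ((\<lambda>_. 0)(0 := mvar 1, 1 := mvar 0)) F = F \<and>
     msubst ((\<lambda>_. 0)(0 := F, 1 := mvar 2)) F =
       msubst ((\<lambda>_. 0)(0 := mvar 0, 1 := msubst ((\<lambda>_. 0)(0 := mvar 1, 1 := mvar 2)) F)) F"

section \<open>Modules\<close>

text \<open>The ring \<open>Q\<close>, regarded as a module along a ring map \<open>\<phi>\<close> into it.\<close>

definition module_along :: "('b \<Rightarrow> 'c) \<Rightarrow> ('c, 'm) ring_scheme \<Rightarrow> ('b, 'c) module" where
  "module_along \<phi> Q = \<lparr>carrier = carrier Q, monoid.mult = monoid.mult Q, one = one Q,
     ring.zero = ring.zero Q, add = add Q, module.smult = (\<lambda>b u. \<phi> b \<otimes>\<^bsub>Q\<^esub> u)\<rparr>"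

definition freely_generated ::
    "('b, 'm) ring_scheme \<Rightarrow> ('b, 'c, 'n) module_scheme \<Rightarrow> 'i set \<Rightarrow> ('i \<Rightarrow> 'c) \<Rightarrow> bool" where
  "freely_generated B M J e \<longleftrightarrow>
     Module.module B M \<and> e \<in> J \<rightarrow> carrier M \<and>
     (\<forall>u \<in> carrier M. \<exists>!b. b \<in> J \<rightarrow>\<^sub>E carrier B \<and> finite {j \<in> J. b j \<noteq> \<zero>\<^bsub>B\<^esub>} \<and>
        u = (\<Oplus>\<^bsub>M\<^esub> j \<in> {j \<in> J. b j \<noteq> \<zero>\<^bsub>B\<^esub>}. b j \<odot>\<^bsub>M\<^esub> e j))"

definition module_homs ::
    "('b, 'm) ring_scheme \<Rightarrow> ('b, 'c, 'n) module_scheme \<Rightarrow> ('b, 'd, 'p) module_scheme \<Rightarrow> ('c \<Rightarrow> 'd) set"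
  where
  "module_homs B M N = {h \<in> carrier M \<rightarrow> carrier N.
     (\<forall>u \<in> carrier M. \<forall>v \<in> carrier M. h (u \<oplus>\<^bsub>M\<^esub> v) = h u \<oplus>\<^bsub>N\<^esub> h v) \<and>
     (\<forall>b \<in> carrier B. \<forall>u \<in> carrier M. h (b \<odot>\<^bsub>M\<^esub> u) = b \<odot>\<^bsub>N\<^esub> h u)}"

definition split_monomorphism ::
    "('b, 'm) ring_scheme \<Rightarrow> ('b, 'c, 'n) module_scheme \<Rightarrow> ('b, 'd, 'p) module_scheme \<Rightarrow> ('c \<Rightarrow> 'd) \<Rightarrow> bool"
  where
  "split_monomorphism B M N h \<longleftrightarrow>
     Module.module B M \<and> Module.module B N \<and> h \<in> module_homs B M N \<and>
     (\<exists>s \<in> module_homs B N M. \<forall>u \<in> carrier M. s (h u) = u)"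

section \<open>Pairs of divisors\<close>

text \<open>The monic polynomial \<open>x\<^sup>d + u\<^sub>1 x\<^sup>d\<^sup>-\<^sup>1 + \<dots> + u\<^sub>d\<close>; the value \<open>u 0\<close> is ignored.\<close>

definition divisor_eqn :: "nat \<Rightarrow> (nat \<Rightarrow> 'b) \<Rightarrow> 'b::comm_ring_1 poly" where
  "divisor_eqn d u = (\<Sum>i\<le>d. Polynomial.monom (if i = 0 then 1 else u i) (d - i))"

text \<open>The variable \<open>(i, j)\<close> is \<open>c\<^sub>i\<^sub>j\<close>; only \<open>i \<in> {0, 1}\<close> occurs.\<close>

definition c_vars :: "nat \<Rightarrow> nat \<Rightarrow> (nat \<times> nat) set" where
  "c_vars i d = {i} \<times> {1..d}"

definition taut_eqn :: "nat \<Rightarrow> nat \<Rightarrow> (nat \<times> nat, 'a::comm_ring_1) mfps poly" where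
  "taut_eqn i d = divisor_eqn d (\<lambda>j. mvar (i, j))"

definition O_DivDiv :: "'a::comm_ring_1 itself \<Rightarrow> nat \<Rightarrow> nat \<Rightarrow> (nat \<times> nat, 'a) mfps ring" where
  "O_DivDiv _ d0 d1 = psring (c_vars 0 d0 \<union> c_vars 1 d1)"

text \<open>The ring of the second factor is regarded as a subring of \<open>O_DivDiv\<close>.\<close>

definition O_Div1 :: "'a::comm_ring_1 itself \<Rightarrow> nat \<Rightarrow> (nat \<times> nat, 'a) mfps ring" where
  "O_Div1 _ d1 = psring (c_vars 1 d1)"

definition sylvester :: "nat \<Rightarrow> nat \<Rightarrow> (nat \<times> nat, 'a::comm_ring_1) mfps mat" where
  "sylvester d0 d1 = mat (d0 + d1) (d0 + d1) (\<lambda>(i, j).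
     if j < d1 then Polynomial.coeff (Polynomial.monom 1 j * taut_eqn 0 d0) i
     else Polynomial.coeff (Polynomial.monom 1 (j - d1) * taut_eqn 1 d1) i)"

definition minors :: "nat \<Rightarrow> 'b::comm_ring_1 mat \<Rightarrow> 'b set" where
  "minors s A = {det (submatrix A P Q) | P Q.
     P \<subseteq> {..<dim_row A} \<and> Q \<subseteq> {..<dim_col A} \<and> card P = s \<and> card Q = s}"

definition int_ideal :: "'a::comm_ring_1 itself \<Rightarrow> nat \<Rightarrow> nat \<Rightarrow> nat \<Rightarrow> (nat \<times> nat, 'a) mfps set" where
  "int_ideal T d0 d1 r = genideal (O_DivDiv T d0 d1) (minors (d0 + d1 - r + 1) (sylvester d0 d1))"

definition O_Int :: "'a::comm_ring_1 itself \<Rightarrow> nat \<Rightarrow> nat \<Rightarrow> nat \<Rightarrow> (nat \<times> nat, 'a) mfps set ring" where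
  "O_Int T d0 d1 r = O_DivDiv T d0 d1 Quot int_ideal T d0 d1 r"

definition int_class ::
    "'a::comm_ring_1 itself \<Rightarrow> nat \<Rightarrow> nat \<Rightarrow> nat \<Rightarrow> (nat \<times> nat, 'a) mfps \<Rightarrow> (nat \<times> nat, 'a) mfps set" where
  "int_class T d0 d1 r F = int_ideal T d0 d1 r +>\<^bsub>O_DivDiv T d0 d1\<^esub> F"

definition int_exponents :: "nat \<Rightarrow> nat \<Rightarrow> nat \<Rightarrow> (nat \<Rightarrow> nat) set" where
  "int_exponents d0 d1 r =
     {\<alpha> \<in> {d0 - r + 1..d0} \<rightarrow>\<^sub>E UNIV. (\<Sum>i = d0 - r + 1..d0. \<alpha> i) \<le> d1 - r}"

definition c0_monomial :: "nat \<Rightarrow> nat \<Rightarrow> (nat \<Rightarrow> nat) \<Rightarrow> (nat \<times> nat, 'a::comm_ring_1) mfps" where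
  "c0_monomial d0 r \<alpha> = (\<Prod>i = d0 - r + 1..d0. mvar (0, i) ^ \<alpha> i)"

section \<open>Pairs of divisors with a common subdivisor\<close>

datatype sub_var = AVar nat | BVar nat | CVar nat

definition O_Sub :: "'a::comm_ring_1 itself \<Rightarrow> nat \<Rightarrow> nat \<Rightarrow> nat \<Rightarrow> (sub_var, 'a) mfps ring" where
  "O_Sub _ d0 d1 r =
     psring (AVar ` {1..d0 - r} \<union> BVar ` {1..d1 - r} \<union> CVar ` {1..r})"

definition sub_f :: "nat \<Rightarrow> nat \<Rightarrow> (sub_var, 'a::comm_ring_1) mfps poly" where
  "sub_f d0 r = divisor_eqn (d0 - r) (\<lambda>i. mvar (AVar i))"

definition sub_g :: "nat \<Rightarrow> nat \<Rightarrow> (sub_var, 'a::comm_ring_1) mfps poly" where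
  "sub_g d1 r = divisor_eqn (d1 - r) (\<lambda>i. mvar (BVar i))"

definition sub_h :: "nat \<Rightarrow> (sub_var, 'a::comm_ring_1) mfps poly" where
  "sub_h r = divisor_eqn r (\<lambda>i. mvar (CVar i))"

text \<open>
  The images of the variables \<open>c\<^sub>i\<^sub>j\<close> under the map given by \<open>f\<^sub>0 \<mapsto> fh\<close>, \<open>f\<^sub>1 \<mapsto> gh\<close>: recall that
  \<open>c\<^sub>i\<^sub>j\<close> is the coefficient of \<open>x\<close> to the power \<open>d\<^sub>i - j\<close> in \<open>f\<^sub>i\<close>.
\<close>

definition sub_image :: "nat \<Rightarrow> nat \<Rightarrow> nat \<Rightarrow> nat \<times> nat \<Rightarrow> (sub_var, 'a::comm_ring_1) mfps" where
  "sub_image d0 d1 r = (\<lambda>(i, j).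
     if i = 0 then Polynomial.coeff (sub_f d0 r * sub_h r) (d0 - j)
     else Polynomial.coeff (sub_g d1 r * sub_h r) (d1 - j))"

text \<open>The ring map of \<open>Sub\<^sub>r(d\<^sub>0, d\<^sub>1) \<rightarrow> Div\<^sub>d\<^sub>0 \<times> Div\<^sub>d\<^sub>1\<close>.\<close>

definition sub_map ::
    "nat \<Rightarrow> nat \<Rightarrow> nat \<Rightarrow> (nat \<times> nat, 'a::comm_ring_1) mfps \<Rightarrow> (sub_var, 'a) mfps" where
  "sub_map d0 d1 r = msubst (sub_image d0 d1 r)"

text \<open>
  The induced map on \<open>O_Int\<close>, on whose elements (cosets of \<open>int_ideal\<close>) \<open>sub_map\<close> is constant
  because it annihilates the ideal.
\<close>

definition pi_star ::
    "nat \<Rightarrow> nat \<Rightarrow> nat \<Rightarrow> (nat \<times> nat, 'a::comm_ring_1) mfps set \<Rightarrow> (sub_var, 'a) mfps" where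
  "pi_star d0 d1 r U = the_elem (sub_map d0 d1 r ` U)"

end

theory Submission
  imports Defs
begin

text \<open>
  Write \<open>m = d\<^sub>0 - r\<close>, \<open>s = d\<^sub>1 - r\<close>, let \<open>P\<close> be the ring in the \<open>c\<^sub>0\<^sub>i\<close> with \<open>i \<le> m\<close> and all \<open>c\<^sub>1\<^sub>j\<close>, and
  consider monomials of degree at most \<open>s\<close> in \<open>r\<close> variables.  Three statements are needed.

  (1) Over \<open>\<O>\<^sub>S[[a, c\<^sub>1]]\<close> the ring \<open>\<O>\<^sub>S[[a, b, c]]\<close> of \<open>Sub\<^sub>r\<close> is free on such monomials in the \<open>c\<^sub>i\<close>.
  Generation and independence are both proved by induction on \<open>r + s\<close>: setting \<open>c\<^sub>r = 0\<close> lowers \<open>r\<close>,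
  and after division by \<open>c\<^sub>r\<close>, setting \<open>b\<^sub>s = 0\<close> lowers \<open>s\<close>; what remains is divisible by \<open>b\<^sub>s c\<^sub>r\<close>,
  the image of the last \<open>c\<^sub>1\<^sub>j\<close>, and one iterates.

  (2) The monomials in the last \<open>r\<close> variables \<open>c\<^sub>0\<^sub>i\<close> generate \<open>R/I\<close> over \<open>P\<close>.  The induction is the
  same: modulo the constant terms of \<open>f\<^sub>0\<close> and \<open>f\<^sub>1\<close> one can divide both by \<open>x\<close>, and modulo the
  constant term of \<open>f\<^sub>1\<close> one can divide \<open>f\<^sub>1\<close> by \<open>x\<close>, at the cost of multiplying minors by the
  constant term of \<open>f\<^sub>0\<close>.

  (3) The composite of the free module on these monomials with \<open>\<pi>\<^sup>*\<close> has a retraction that is linear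
  over the ring of \<open>D\<^sub>1\<close>.  For suitable weights the leading terms of the images of \<open>c\<^sub>0\<^sub>i\<close> and
  \<open>c\<^sub>0\<^sub>,\<^sub>m\<^sub>+\<^sub>i\<close> are \<open>a\<^sub>i\<close> and \<open>a\<^sub>m c\<^sub>i\<close>.  Replacing the images by these leading terms gives, by (1), a
  map with an evident retraction; composing this retraction with the true map gives \<open>1 - \<nu>\<close> with
  \<open>\<nu>\<close> raising weights, which is inverted by a Neumann series.

  Since \<open>\<pi>\<^sup>*\<close> kills \<open>I\<close>, (2) and (3) show that the generators are free and that \<open>\<pi>\<^sup>*\<close> splits.
\<close>

text \<open>The obstacle in (3): by (1) the ring of subdivisors is free along the map that sends
  \<open>c_0i\<close> to \<open>a_i\<close>, whereas the true map sends \<open>c_0i\<close> to a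
  coefficient of \<open>fh\<close>. The two maps agree on the \<open>c_1j\<close> only, which is why
  linearity is obtained over the ring of D_1. To compare them, \<open>a_i\<close> gets weight i, and
  \<open>b_i\<close> and \<open>c_i\<close> get weight 2i. Then \<open>a_l c_(j-l)\<close> has
  weight 2j - l, so among the terms of the coefficient with index j of \<open>fh\<close> the one
  with l = min(j, m) is the unique lowest, while the coefficients of \<open>gh\<close> are
  homogeneous. The leading map sends the monomial with exponent \<alpha> to
  \<open>a_m^|\<alpha>| c^\<alpha>\<close>, so its retraction takes coordinates as in (1) and
  divides them by powers of \<open>a_m\<close>. Division is extended to all series by dropping the
  terms without \<open>a_m\<close>; this is additive and linear over series free of
  \<open>a_m\<close>, in particular over those in the \<open>c_1j\<close>. The coefficients form an
  arbitrary commutative ring, so ranks and lengths are of no help: the cancellations use only that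
  variables are non-zero-divisors, and convergence is measured by weights.\<close>

type_synonym 'a cseries = "(nat \<times> nat, 'a) mfps"
type_synonym 'a sseries = "(sub_var, 'a) mfps"

section \<open>Power series: supports, weights and infinite sums\<close>

definition ps :: "'v set \<Rightarrow> ('v, 'a::comm_ring_1) mfps set" where
  "ps V = {F. \<forall>m. mcoeff F m \<noteq> 0 \<longrightarrow> Poly_Mapping.keys m \<subseteq> V}"

lemma carrier_psring: "carrier (psring V) = ps V"
  by (auto simp: psring_def ps_def mfps_vars_def)

lemma mcoeff_Abs [simp]: "mcoeff (Abs_mfps f) = f"
  by (simp add: Abs_mfps_inverse)

lemma mcoeff_0 [simp]: "mcoeff 0 m = 0"
  by (simp add: zero_mfps.rep_eq)

lemma mcoeff_1: "mcoeff 1 m = (if m = 0 then 1 else 0)"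
  by (simp add: one_mfps.rep_eq)

lemma mcoeff_add [simp]: "mcoeff (F + G) m = mcoeff F m + mcoeff G m"
  by (simp add: plus_mfps.rep_eq)

lemma mcoeff_diff [simp]: "mcoeff (F - G) m = mcoeff F m - mcoeff G m"
  by (simp add: minus_mfps.rep_eq)

lemma mcoeff_uminus [simp]: "mcoeff (- F) m = - mcoeff F m"
  by (simp add: uminus_mfps.rep_eq)

lemma mcoeff_sum [simp]: "mcoeff (\<Sum>i\<in>A. F i) m = (\<Sum>i\<in>A. mcoeff (F i) m)"
  by (induction A rule: infinite_finite_induct) auto

lemma mcoeff_times:
  "mcoeff (F * G) m = (\<Sum>(p, q) \<in> {(p, q). p + q = m}. mcoeff F p * mcoeff G q)"
  by (simp add: times_mfps.rep_eq)

lemma mcoeff_times_nonzero: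
  assumes "mcoeff (F * G) m \<noteq> 0"
  obtains p q where "m = p + q" "mcoeff F p \<noteq> 0" "mcoeff G q \<noteq> 0"
proof -
  have "\<exists>x \<in> {(p, q). p + q = m}. (case x of (p, q) \<Rightarrow> mcoeff F p * mcoeff G q) \<noteq> 0"
    using assms unfolding mcoeff_times by (rule contrapos_np) (auto intro: sum.neutral)
  then show thesis
    using that by (auto; metis mult_zero_left mult_zero_right)
qed

lemma keys_plus_nat: "Poly_Mapping.keys (p + q :: 'v \<Rightarrow>\<^sub>0 nat) = Poly_Mapping.keys p \<union> Poly_Mapping.keys q"
  by (auto simp: Poly_Mapping.in_keys_iff lookup_add)

lemma ps_times: "F \<in> ps V \<Longrightarrow> G \<in> ps V \<Longrightarrow> F * G \<in> ps V"
  unfolding ps_def by (auto elim!: mcoeff_times_nonzero simp: keys_plus_nat) blast+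

lemma ps_add: "F \<in> ps V \<Longrightarrow> G \<in> ps V \<Longrightarrow> F + G \<in> ps V"
  unfolding ps_def by (auto, metis add_0 subsetD)

lemma ps_uminus: "F \<in> ps V \<Longrightarrow> - F \<in> ps V"
  unfolding ps_def by auto

lemma ps_diff: "F \<in> ps V \<Longrightarrow> G \<in> ps V \<Longrightarrow> F - G \<in> ps V"
  using ps_add[of F V "- G"] ps_uminus[of G V] by simp

lemma ps_0 [simp]: "0 \<in> ps V"
  unfolding ps_def by auto

lemma ps_1 [simp]: "1 \<in> ps V"
  unfolding ps_def by (auto simp: mcoeff_1 split: if_splits)

lemma ps_sum: "(\<And>i. i \<in> A \<Longrightarrow> F i \<in> ps V) \<Longrightarrow> (\<Sum>i\<in>A. F i) \<in> ps V"
  by (induction A rule: infinite_finite_induct) (auto intro: ps_add)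

lemma ps_prod: "(\<And>i. i \<in> A \<Longrightarrow> F i \<in> ps V) \<Longrightarrow> (\<Prod>i\<in>A. F i) \<in> ps V"
  by (induction A rule: infinite_finite_induct) (auto intro: ps_times)

lemma ps_power: "F \<in> ps V \<Longrightarrow> F ^ n \<in> ps V"
  by (induction n) (auto intro: ps_times)

lemma ps_mono: "F \<in> ps V \<Longrightarrow> V \<subseteq> W \<Longrightarrow> F \<in> ps W"
  unfolding ps_def by auto

lemma mcoeff_mvar: "mcoeff (mvar v) m = (if m = Poly_Mapping.single v 1 then 1 else 0)"
  by (simp add: mvar.rep_eq)

lemma ps_mvar: "v \<in> V \<Longrightarrow> mvar v \<in> ps V"
  unfolding ps_def by (auto simp: mcoeff_mvar split: if_splits)

definition Mon :: "('v \<Rightarrow>\<^sub>0 nat) \<Rightarrow> 'a \<Rightarrow> ('v, 'a::comm_ring_1) mfps" where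
  "Mon n c = Abs_mfps (\<lambda>m. if m = n then c else 0)"

lemma mcoeff_Mon: "mcoeff (Mon n c) m = (if m = n then c else 0)"
  by (simp add: Mon_def)

lemma mvar_eq_Mon: "mvar v = Mon (Poly_Mapping.single v 1) 1"
  by (rule mfps_eqI) (simp add: mcoeff_mvar mcoeff_Mon)

lemma one_eq_Mon: "1 = Mon 0 1"
  by (rule mfps_eqI) (simp add: mcoeff_1 mcoeff_Mon)

lemma mcoeff_Mon_times: "mcoeff (Mon n c * F) (n + q) = c * mcoeff F q"
proof -
  have "mcoeff (Mon n c * F) (n + q)
      = (\<Sum>(x, y) \<in> {(x, y). x + y = n + q}. mcoeff (Mon n c) x * mcoeff F y)"
    by (rule mcoeff_times)
  also have "\<dots> = (\<Sum>(x, y) \<in> {(n, q)}. mcoeff (Mon n c) x * mcoeff F y)"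
    by (rule sum.mono_neutral_right) (auto intro: finite_mono_sums simp: mcoeff_Mon split: if_splits)
  finally show ?thesis by (simp add: mcoeff_Mon)
qed

lemma mcoeff_Mon_times_0: "(\<And>q. m \<noteq> n + q) \<Longrightarrow> mcoeff (Mon n c * F) m = 0"
  by (rule ccontr) (erule mcoeff_times_nonzero, auto simp: mcoeff_Mon split: if_splits)

lemma Mon_times: "Mon p c * Mon q d = Mon (p + q) (c * d)"
proof (rule mfps_eqI)
  fix m
  show "mcoeff (Mon p c * Mon q d) m = mcoeff (Mon (p + q) (c * d)) m"
  proof (cases "\<exists>x. m = p + x")
    case True
    then show ?thesis by (auto simp: mcoeff_Mon_times mcoeff_Mon)
  next
    case False
    then show ?thesis using mcoeff_Mon_times_0[of m p] by (auto simp: mcoeff_Mon)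
  qed
qed

section \<open>Weights of monomials, the filtration of series by weight, and convergent sums\<close>

definition wt :: "('v \<Rightarrow> nat) \<Rightarrow> ('v \<Rightarrow>\<^sub>0 nat) \<Rightarrow> nat" where
  "wt w m = (\<Sum>v\<in>Poly_Mapping.keys m. w v * Poly_Mapping.lookup m v)"

lemma wt_superset:
  "finite S \<Longrightarrow> Poly_Mapping.keys m \<subseteq> S \<Longrightarrow> wt w m = (\<Sum>v\<in>S. w v * Poly_Mapping.lookup m v)"
  unfolding wt_def by (rule sum.mono_neutral_left) (auto simp: Poly_Mapping.in_keys_iff)

lemma wt_add: "wt w (m + n) = wt w m + wt w n"
proof -
  let ?S = "Poly_Mapping.keys m \<union> Poly_Mapping.keys n"
  have "wt w (m + n) = (\<Sum>v\<in>?S. w v * Poly_Mapping.lookup (m + n) v)"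
    by (rule wt_superset) (auto simp: keys_plus_nat)
  moreover have "wt w m = (\<Sum>v\<in>?S. w v * Poly_Mapping.lookup m v)"
    by (rule wt_superset) auto
  moreover have "wt w n = (\<Sum>v\<in>?S. w v * Poly_Mapping.lookup n v)"
    by (rule wt_superset) auto
  ultimately show ?thesis
    by (simp add: lookup_add algebra_simps sum.distrib)
qed

lemma wt_0 [simp]: "wt w 0 = 0"
  by (simp add: wt_def)

lemma wt_single [simp]: "wt w (Poly_Mapping.single v k) = w v * k"
  by (simp add: wt_def)

lemma finite_wt_less:
  assumes "finite V" "\<And>v. v \<in> V \<Longrightarrow> 0 < w v"
  shows "finite {n. Poly_Mapping.keys n \<subseteq> V \<and> wt w n < D}" (is "finite ?S")
proof -
  let ?f = "\<lambda>n. restrict (Poly_Mapping.lookup n) V"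
  have "inj_on ?f ?S"
  proof (rule inj_onI)
    fix p q assume p: "p \<in> ?S" and q: "q \<in> ?S" and eq: "?f p = ?f q"
    show "p = q"
    proof (rule poly_mapping_eqI)
      fix v
      show "Poly_Mapping.lookup p v = Poly_Mapping.lookup q v"
      proof (cases "v \<in> V")
        case True
        then show ?thesis using fun_cong[OF eq, of v] by simp
      next
        case False
        then show ?thesis using p q by (metis (no_types, lifting) Poly_Mapping.in_keys_iff mem_Collect_eq subsetD)
      qed
    qed
  qed
  moreover have "?f ` ?S \<subseteq> (\<Pi>\<^sub>E v\<in>V. {..D})"
  proof (clarsimp simp: PiE_iff)
    fix n v assume n: "Poly_Mapping.keys n \<subseteq> V" "wt w n < D" and v: "v \<in> V"
    have "w v * Poly_Mapping.lookup n v \<le> (\<Sum>v\<in>V. w v * Poly_Mapping.lookup n v)"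
      by (rule member_le_sum) (use v assms in auto)
    also have "\<dots> = wt w n"
      using n assms(1) by (simp add: wt_superset)
    finally show "Poly_Mapping.lookup n v \<le> D"
      using n(2) assms(2)[OF v] by (metis le_trans less_imp_le mult_le_mono1 nat_mult_1 Suc_leI One_nat_def)
  qed
  then have "finite (?f ` ?S)"
    by (rule finite_subset) (use assms(1) in \<open>auto intro: finite_PiE\<close>)
  ultimately show ?thesis using finite_imageD by blast
qed

definition fil :: "('v \<Rightarrow> nat) \<Rightarrow> nat \<Rightarrow> ('v, 'a::comm_ring_1) mfps set" where
  "fil w d = {F. \<forall>m. mcoeff F m \<noteq> 0 \<longrightarrow> d \<le> wt w m}"

lemma filD: "F \<in> fil w d \<Longrightarrow> wt w m < d \<Longrightarrow> mcoeff F m = 0"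
  unfolding fil_def by fastforce

lemma filI: "(\<And>m. wt w m < d \<Longrightarrow> mcoeff F m = 0) \<Longrightarrow> F \<in> fil w d"
  unfolding fil_def by (auto intro: leI)

lemma fil_times: "F \<in> fil w d \<Longrightarrow> G \<in> fil w e \<Longrightarrow> F * G \<in> fil w (d + e)"
  unfolding fil_def by (auto elim!: mcoeff_times_nonzero simp: wt_add intro!: add_mono)

lemma fil_0 [simp]: "F \<in> fil w 0"
  unfolding fil_def by auto

lemma zero_fil [simp]: "0 \<in> fil w d"
  unfolding fil_def by auto

lemma fil_mono: "F \<in> fil w d \<Longrightarrow> e \<le> d \<Longrightarrow> F \<in> fil w e"
  unfolding fil_def by (auto intro: le_trans)

lemma fil_add: "F \<in> fil w d \<Longrightarrow> G \<in> fil w d \<Longrightarrow> F + G \<in> fil w d"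
  by (rule filI) (simp add: filD)

lemma fil_uminus: "F \<in> fil w d \<Longrightarrow> - F \<in> fil w d"
  by (rule filI) (simp add: filD)

lemma fil_diff: "F \<in> fil w d \<Longrightarrow> G \<in> fil w d \<Longrightarrow> F - G \<in> fil w d"
  by (rule filI) (simp add: filD)

lemma fil_sum: "(\<And>i. i \<in> A \<Longrightarrow> F i \<in> fil w d) \<Longrightarrow> (\<Sum>i\<in>A. F i) \<in> fil w d"
  by (rule filI) (auto intro!: sum.neutral filD)

lemma fil_mult_left: "G \<in> fil w e \<Longrightarrow> F * G \<in> fil w e"
  using fil_times[of F w 0 G e] by simp

lemma fil_power: "F \<in> fil w d \<Longrightarrow> F ^ n \<in> fil w (d * n)"
  by (induction n) (auto dest: fil_times)

lemma fil_prod: "(\<And>i. i \<in> A \<Longrightarrow> F i \<in> fil w (d i)) \<Longrightarrow> (\<Prod>i\<in>A. F i) \<in> fil w (\<Sum>i\<in>A. d i)"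
  by (induction A rule: infinite_finite_induct) (auto intro: fil_times)

lemma fil_mvar: "mvar v \<in> fil w (w v)"
  by (rule filI) (auto simp: mcoeff_mvar)

lemma fil_all_imp_0: "(\<And>d. F \<in> fil w d) \<Longrightarrow> F = 0"
  by (rule mfps_eqI) (metis filD lessI mcoeff_0)

text \<open>The value is meaningful when the \<open>i\<close>-th term has order at least \<open>i\<close>.\<close>

definition isum :: "('v \<Rightarrow> nat) \<Rightarrow> (nat \<Rightarrow> ('v, 'a::comm_ring_1) mfps) \<Rightarrow> ('v, 'a) mfps" where
  "isum w G = Abs_mfps (\<lambda>m. \<Sum>i\<le>wt w m. mcoeff (G i) m)"

lemma mcoeff_isum:
  assumes "\<And>i. G i \<in> fil w i" "wt w m < N"
  shows "mcoeff (isum w G) m = (\<Sum>i<N. mcoeff (G i) m)"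
proof -
  have "(\<Sum>i<N. mcoeff (G i) m) = (\<Sum>i\<le>wt w m. mcoeff (G i) m)"
    proof (rule sum.mono_neutral_right)
    show "\<forall>i\<in>{..<N} - {..wt w m}. mcoeff (G i) m = 0"
      using filD[OF assms(1)] by auto
  qed (use assms in auto)
  then show ?thesis by (simp add: isum_def)
qed

lemma isum_approx:
  assumes "\<And>i. G i \<in> fil w i"
  shows "isum w G - (\<Sum>i<N. G i) \<in> fil w N"
  by (rule filI) (simp add: mcoeff_isum[OF assms])

lemma isum_ps: "(\<And>i. G i \<in> ps V) \<Longrightarrow> isum w G \<in> ps V"
  unfolding ps_def isum_def mcoeff_Abs
  by (auto elim!: sum.not_neutral_contains_not_neutral simp: subset_iff)

lemma isum_fil: "(\<And>i. G i \<in> fil w' d) \<Longrightarrow> isum w G \<in> fil w' d"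
  by (rule filI) (auto simp: isum_def intro!: sum.neutral filD)

lemma isum_add: "isum w (\<lambda>i. G i + H i) = isum w G + isum w H"
  by (rule mfps_eqI) (simp add: isum_def sum.distrib)

lemma isum_mult:
  assumes "\<And>i. G i \<in> fil w i"
  shows "isum w (\<lambda>i. F * G i) = F * isum w G"
proof -
  have FG: "F * G i \<in> fil w i" for i
    using assms by (rule fil_mult_left)
  have "isum w (\<lambda>i. F * G i) - F * isum w G \<in> fil w d" for d
  proof -
    have "F * (isum w G - (\<Sum>i<d. G i)) \<in> fil w d"
      by (rule fil_mult_left, rule isum_approx, rule assms)
    with isum_approx[of "\<lambda>i. F * G i" w d, OF FG]
    have "(isum w (\<lambda>i. F * G i) - (\<Sum>i<d. F * G i)) - F * (isum w G - (\<Sum>i<d. G i)) \<in> fil w d"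
      by (rule fil_diff)
    then show ?thesis by (simp add: algebra_simps sum_distrib_left)
  qed
  then show ?thesis using fil_all_imp_0 by (metis eq_iff_diff_eq_0)
qed

section \<open>Substitution is a ring homomorphism\<close>

text \<open>Below weight \<open>D\<close> a series in finitely many variables of positive weight has
  finitely many terms, and the rest is sent to order at least \<open>D\<close>. So
  \<open>h F\<close> has arbitrarily high order. Multiplicativity and composition of substitutions
  are reduced to monomials in this way.\<close>

lemma vanish_from_monomials:
  fixes h :: "('v, 'a::comm_ring_1) mfps \<Rightarrow> ('w, 'b::comm_ring_1) mfps"
  assumes V: "finite V" "\<And>v. v \<in> V \<Longrightarrow> 0 < w v"
    and add: "\<And>F G. F \<in> ps V \<Longrightarrow> G \<in> ps V \<Longrightarrow> h (F + G) = h F + h G"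
    and cont: "\<And>F d. F \<in> ps V \<Longrightarrow> F \<in> fil w d \<Longrightarrow> h F \<in> fil w' d"
    and mon: "\<And>n c. Poly_Mapping.keys n \<subseteq> V \<Longrightarrow> h (Mon n c) = 0"
    and F: "F \<in> ps V"
  shows "h F = 0"
proof (rule fil_all_imp_0)
  fix D
  let ?S = "{n. Poly_Mapping.keys n \<subseteq> V \<and> wt w n < D}"
  have S: "finite ?S" using V by (rule finite_wt_less)
  define T where "T = (\<Sum>n\<in>?S. Mon n (mcoeff F n))"
  have Mps: "Mon n c \<in> ps V" if "Poly_Mapping.keys n \<subseteq> V" for n and c :: 'a
    using that by (auto simp: ps_def mcoeff_Mon split: if_splits)
  have Tps: "T \<in> ps V" unfolding T_def by (rule ps_sum) (use Mps in auto)
  have h0: "h 0 = 0" using add[of 0 0] by simp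
  have hsum: "finite A \<Longrightarrow> (\<And>i. i \<in> A \<Longrightarrow> G i \<in> ps V) \<Longrightarrow> h (\<Sum>i\<in>A. G i) = (\<Sum>i\<in>A. h (G i))" for A G
    by (induction A rule: finite_induct) (auto simp: h0 add ps_sum)
  have "h T = 0" unfolding T_def by (subst hsum) (use S Mps mon in auto)
  have "mcoeff T m = (if m \<in> ?S then mcoeff F m else 0)" for m
    unfolding T_def mcoeff_sum mcoeff_Mon using S by (rule sum.delta')
  moreover have "mcoeff F m = 0" if "\<not> Poly_Mapping.keys m \<subseteq> V" for m
    using F that by (auto simp: ps_def)
  ultimately have "F - T \<in> fil w D"
    by (intro filI) auto
  then have "h (F - T) \<in> fil w' D" using cont ps_diff[OF F Tps] by blast
  moreover have "h F = h (F - T) + h T"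
    using add[OF ps_diff[OF F Tps] Tps] by simp
  ultimately show "h F \<in> fil w' D" using \<open>h T = 0\<close> by simp
qed

definition monim :: "('v \<Rightarrow> ('w, 'a::comm_ring_1) mfps) \<Rightarrow> ('v \<Rightarrow>\<^sub>0 nat) \<Rightarrow> ('w, 'a) mfps" where
  "monim \<phi> n = (\<Prod>v\<in>Poly_Mapping.keys n. \<phi> v ^ Poly_Mapping.lookup n v)"

lemma monim_superset:
  "finite S \<Longrightarrow> Poly_Mapping.keys n \<subseteq> S \<Longrightarrow> monim \<phi> n = (\<Prod>v\<in>S. \<phi> v ^ Poly_Mapping.lookup n v)"
  unfolding monim_def by (rule prod.mono_neutral_left) (auto simp: Poly_Mapping.in_keys_iff)

lemma monim_add: "monim \<phi> (m + n) = monim \<phi> m * monim \<phi> n"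
proof -
  let ?S = "Poly_Mapping.keys m \<union> Poly_Mapping.keys n"
  have "monim \<phi> (m + n) = (\<Prod>v\<in>?S. \<phi> v ^ Poly_Mapping.lookup (m + n) v)"
    by (rule monim_superset) (auto simp: keys_plus_nat)
  moreover have "monim \<phi> m = (\<Prod>v\<in>?S. \<phi> v ^ Poly_Mapping.lookup m v)"
    by (rule monim_superset) auto
  moreover have "monim \<phi> n = (\<Prod>v\<in>?S. \<phi> v ^ Poly_Mapping.lookup n v)"
    by (rule monim_superset) auto
  ultimately show ?thesis
    by (simp add: lookup_add power_add prod.distrib)
qed

lemma monim_fil:
  "(\<And>v. v \<in> Poly_Mapping.keys n \<Longrightarrow> \<phi> v \<in> fil w' (w v)) \<Longrightarrow> monim \<phi> n \<in> fil w' (wt w n)"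
  unfolding monim_def wt_def by (intro fil_prod fil_power)

lemma mcoeff_msubst: "mcoeff (msubst \<phi> F) m = Sum_any (\<lambda>n. mcoeff F n * mcoeff (monim \<phi> n) m)"
  by (simp add: msubst_def monim_def)

lemma msubst_cong:
  assumes "F \<in> ps V" "\<And>v. v \<in> V \<Longrightarrow> \<phi> v = \<psi> v"
  shows "msubst \<phi> F = msubst \<psi> F"
proof (rule mfps_eqI)
  fix m
  have "mcoeff F n * mcoeff (monim \<phi> n) m = mcoeff F n * mcoeff (monim \<psi> n) m" for n
  proof (cases "mcoeff F n = 0")
    case False
    then have "Poly_Mapping.keys n \<subseteq> V" using assms(1) by (auto simp: ps_def)
    then have "monim \<phi> n = monim \<psi> n"
      using assms(2) unfolding monim_def by (intro prod.cong) (auto simp: subset_iff)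
    then show ?thesis by simp
  qed simp
  then show "mcoeff (msubst \<phi> F) m = mcoeff (msubst \<psi> F) m"
    by (simp add: mcoeff_msubst)
qed

lemma msubst_ps:
  assumes "F \<in> ps V" "\<And>v. v \<in> V \<Longrightarrow> \<phi> v \<in> ps W"
  shows "msubst \<phi> F \<in> ps W"
proof -
  have "Poly_Mapping.keys m \<subseteq> W" if "mcoeff (msubst \<phi> F) m \<noteq> 0" for m
  proof -
    from that obtain n where "mcoeff F n * mcoeff (monim \<phi> n) m \<noteq> 0"
      unfolding mcoeff_msubst by (rule Sum_any.not_neutral_obtains_not_neutral)
    then have n: "mcoeff F n \<noteq> 0" "mcoeff (monim \<phi> n) m \<noteq> 0" by auto
    then have "Poly_Mapping.keys n \<subseteq> V" using assms(1) by (auto simp: ps_def)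
    then have "monim \<phi> n \<in> ps W"
      using assms(2) unfolding monim_def by (intro ps_prod ps_power) auto
    then show ?thesis using n by (auto simp: ps_def)
  qed
  then show ?thesis by (auto simp: ps_def)
qed

lemma msubst_Mon: "msubst \<phi> (Mon n c) = Mon 0 c * monim \<phi> n"
proof (rule mfps_eqI)
  fix m
  have "mcoeff (msubst \<phi> (Mon n c)) m = (\<Sum>k\<in>{n}. mcoeff (Mon n c) k * mcoeff (monim \<phi> k) m)"
    unfolding mcoeff_msubst by (rule Sum_any.expand_superset) (auto simp: mcoeff_Mon split: if_splits)
  then show "mcoeff (msubst \<phi> (Mon n c)) m = mcoeff (Mon 0 c * monim \<phi> n) m"
    using mcoeff_Mon_times[of 0 c "monim \<phi> n" m] by (simp add: mcoeff_Mon)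
qed

lemma msubst_one: "msubst \<phi> 1 = 1"
  using msubst_Mon[of \<phi> 0 1] by (simp add: one_eq_Mon[symmetric] monim_def)

lemma msubst_zero: "msubst \<phi> 0 = 0"
  by (rule mfps_eqI) (simp add: mcoeff_msubst)

text \<open>Weights on both sides make the sum in \<open>msubst\<close> finite at each coefficient:
  a monomial of weight at least \<open>D\<close> contributes only in weight at least
  \<open>D\<close>. They are parameters because the leading-term argument needs weights other than
  the degree.\<close>

locale substitution =
  fixes V :: "'v set" and w :: "'v \<Rightarrow> nat" and w' :: "'w \<Rightarrow> nat"
    and \<phi> :: "'v \<Rightarrow> ('w, 'a::comm_ring_1) mfps"
  assumes finite_V: "finite V" and w_pos: "v \<in> V \<Longrightarrow> 0 < w v"
    and image_fil: "v \<in> V \<Longrightarrow> \<phi> v \<in> fil w' (w v)"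
begin

lemma mcoeff_finite:
  assumes "F \<in> ps V" "wt w' m < D"
  shows "mcoeff (msubst \<phi> F) m
    = (\<Sum>n\<in>{n. Poly_Mapping.keys n \<subseteq> V \<and> wt w n < D}. mcoeff F n * mcoeff (monim \<phi> n) m)"
  unfolding mcoeff_msubst
proof (rule Sum_any.expand_superset)
  show "finite {n. Poly_Mapping.keys n \<subseteq> V \<and> wt w n < D}"
    using finite_V w_pos by (rule finite_wt_less)
  show "{n. mcoeff F n * mcoeff (monim \<phi> n) m \<noteq> 0} \<subseteq> {n. Poly_Mapping.keys n \<subseteq> V \<and> wt w n < D}"
  proof clarify
    fix n assume *: "mcoeff F n * mcoeff (monim \<phi> n) m \<noteq> 0"
    then have "mcoeff F n \<noteq> 0" "mcoeff (monim \<phi> n) m \<noteq> 0" by auto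
    then have n: "Poly_Mapping.keys n \<subseteq> V" using assms(1) by (auto simp: ps_def)
    have "monim \<phi> n \<in> fil w' (wt w n)"
      using n by (intro monim_fil image_fil) auto
    then have "wt w n \<le> wt w' m"
      using \<open>mcoeff (monim \<phi> n) m \<noteq> 0\<close> by (auto simp: fil_def)
    then show "Poly_Mapping.keys n \<subseteq> V \<and> wt w n < D" using n assms(2) by simp
  qed
qed

lemma add: "F \<in> ps V \<Longrightarrow> G \<in> ps V \<Longrightarrow> msubst \<phi> (F + G) = msubst \<phi> F + msubst \<phi> G"
  by (rule mfps_eqI)
    (simp add: mcoeff_finite[OF _ lessI] ps_add algebra_simps sum.distrib)

lemma fil_image:
  assumes "F \<in> ps V" "F \<in> fil w d"
  shows "msubst \<phi> F \<in> fil w' d"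
proof (rule filI)
  fix m assume "wt w' m < d"
  then show "mcoeff (msubst \<phi> F) m = 0"
    by (subst mcoeff_finite[OF assms(1)]) (auto intro!: sum.neutral simp: filD[OF assms(2)])
qed

lemma sum: "(\<And>i. i \<in> A \<Longrightarrow> F i \<in> ps V) \<Longrightarrow> msubst \<phi> (\<Sum>i\<in>A. F i) = (\<Sum>i\<in>A. msubst \<phi> (F i))"
  by (induction A rule: infinite_finite_induct) (auto simp: msubst_zero add ps_sum)

lemma uminus: "F \<in> ps V \<Longrightarrow> msubst \<phi> (- F) = - msubst \<phi> F"
  using add[of F "- F"] by (simp add: ps_uminus msubst_zero add_eq_0_iff)

lemma diff: "F \<in> ps V \<Longrightarrow> G \<in> ps V \<Longrightarrow> msubst \<phi> (F - G) = msubst \<phi> F - msubst \<phi> G"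
  using add[of F "- G"] by (simp add: ps_uminus uminus)

lemma mult:
  assumes F: "F \<in> ps V" and G: "G \<in> ps V"
  shows "msubst \<phi> (F * G) = msubst \<phi> F * msubst \<phi> G"
proof -
  have MM: "msubst \<phi> (Mon p c * Mon q d) = msubst \<phi> (Mon p c) * msubst \<phi> (Mon q d)" for p c q d
  proof -
    have "msubst \<phi> (Mon p c * Mon q d) = (Mon 0 c * Mon 0 d) * (monim \<phi> p * monim \<phi> q)"
      by (simp add: Mon_times msubst_Mon monim_add)
    then show ?thesis by (simp add: msubst_Mon ac_simps)
  qed
  have Mps: "Mon n c \<in> ps V" if "Poly_Mapping.keys n \<subseteq> V" for n and c :: 'a
    using that by (auto simp: ps_def mcoeff_Mon split: if_splits)
  \<comment> \<open>Continuity is available in one factor at a time: first \<open>F\<close> varies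
    against a fixed monomial, then \<open>G\<close> varies against a fixed \<open>F\<close>.\<close>
  have FM: "msubst \<phi> (F * Mon q d) - msubst \<phi> F * msubst \<phi> (Mon q d) = 0"
    if F: "F \<in> ps V" and q: "Poly_Mapping.keys q \<subseteq> V" for F q d
  proof (rule vanish_from_monomials[where h = "\<lambda>F. msubst \<phi> (F * Mon q d) - msubst \<phi> F * msubst \<phi> (Mon q d)",
        OF finite_V w_pos _ _ _ F])
    fix F G :: "('v, 'a) mfps" and e assume *: "F \<in> ps V"
    show "msubst \<phi> (F * Mon q d) - msubst \<phi> F * msubst \<phi> (Mon q d) \<in> fil w' e" if "F \<in> fil w e"
      using fil_image[OF * that] fil_image[OF ps_times[OF * Mps[OF q]] fil_mult_left[OF that, of "Mon q d", unfolded mult.commute[of "Mon q d"]]]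
      by (metis fil_diff fil_mult_left mult.commute)
    show "msubst \<phi> ((F + G) * Mon q d) - msubst \<phi> (F + G) * msubst \<phi> (Mon q d)
        = msubst \<phi> (F * Mon q d) - msubst \<phi> F * msubst \<phi> (Mon q d)
          + (msubst \<phi> (G * Mon q d) - msubst \<phi> G * msubst \<phi> (Mon q d))" if "G \<in> ps V"
      using * that Mps[OF q] by (simp add: algebra_simps add ps_times)
  qed (simp_all add: MM)
  have "msubst \<phi> (F * G) - msubst \<phi> F * msubst \<phi> G = 0"
  proof (rule vanish_from_monomials[where h = "\<lambda>G. msubst \<phi> (F * G) - msubst \<phi> F * msubst \<phi> G",
        OF finite_V w_pos _ _ _ G])
    fix G H :: "('v, 'a) mfps" and e assume *: "G \<in> ps V"
    show "msubst \<phi> (F * G) - msubst \<phi> F * msubst \<phi> G \<in> fil w' e" if "G \<in> fil w e"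
      using fil_image[OF * that] fil_image[OF ps_times[OF F *] fil_mult_left[OF that]]
      by (simp add: fil_diff fil_mult_left)
    show "msubst \<phi> (F * (G + H)) - msubst \<phi> F * msubst \<phi> (G + H)
        = msubst \<phi> (F * G) - msubst \<phi> F * msubst \<phi> G
          + (msubst \<phi> (F * H) - msubst \<phi> F * msubst \<phi> H)" if "H \<in> ps V"
      using * that F by (simp add: algebra_simps add ps_times)
  qed (use FM F in simp_all)
  then show ?thesis by simp
qed

lemma prod: "(\<And>i. i \<in> A \<Longrightarrow> F i \<in> ps V) \<Longrightarrow> msubst \<phi> (\<Prod>i\<in>A. F i) = (\<Prod>i\<in>A. msubst \<phi> (F i))"
  by (induction A rule: infinite_finite_induct) (auto simp: msubst_one mult ps_prod)

lemma power: "F \<in> ps V \<Longrightarrow> msubst \<phi> (F ^ n) = msubst \<phi> F ^ n"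
  by (induction n) (auto simp: msubst_one mult ps_power)

end

lemma msubst_mvar [simp]: "msubst \<phi> (mvar v) = \<phi> v"
  using msubst_Mon[of \<phi> "Poly_Mapping.single v 1" 1]
  by (simp add: mvar_eq_Mon one_eq_Mon[symmetric] monim_def)

lemma monim_mvar: "monim mvar n = (Mon n 1 :: ('v, 'a::comm_ring_1) mfps)"
proof (rule mfps_eqI)
  have pow: "(mvar v :: ('v, 'a) mfps) ^ k = Mon (Poly_Mapping.single v k) 1" for v :: 'v and k
    by (induction k) (simp_all add: one_eq_Mon mvar_eq_Mon Mon_times single_add[symmetric])
  have "(\<Prod>v\<in>A. Mon (f v) 1) = (Mon (\<Sum>v\<in>A. f v) 1 :: ('v, 'a) mfps)" for A :: "'v set" and f
    by (induction A rule: infinite_finite_induct) (simp_all add: one_eq_Mon Mon_times)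
  moreover have "(\<Sum>v\<in>Poly_Mapping.keys n. Poly_Mapping.single v (Poly_Mapping.lookup n v)) = n"
    by (rule poly_mapping_eqI) (simp add: lookup_sum lookup_single when_def Poly_Mapping.in_keys_iff)
  ultimately show "mcoeff (monim mvar n) m = mcoeff (Mon n 1 :: ('v, 'a) mfps) m" for m
    by (simp add: monim_def pow)
qed

lemma msubst_mvar_id: "msubst mvar F = F"
proof (rule mfps_eqI)
  fix m
  have "mcoeff (msubst mvar F) m = (\<Sum>n\<in>{m}. mcoeff F n * mcoeff (Mon n 1) m)"
    unfolding mcoeff_msubst monim_mvar by (rule Sum_any.expand_superset) (auto simp: mcoeff_Mon split: if_splits)
  then show "mcoeff (msubst mvar F) m = mcoeff F m" by (simp add: mcoeff_Mon)
qed

lemma msubst_comp: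
  assumes "substitution V w w' \<psi>" "substitution W w' w'' \<phi>"
    and im: "\<And>v. v \<in> V \<Longrightarrow> \<psi> v \<in> ps W" and F: "F \<in> ps V"
  shows "msubst \<phi> (msubst \<psi> F) = msubst (\<lambda>v. msubst \<phi> (\<psi> v)) F"
proof -
  interpret A: substitution V w w' \<psi> by fact
  interpret B: substitution W w' w'' \<phi> by fact
  interpret C: substitution V w w'' "\<lambda>v. msubst \<phi> (\<psi> v)"
    by unfold_locales (use A.finite_V A.w_pos A.image_fil B.fil_image im in auto)
  have ps: "msubst \<psi> F \<in> ps W" if "F \<in> ps V" for F
    using that im by (rule msubst_ps)
  have "msubst \<phi> (msubst \<psi> F) - msubst (\<lambda>v. msubst \<phi> (\<psi> v)) F = 0"
  proof (rule vanish_from_monomials[where h = "\<lambda>F. msubst \<phi> (msubst \<psi> F) - msubst (\<lambda>v. msubst \<phi> (\<psi> v)) F",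
        OF A.finite_V A.w_pos _ _ _ F])
    fix n :: "'a \<Rightarrow>\<^sub>0 nat" and c :: 'c assume n: "Poly_Mapping.keys n \<subseteq> V"
    have c: "Mon 0 c \<in> ps W" by (auto simp: ps_def mcoeff_Mon split: if_splits)
    have m: "monim \<psi> n \<in> ps W" unfolding monim_def using n im by (intro ps_prod ps_power) auto
    have "msubst \<phi> (monim \<psi> n) = monim (\<lambda>v. msubst \<phi> (\<psi> v)) n"
      unfolding monim_def using n im
      by (subst B.prod) (auto intro!: ps_power prod.cong B.power)
    then show "msubst \<phi> (msubst \<psi> (Mon n c)) - msubst (\<lambda>v. msubst \<phi> (\<psi> v)) (Mon n c) = 0"
      using c m msubst_Mon[of \<phi> 0 c] by (simp add: msubst_Mon B.mult monim_def)
  next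
    fix F :: "('a, 'c) mfps" and d assume "F \<in> ps V" "F \<in> fil w d"
    then show "msubst \<phi> (msubst \<psi> F) - msubst (\<lambda>v. msubst \<phi> (\<psi> v)) F \<in> fil w'' d"
      by (intro fil_diff C.fil_image B.fil_image A.fil_image ps)
  next
    fix F G :: "('a, 'c) mfps" assume "F \<in> ps V" "G \<in> ps V"
    then show "msubst \<phi> (msubst \<psi> (F + G)) - msubst (\<lambda>v. msubst \<phi> (\<psi> v)) (F + G) =
           msubst \<phi> (msubst \<psi> F) - msubst (\<lambda>v. msubst \<phi> (\<psi> v)) F +
           (msubst \<phi> (msubst \<psi> G) - msubst (\<lambda>v. msubst \<phi> (\<psi> v)) G)"
      by (simp add: A.add B.add C.add ps)
  qed
  then show ?thesis by simp
qed

text \<open>In a product of powers one factor at a time is changed from \<open>\<phi> v\<close> to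
  \<open>\<psi> v\<close>, and each change gains one unit of weight. This will compare the images of
  the variables with their leading terms.\<close>

lemma msubst_diff_fil:
  assumes "substitution V w w' \<phi>" "substitution V w w' \<psi>"
    and near: "\<And>v. v \<in> V \<Longrightarrow> \<phi> v - \<psi> v \<in> fil w' (Suc (w v))"
    and F: "F \<in> ps V" "F \<in> fil w d"
  shows "msubst \<phi> F - msubst \<psi> F \<in> fil w' (Suc d)"
proof (rule filI)
  interpret A: substitution V w w' \<phi> by fact
  interpret B: substitution V w w' \<psi> by fact
  have pow: "\<phi> v ^ k - \<psi> v ^ k \<in> fil w' (Suc (w v * k))" if v: "v \<in> V" for v k
  proof (induction k)
    case (Suc k)
    have "\<phi> v ^ Suc k - \<psi> v ^ Suc k = \<phi> v * (\<phi> v ^ k - \<psi> v ^ k) + (\<phi> v - \<psi> v) * \<psi> v ^ k"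
      by (simp add: algebra_simps)
    moreover have "\<phi> v * (\<phi> v ^ k - \<psi> v ^ k) \<in> fil w' (w v + Suc (w v * k))"
      by (intro fil_times A.image_fil v Suc)
    moreover have "(\<phi> v - \<psi> v) * \<psi> v ^ k \<in> fil w' (Suc (w v) + w v * k)"
      by (intro fil_times near v fil_power B.image_fil)
    ultimately show ?case by (simp add: fil_add)
  qed simp
  have prd: "S \<subseteq> V \<Longrightarrow> (\<Prod>v\<in>S. \<phi> v ^ k v) - (\<Prod>v\<in>S. \<psi> v ^ k v) \<in> fil w' (Suc (\<Sum>v\<in>S. w v * k v))"
    if "finite S" for S and k :: "'a \<Rightarrow> nat"
    using that
  proof (induction S rule: finite_induct)
    case (insert v S)
    have "(\<Prod>v\<in>insert v S. \<phi> v ^ k v) - (\<Prod>v\<in>insert v S. \<psi> v ^ k v)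
      = \<phi> v ^ k v * ((\<Prod>v\<in>S. \<phi> v ^ k v) - (\<Prod>v\<in>S. \<psi> v ^ k v)) + (\<phi> v ^ k v - \<psi> v ^ k v) * (\<Prod>v\<in>S. \<psi> v ^ k v)"
      using insert by (simp add: algebra_simps)
    moreover have "\<phi> v ^ k v * ((\<Prod>v\<in>S. \<phi> v ^ k v) - (\<Prod>v\<in>S. \<psi> v ^ k v)) \<in> fil w' (w v * k v + Suc (\<Sum>v\<in>S. w v * k v))"
      using insert by (intro fil_times fil_power A.image_fil) auto
    moreover have "(\<phi> v ^ k v - \<psi> v ^ k v) * (\<Prod>v\<in>S. \<psi> v ^ k v) \<in> fil w' (Suc (w v * k v) + (\<Sum>v\<in>S. w v * k v))"
      using insert by (intro fil_times pow fil_prod fil_power B.image_fil) auto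
    ultimately show ?case using insert by (simp add: fil_add)
  qed simp
  fix m assume m: "wt w' m < Suc d"
  have "mcoeff F n * mcoeff (monim \<phi> n) m = mcoeff F n * mcoeff (monim \<psi> n) m"
    if n: "Poly_Mapping.keys n \<subseteq> V" for n
  proof (cases "wt w n < d")
    case True
    then show ?thesis using filD[OF F(2)] by simp
  next
    case False
    have "monim \<phi> n - monim \<psi> n \<in> fil w' (Suc (wt w n))"
      unfolding monim_def wt_def using n by (intro prd) auto
    then have "mcoeff (monim \<phi> n - monim \<psi> n) m = 0"
      by (rule filD) (use False m in simp)
    then show ?thesis by simp
  qed
  then show "mcoeff (msubst \<phi> F - msubst \<psi> F) m = 0"
    by (simp add: A.mcoeff_finite[OF F(1) m] B.mcoeff_finite[OF F(1) m])
qed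


section \<open>Setting a variable to zero and dividing by it\<close>

definition res :: "'v \<Rightarrow> ('v, 'a::comm_ring_1) mfps \<Rightarrow> ('v, 'a) mfps" where
  "res v F = Abs_mfps (\<lambda>m. if Poly_Mapping.lookup m v = 0 then mcoeff F m else 0)"

text \<open>Division by \<open>v\<close> that drops the terms free of \<open>v\<close>. It is thus a
  total additive map, linear over series without \<open>v\<close>, and undoes multiplication by
  \<open>mvar v\<close>.\<close>

definition shift :: "'v \<Rightarrow> ('v, 'a::comm_ring_1) mfps \<Rightarrow> ('v, 'a) mfps" where
  "shift v F = Abs_mfps (\<lambda>m. mcoeff F (Poly_Mapping.single v 1 + m))"

lemma mcoeff_res: "mcoeff (res v F) m = (if Poly_Mapping.lookup m v = 0 then mcoeff F m else 0)"
  by (simp add: res_def)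

lemma mcoeff_shift: "mcoeff (shift v F) m = mcoeff F (Poly_Mapping.single v 1 + m)"
  by (simp add: shift_def)

lemma res_add: "res v (F + G) = res v F + res v G"
  by (rule mfps_eqI) (simp add: mcoeff_res)

lemma res_diff: "res v (F - G) = res v F - res v G"
  by (rule mfps_eqI) (simp add: mcoeff_res)

lemma res_0 [simp]: "res v 0 = 0"
  by (rule mfps_eqI) (simp add: mcoeff_res)

lemma res_1 [simp]: "res v 1 = 1"
  by (rule mfps_eqI) (simp add: mcoeff_res mcoeff_1)

lemma res_mult: "res v (F * G) = res v F * res v G"
proof (rule mfps_eqI)
  fix m
  show "mcoeff (res v (F * G)) m = mcoeff (res v F * res v G) m"
  proof (cases "Poly_Mapping.lookup m v = 0")
    case True
    then show ?thesis
      unfolding mcoeff_times mcoeff_res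
      by (auto intro!: sum.cong simp: lookup_add)
  next
    case False
    have "mcoeff (res v F * res v G) m = 0"
      by (rule ccontr, erule mcoeff_times_nonzero)
        (use False in \<open>auto simp: mcoeff_res lookup_add split: if_splits\<close>)
    with False show ?thesis by (simp add: mcoeff_res)
  qed
qed

interpretation res: comm_ring_hom "res v" for v :: 'v
  by unfold_locales (simp_all add: res_add res_mult)

lemma res_mvar: "res v (mvar u) = (if u = v then 0 else mvar u)"
  by (rule mfps_eqI) (auto simp: mcoeff_res mcoeff_mvar lookup_single)

lemma res_ps: "F \<in> ps (insert v V) \<Longrightarrow> res v F \<in> ps (V - {v})"
  by (auto simp: ps_def mcoeff_res Poly_Mapping.in_keys_iff split: if_splits)

lemma res_ident: "F \<in> ps V \<Longrightarrow> v \<notin> V \<Longrightarrow> res v F = F"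
  by (rule mfps_eqI, simp add: mcoeff_res ps_def)
    (metis Poly_Mapping.in_keys_iff not_gr_zero subsetD)

lemma res_fil: "F \<in> fil w d \<Longrightarrow> res v F \<in> fil w d"
  by (auto simp: fil_def mcoeff_res)

lemma shift_add: "shift v (F + G) = shift v F + shift v G"
  by (rule mfps_eqI) (simp add: mcoeff_shift)

lemma shift_mvar_times: "shift v (mvar v * F) = F"
  by (rule mfps_eqI) (simp add: mcoeff_shift mvar_eq_Mon mcoeff_Mon_times del: One_nat_def)

lemma mvar_times_cancel: "mvar v * F = mvar v * G \<Longrightarrow> F = G"
  by (metis shift_mvar_times)

lemma res_plus_shift: "F = res v F + mvar v * shift v F"
proof (rule mfps_eqI)
  fix m
  show "mcoeff F m = mcoeff (res v F + mvar v * shift v F) m"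
  proof (cases "Poly_Mapping.lookup m v = 0")
    case True
    then have "m \<noteq> Poly_Mapping.single v 1 + q" for q
      by (auto simp: lookup_add)
    then show ?thesis
      using True by (simp add: mcoeff_res mvar_eq_Mon mcoeff_Mon_times_0 del: One_nat_def)
  next
    case False
    define q where "q = m - Poly_Mapping.single v 1"
    have "m = Poly_Mapping.single v 1 + q"
      by (rule poly_mapping_eqI) (use False in \<open>auto simp: q_def lookup_add lookup_minus lookup_single when_def\<close>)
    then show ?thesis
      using False by (simp add: mcoeff_res mvar_eq_Mon mcoeff_Mon_times mcoeff_shift del: One_nat_def)
  qed
qed

lemma res_eq_0: "res v F = 0 \<Longrightarrow> F = mvar v * shift v F"
  using res_plus_shift[of F v] by simp

lemma shift_ps: "F \<in> ps V \<Longrightarrow> shift v F \<in> ps V"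
  by (simp add: ps_def mcoeff_shift keys_plus_nat) (metis keys_plus_nat le_sup_iff)

lemma shift_mult: "F \<in> ps V \<Longrightarrow> v \<notin> V \<Longrightarrow> shift v (F * G) = F * shift v G"
proof -
  assume F: "F \<in> ps V" "v \<notin> V"
  have "F * G = res v (F * G) + mvar v * (F * shift v G)"
    using res_plus_shift[of G v] res_ident[OF F] by (metis (no_types) distrib_left mult.left_commute res_mult)
  then show ?thesis
    using res_plus_shift[of "F * G" v] mvar_times_cancel[of v "F * shift v G" "shift v (F * G)"]
    by (metis add_left_cancel)
qed

lemma shift_fil: "F \<in> fil w d \<Longrightarrow> shift v F \<in> fil w (d - w v)"
  by (rule filI) (auto simp: mcoeff_shift wt_add intro!: filD)

lemma res_msubst: "res v (msubst \<phi> F) = msubst (\<lambda>u. res v (\<phi> u)) F"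
proof (rule mfps_eqI)
  fix m
  have "monim (\<lambda>u. res v (\<phi> u)) n = res v (monim \<phi> n)" for n
    by (simp add: monim_def res.hom_prod res.hom_power)
  then show "mcoeff (res v (msubst \<phi> F)) m = mcoeff (msubst (\<lambda>u. res v (\<phi> u)) F) m"
    by (simp add: mcoeff_res mcoeff_msubst)
qed

section \<open>Coefficients of products of divisor equations\<close>

text \<open>Coefficients are indexed downwards from the leading one and extended by zero beyond the
  degree, so that a product of equations is a plain convolution over all
  \<open>l \<le> j\<close>.\<close>

definition dc :: "nat \<Rightarrow> (nat \<Rightarrow> 'b) \<Rightarrow> nat \<Rightarrow> 'b::comm_ring_1" where
  "dc d u k = (if k = 0 then 1 else if k \<le> d then u k else 0)"

lemma coeff_divisor_eqn:
  "Polynomial.coeff (divisor_eqn d u) i = (if i \<le> d then dc d u (d - i) else 0)"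
proof -
  have "Polynomial.coeff (divisor_eqn d u) i
      = (\<Sum>k\<le>d. if i = d - k then (if k = 0 then 1 else u k) else 0)"
    unfolding divisor_eqn_def coeff_sum coeff_monom by (rule sum.cong) auto
  also have "\<dots> = (\<Sum>k\<le>d. if k = d - i then (if i \<le> d then dc d u k else 0) else 0)"
    by (rule sum.cong) (auto simp: dc_def)
  finally show ?thesis by simp
qed

lemma coeff_divisor_eqn_mult:
  assumes "j \<le> d + e"
  shows "Polynomial.coeff (divisor_eqn d u * divisor_eqn e v) (d + e - j)
    = (\<Sum>l\<le>j. dc d u l * dc e v (j - l))"
proof -
  have "Polynomial.coeff (divisor_eqn d u * divisor_eqn e v) (d + e - j)
     = (\<Sum>i\<in>{i. i \<le> d + e - j \<and> i \<le> d \<and> d + e - j - i \<le> e}. dc d u (d - i) * dc e v (e - (d + e - j - i)))"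
    unfolding coeff_mult coeff_divisor_eqn by (rule sum.mono_neutral_cong_right) auto
  also have "\<dots> = (\<Sum>l\<in>{l. l \<le> j \<and> l \<le> d \<and> j - l \<le> e}. dc d u l * dc e v (j - l))"
    by (rule sum.reindex_bij_witness[where i = "\<lambda>l. d - l" and j = "\<lambda>i. d - i"])
      (use assms in \<open>auto intro!: arg_cong2[where f = "(*)"] arg_cong[where f = "dc e v"]\<close>)
  also have "\<dots> = (\<Sum>l\<le>j. dc d u l * dc e v (j - l))"
    by (rule sum.mono_neutral_left) (auto simp: dc_def)
  finally show ?thesis .
qed

section \<open>The exponents indexing the basis\<close>

text \<open>Exponents are zero outside the range, so that \<open>box m r s\<close> is contained in
  \<open>box m (Suc r) s\<close> and the inductions need no conversion. Indices start after
  \<open>m\<close> because the same exponents serve the variables \<open>c_(0,m+i)\<close> and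
  \<open>c_i\<close>.\<close>

definition box :: "nat \<Rightarrow> nat \<Rightarrow> nat \<Rightarrow> (nat \<Rightarrow> nat) set" where
  "box m r s = {\<alpha>. (\<forall>i. \<alpha> i \<noteq> 0 \<longrightarrow> m < i \<and> i \<le> m + r) \<and> (\<Sum>i=m+1..m+r. \<alpha> i) \<le> s}"

definition bmon :: "nat \<Rightarrow> nat \<Rightarrow> (nat \<Rightarrow> 'b::comm_monoid_mult) \<Rightarrow> (nat \<Rightarrow> nat) \<Rightarrow> 'b" where
  "bmon m r X \<alpha> = (\<Prod>i=m+1..m+r. X i ^ \<alpha> i)"

definition incr :: "nat \<Rightarrow> (nat \<Rightarrow> nat) \<Rightarrow> nat \<Rightarrow> nat" where
  "incr k \<alpha> = \<alpha>(k := Suc (\<alpha> k))"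

lemma box_support: "\<alpha> \<in> box m r s \<Longrightarrow> \<alpha> i \<noteq> 0 \<Longrightarrow> m < i \<and> i \<le> m + r"
  unfolding box_def by blast

lemma zero_in_box: "(\<lambda>_. 0) \<in> box m r s"
  by (simp add: box_def)

lemma box_0_left: "box m 0 s = {\<lambda>_. 0}"
  by (auto simp: box_def fun_eq_iff) (metis leD not_gr_zero)

lemma box_0_right: "box m r 0 = {\<lambda>_. 0}"
proof -
  have "\<alpha> i = 0" if "\<alpha> \<in> box m r 0" for \<alpha> i
  proof (rule ccontr)
    assume "\<alpha> i \<noteq> 0"
    moreover from this have "i \<in> {m+1..m+r}"
      using box_support[OF that, of i] by simp
    moreover have "(\<Sum>i\<in>{m+1..m+r}. \<alpha> i) = 0"
      using that unfolding box_def by blast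
    then have "\<forall>i\<in>{m+1..m+r}. \<alpha> i = 0"
      by (subst (asm) sum_eq_0_iff) simp_all
    ultimately show False by simp
  qed
  then show ?thesis
    using zero_in_box[of m r 0] by (auto intro!: ext)
qed

text \<open>Either the last variable does not occur, which lowers \<open>r\<close>, or one factor of
  it can be removed, which lowers the degree bound. This is the combinatorial form of the induction
  on \<open>r + s\<close>.\<close>

lemma box_Suc:
  "box m (Suc r) (Suc s) = box m r (Suc s) \<union> incr (m + Suc r) ` box m (Suc r) s" (is "?L = ?A \<union> ?B")
proof (intro equalityI subsetI)
  fix \<alpha> assume a: "\<alpha> \<in> ?L"
  show "\<alpha> \<in> ?A \<union> ?B"
  proof (cases "\<alpha> (m + Suc r)")
    case 0
    have "m < i \<and> i \<le> m + r" if "\<alpha> i \<noteq> 0" for i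
      using box_support[OF a that] 0 that by (cases "i = m + Suc r") auto
    then show ?thesis using a 0 by (auto simp: box_def)
  next
    case (Suc k)
    define \<beta> where "\<beta> = \<alpha>(m + Suc r := k)"
    have "\<alpha> = incr (m + Suc r) \<beta>" using Suc by (auto simp: \<beta>_def incr_def)
    moreover have "(\<Sum>i=m+1..m+r. \<beta> i) = (\<Sum>i=m+1..m+r. \<alpha> i)"
      by (rule sum.cong) (auto simp: \<beta>_def)
    then have "\<beta> \<in> box m (Suc r) s"
      using a Suc by (auto simp: box_def \<beta>_def)
    ultimately show ?thesis by blast
  qed
next
  fix \<alpha> assume "\<alpha> \<in> ?A \<union> ?B"
  then show "\<alpha> \<in> ?L"
  proof
    assume a: "\<alpha> \<in> ?A"
    then have "\<alpha> (m + Suc r) = 0" by (auto simp: box_def)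
    then show ?thesis using a by (auto simp: box_def le_SucI)
  next
    assume "\<alpha> \<in> ?B"
    then obtain \<beta> where b: "\<beta> \<in> box m (Suc r) s" "\<alpha> = incr (m + Suc r) \<beta>" by auto
    moreover have "(\<Sum>i=m+1..m+r. \<alpha> i) = (\<Sum>i=m+1..m+r. \<beta> i)"
      by (rule sum.cong) (auto simp: b incr_def)
    ultimately show ?thesis by (auto simp: box_def incr_def)
  qed
qed

lemma finite_box: "finite (box m r s)"
proof (induction "r + s" arbitrary: r s)
  case (Suc k)
  show ?case
  proof (cases "r = 0 \<or> s = 0")
    case False
    then obtain r' s' where "r = Suc r'" "s = Suc s'" by (metis not0_implies_Suc)
    then show ?thesis using Suc by (simp add: box_Suc)
  qed (auto simp: box_0_left box_0_right)
qed (simp add: box_0_left)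

lemma sum_box_Suc:
  fixes g :: "(nat \<Rightarrow> nat) \<Rightarrow> 'b::comm_monoid_add"
  shows "(\<Sum>\<alpha>\<in>box m (Suc r) (Suc s). g \<alpha>)
    = (\<Sum>\<alpha>\<in>box m r (Suc s). g \<alpha>) + (\<Sum>\<alpha>\<in>box m (Suc r) s. g (incr (m + Suc r) \<alpha>))"
proof -
  have "inj_on (incr (m + Suc r)) A" for A
    by (rule inj_onI) (auto simp: incr_def fun_eq_iff split: if_splits)
  then have "(\<Sum>\<alpha>\<in>incr (m + Suc r) ` box m (Suc r) s. g \<alpha>) = (\<Sum>\<alpha>\<in>box m (Suc r) s. g (incr (m + Suc r) \<alpha>))"
    by (simp add: sum.reindex)
  moreover have "box m r (Suc s) \<inter> incr (m + Suc r) ` box m (Suc r) s = {}"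
  proof -
    have "\<alpha> (m + Suc r) = 0" if "\<alpha> \<in> box m r (Suc s)" for \<alpha>
      using that by (auto simp: box_def)
    then show ?thesis by (fastforce simp: incr_def)
  qed
  ultimately show ?thesis
    unfolding box_Suc by (subst sum.union_disjoint) (auto simp: finite_box)
qed

lemma box_last: "\<alpha> \<in> box m r s \<Longrightarrow> \<alpha> (m + Suc r) = 0"
  by (auto simp: box_def)

text \<open>Glues the coefficient families that the induction produces on the two pieces of
  \<open>box_Suc\<close>.\<close>

lemma box_merge:
  obtains P where "\<And>\<alpha>. \<alpha> \<in> box m r (Suc s) \<Longrightarrow> P \<alpha> = p \<alpha>" "\<And>\<beta>. P (incr (m + Suc r) \<beta>) = q \<beta>"
proof
  let ?k = "m + Suc r"
  let ?P = "\<lambda>\<alpha>. if \<alpha> ?k = 0 then p \<alpha> else q (\<alpha>(?k := \<alpha> ?k - 1))"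
  show "?P \<alpha> = p \<alpha>" if "\<alpha> \<in> box m r (Suc s)" for \<alpha> using box_last[OF that] by simp
  show "?P (incr ?k \<beta>) = q \<beta>" for \<beta> by (simp add: incr_def)
qed

lemma bmon_zero [simp]: "bmon m r X (\<lambda>_. 0) = 1"
  by (simp add: bmon_def)

lemma bmon_Suc: "\<alpha> (m + Suc r) = 0 \<Longrightarrow> bmon m (Suc r) X \<alpha> = bmon m r X \<alpha>"
  by (simp add: bmon_def)

lemma bmon_incr: "bmon m (Suc r) X (incr (m + Suc r) \<alpha>) = X (m + Suc r) * bmon m (Suc r) X \<alpha>"
proof -
  have "(\<Prod>i=m+1..m+r. X i ^ incr (m + Suc r) \<alpha> i) = (\<Prod>i=m+1..m+r. X i ^ \<alpha> i)"
    by (rule prod.cong) (auto simp: incr_def)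
  then show ?thesis by (simp add: bmon_def incr_def mult_ac)
qed

text \<open>The weight under \<open>wS\<close> of the monomial with exponent \<alpha> in the
  \<open>c_i\<close>.\<close>

definition bwt :: "nat \<Rightarrow> nat \<Rightarrow> (nat \<Rightarrow> nat) \<Rightarrow> nat" where
  "bwt m r \<alpha> = (\<Sum>i=m+1..m+r. 2 * (i - m) * \<alpha> i)"

lemma bwt_Suc: "\<alpha> (m + Suc r) = 0 \<Longrightarrow> bwt m (Suc r) \<alpha> = bwt m r \<alpha>"
  by (simp add: bwt_def)

lemma bwt_incr: "bwt m (Suc r) (incr (m + Suc r) \<alpha>) = 2 * Suc r + bwt m (Suc r) \<alpha>"
proof -
  have "(\<Sum>i=m+1..m+r. 2 * (i - m) * incr (m + Suc r) \<alpha> i) = (\<Sum>i=m+1..m+r. 2 * (i - m) * \<alpha> i)"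
    by (rule sum.cong) (auto simp: incr_def)
  then show ?thesis by (simp add: bwt_def incr_def)
qed

section \<open>Successive approximation\<close>

text \<open>If every element of \<open>X\<close> is a combination of the \<open>\<gamma> k\<close>
  up to a multiple of the image of \<open>t\<close>, the remainder can be expanded again, and the
  coefficients found add up to a power series in \<open>t\<close>. The index \<open>d\<close>
  records the order of \<open>F\<close>, so that a bound on the order of the coefficients survives
  the limit; \<open>C\<close> states which coefficients are allowed.\<close>

lemma successive_approximation:
  fixes t :: "('v, 'a::comm_ring_1) mfps" and \<phi> :: "'v \<Rightarrow> ('w, 'a) mfps"
    and \<gamma> :: "'k \<Rightarrow> ('w, 'a) mfps"
  assumes sub: "substitution V w w' \<phi>" and t: "t \<in> ps V" "t \<in> fil w e" "0 < e"
    and CV: "\<And>k d. k \<in> K \<Longrightarrow> C k d \<subseteq> ps V"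
    and C: "\<And>k d G. k \<in> K \<Longrightarrow> (\<And>i. G i \<in> C k (d - i * e)) \<Longrightarrow> isum w (\<lambda>i. t ^ i * G i) \<in> C k d"
    and step: "\<And>d F. F \<in> X d \<Longrightarrow> \<exists>p F'. (\<forall>k\<in>K. p k \<in> C k d) \<and> F' \<in> X (d - e)
        \<and> F = (\<Sum>k\<in>K. msubst \<phi> (p k) * \<gamma> k) + msubst \<phi> t * F'"
    and F: "F \<in> X d"
  shows "\<exists>p. (\<forall>k\<in>K. p k \<in> C k d) \<and> F = (\<Sum>k\<in>K. msubst \<phi> (p k) * \<gamma> k)"
proof -
  interpret substitution V w w' \<phi> by fact
  obtain P R where PR: "\<And>d F. F \<in> X d \<Longrightarrow> (\<forall>k\<in>K. P d F k \<in> C k d) \<and> R d F \<in> X (d - e)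
        \<and> F = (\<Sum>k\<in>K. msubst \<phi> (P d F k) * \<gamma> k) + msubst \<phi> t * R d F"
  proof -
    have "\<forall>d F. \<exists>p F'. F \<in> X d \<longrightarrow> (\<forall>k\<in>K. p k \<in> C k d) \<and> F' \<in> X (d - e)
        \<and> F = (\<Sum>k\<in>K. msubst \<phi> (p k) * \<gamma> k) + msubst \<phi> t * F'"
      using step by blast
    then show thesis unfolding choice_iff using that by blast
  qed
  define Fs where "Fs = rec_nat F (\<lambda>i F. R (d - i * e) F)"
  have Fs0: "Fs 0 = F" and FsS: "Fs (Suc i) = R (d - i * e) (Fs i)" for i
    by (simp_all add: Fs_def)
  have X: "Fs i \<in> X (d - i * e)" for i
  proof (induction i)
    case (Suc i)
    then have "R (d - i * e) (Fs i) \<in> X (d - i * e - e)" using PR by blast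
    then show ?case by (simp add: FsS add.commute)
  qed (simp add: Fs0 F)
  define G where "G k i = P (d - i * e) (Fs i) k" for k i
  have G: "G k i \<in> C k (d - i * e)" if "k \<in> K" for k i
    using PR[OF X[of i]] that by (simp add: G_def)
  have Gps: "G k i \<in> ps V" if "k \<in> K" for k i
    using G CV that by blast
  have tG: "t ^ i * H \<in> fil w i" for i H
  proof -
    have "t ^ i \<in> fil w (e * i)" by (rule fil_power) (rule t)
    then have "t ^ i \<in> fil w i" by (rule fil_mono) (use t(3) in simp)
    then show ?thesis by (metis fil_mult_left mult.commute)
  qed
  have tGps: "t ^ i * G k i \<in> ps V" if "k \<in> K" for k i
    using Gps[OF that] t(1) by (intro ps_times ps_power)
  define p where "p k = isum w (\<lambda>i. t ^ i * G k i)" for k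
  have pps: "p k \<in> ps V" if "k \<in> K" for k
    unfolding p_def by (rule isum_ps) (rule tGps[OF that])
  \<comment> \<open>The remainder after \<open>N\<close> rounds carries \<open>t ^ N\<close>, whose
    order grows with \<open>N\<close> because \<open>t\<close> has positive order
    \<open>e\<close>.\<close>
  have partial_sum: "F = (\<Sum>k\<in>K. msubst \<phi> (\<Sum>i<N. t ^ i * G k i) * \<gamma> k) + msubst \<phi> t ^ N * Fs N" for N
  proof (induction N)
    case 0
    then show ?case by (simp add: Fs0 msubst_zero)
  next
    case (Suc N)
    have "Fs N = (\<Sum>k\<in>K. msubst \<phi> (G k N) * \<gamma> k) + msubst \<phi> t * Fs (Suc N)"
      using PR[OF X[of N]] by (simp add: G_def FsS)
    then have "msubst \<phi> t ^ N * Fs N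
        = (\<Sum>k\<in>K. msubst \<phi> t ^ N * msubst \<phi> (G k N) * \<gamma> k) + msubst \<phi> t ^ Suc N * Fs (Suc N)"
      by (simp add: algebra_simps sum_distrib_left)
    moreover have "(\<Sum>k\<in>K. msubst \<phi> t ^ N * msubst \<phi> (G k N) * \<gamma> k)
        = (\<Sum>k\<in>K. msubst \<phi> (t ^ N * G k N) * \<gamma> k)"
      using Gps t(1) by (intro sum.cong) (auto simp: mult power ps_power)
    moreover have "(\<Sum>k\<in>K. msubst \<phi> (\<Sum>i<Suc N. t ^ i * G k i) * \<gamma> k)
       = (\<Sum>k\<in>K. msubst \<phi> (\<Sum>i<N. t ^ i * G k i) * \<gamma> k) + (\<Sum>k\<in>K. msubst \<phi> (t ^ N * G k N) * \<gamma> k)"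
      using tGps by (simp add: add ps_sum algebra_simps flip: sum.distrib)
    ultimately show ?case using Suc by simp
  qed
  have "F - (\<Sum>k\<in>K. msubst \<phi> (p k) * \<gamma> k) \<in> fil w' N" for N
  proof -
    have "msubst \<phi> (p k) - msubst \<phi> (\<Sum>i<N. t ^ i * G k i) \<in> fil w' N" if k: "k \<in> K" for k
    proof -
      have S: "(\<Sum>i<N. t ^ i * G k i) \<in> ps V" using tGps[OF k] by (intro ps_sum)
      have "p k - (\<Sum>i<N. t ^ i * G k i) \<in> fil w N"
        unfolding p_def by (rule isum_approx) (rule tG)
      then have "msubst \<phi> (p k - (\<Sum>i<N. t ^ i * G k i)) \<in> fil w' N"
        by (intro fil_image ps_diff pps k S)
      then show ?thesis by (simp add: diff[OF pps[OF k] S])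
    qed
    then have "(\<Sum>k\<in>K. (msubst \<phi> (p k) - msubst \<phi> (\<Sum>i<N. t ^ i * G k i)) * \<gamma> k) \<in> fil w' N"
      by (intro fil_sum) (metis fil_mult_left mult.commute)
    moreover have "msubst \<phi> t ^ N * Fs N \<in> fil w' N"
    proof -
      have "msubst \<phi> (t ^ N * 1) \<in> fil w' N"
        using tG[of N 1] t(1) by (intro fil_image ps_times ps_power) auto
      then show ?thesis using t(1) by (simp add: power) (metis fil_mult_left mult.commute)
    qed
    ultimately have "msubst \<phi> t ^ N * Fs N - (\<Sum>k\<in>K. (msubst \<phi> (p k) - msubst \<phi> (\<Sum>i<N. t ^ i * G k i)) * \<gamma> k) \<in> fil w' N"
      by (intro fil_diff)
    then show ?thesis
      by (subst (1) partial_sum[of N]) (simp add: algebra_simps sum_subtractf)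
  qed
  then have "F - (\<Sum>k\<in>K. msubst \<phi> (p k) * \<gamma> k) = 0" by (rule fil_all_imp_0)
  moreover have "\<forall>k\<in>K. p k \<in> C k d"
    unfolding p_def using G by (auto intro: C)
  ultimately show ?thesis by (intro exI[of _ p]) simp
qed

section \<open>Pairs of a subdivisor and its complement\<close>

definition par_vars :: "nat \<Rightarrow> nat \<Rightarrow> (nat \<times> nat) set" where
  "par_vars m n = c_vars 0 m \<union> c_vars 1 n"

definition sub_vars :: "nat \<Rightarrow> nat \<Rightarrow> nat \<Rightarrow> sub_var set" where
  "sub_vars m r s = AVar ` {1..m} \<union> BVar ` {1..s} \<union> CVar ` {1..r}"

text \<open>
  The weights are chosen so that \<open>a\<^sub>i\<close> is the term of lowest weight in the image of \<open>c\<^sub>0\<^sub>i\<close> for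
  \<open>i \<le> m\<close>, and \<open>a\<^sub>m c\<^sub>i\<close> that in the image of the coefficient with index \<open>m + i\<close>.
\<close>

definition wR :: "nat \<Rightarrow> nat \<times> nat \<Rightarrow> nat" where
  "wR m = (\<lambda>(i, j). if i = 0 then (if j \<le> m then j else m + 2 * (j - m)) else 2 * j)"

primrec wS :: "sub_var \<Rightarrow> nat" where
  "wS (AVar i) = i" | "wS (BVar i) = 2 * i" | "wS (CVar i) = 2 * i"

text \<open>The algebra structure of statement (1): the \<open>c_0j\<close> go to single variables
  \<open>a_j\<close>, but the \<open>c_1j\<close> go to the coefficients of \<open>gh\<close>, as
  under the projection.\<close>

definition ephi :: "nat \<Rightarrow> nat \<Rightarrow> nat \<times> nat \<Rightarrow> 'a::comm_ring_1 sseries" where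
  "ephi r s = (\<lambda>(i, j). if i = 0 then mvar (AVar j)
     else \<Sum>l\<le>j. dc s (\<lambda>k. mvar (BVar k)) l * dc r (\<lambda>k. mvar (CVar k)) (j - l))"

text \<open>Inverse to \<open>ephi\<close> in the base cases of the inductions: for
  \<open>r = 0\<close> or \<open>s = 0\<close> one of \<open>g\<close>, \<open>h\<close> is 1, and
  \<open>gh\<close> is the other.\<close>

definition unphi :: "sub_var \<Rightarrow> 'a::comm_ring_1 cseries" where
  "unphi v = (case v of AVar i \<Rightarrow> mvar (0, i) | BVar j \<Rightarrow> mvar (1, j) | CVar j \<Rightarrow> mvar (1, j))"

lemma dc_fil: "(\<And>k. 0 < k \<Longrightarrow> u k \<in> fil w (c * k)) \<Longrightarrow> dc d u k \<in> fil w (c * k)"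
  by (auto simp: dc_def)

lemma dc_ps: "(\<And>k. 0 < k \<Longrightarrow> k \<le> d \<Longrightarrow> u k \<in> ps V) \<Longrightarrow> dc d u k \<in> ps V"
  by (auto simp: dc_def)

lemma ephi_fil: "v \<in> par_vars m n \<Longrightarrow> ephi r s v \<in> fil wS (wR m v)"
proof -
  assume v: "v \<in> par_vars m n"
  have "dc s (\<lambda>k. mvar (BVar k)) l * dc r (\<lambda>k. mvar (CVar k)) (j - l) \<in> fil wS (2 * j)" if "l \<le> j" for j l
  proof -
    have "dc s (\<lambda>k. mvar (BVar k)) l * dc r (\<lambda>k. mvar (CVar k)) (j - l) \<in> fil wS (2 * l + 2 * (j - l))"
      by (intro fil_times dc_fil) (use fil_mvar[of "BVar _" wS] fil_mvar[of "CVar _" wS] in simp_all)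
    then show ?thesis using that by (simp flip: distrib_left)
  qed
  then show ?thesis
    using v fil_mvar[of "AVar _" wS]
    by (auto simp: ephi_def wR_def par_vars_def c_vars_def intro!: fil_sum)
qed

lemma finite_par_vars: "finite (par_vars m n)"
  by (simp add: par_vars_def c_vars_def)

lemma substitution_ephi: "substitution (par_vars m n) (wR m) wS (ephi r s)"
  by unfold_locales (auto simp: finite_par_vars intro: ephi_fil, auto simp: par_vars_def c_vars_def wR_def)

lemma substitution_unphi: "substitution (sub_vars m r s) wS (wR m) unphi"
proof
  show "unphi v \<in> fil (wR m) (wS v)" if "v \<in> sub_vars m r s" for v
  proof (cases v)
    case (AVar i)
    then show ?thesis
      using that fil_mvar[of "(0, i)" "wR m"] by (auto simp: unphi_def sub_vars_def wR_def)
  next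
    case (BVar i)
    then show ?thesis
      using fil_mvar[of "(1, i)" "wR m"] by (simp add: unphi_def wR_def)
  next
    case (CVar i)
    then show ?thesis
      using fil_mvar[of "(1, i)" "wR m"] by (simp add: unphi_def wR_def)
  qed
qed (auto simp: sub_vars_def)

lemma ephi_ps: "v \<in> par_vars m n \<Longrightarrow> ephi r s v \<in> ps (sub_vars m r s)"
  by (auto simp: ephi_def par_vars_def c_vars_def sub_vars_def
      intro!: ps_sum ps_times dc_ps ps_mvar)

lemma ephi_AVar: "ephi r s (0, j) = mvar (AVar j)"
  by (simp add: ephi_def)

lemma ephi_0: "j \<le> s \<Longrightarrow> 0 < j \<Longrightarrow> ephi 0 s (Suc 0, j) = mvar (BVar j)"
  unfolding ephi_def
  by (simp, subst sum.mono_neutral_right[of _ "{j}"]) (auto simp: dc_def)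

lemma ephi_0': "j \<le> r \<Longrightarrow> 0 < j \<Longrightarrow> ephi r 0 (Suc 0, j) = mvar (CVar j)"
  unfolding ephi_def
  by (simp, subst sum.mono_neutral_right[of _ "{0}"]) (auto simp: dc_def)

text \<open>The constant term of \<open>gh\<close>. Its being a product of two variables is what
  allows the two successive divisions, by \<open>c_r\<close> and then by \<open>b_s\<close>.\<close>

lemma ephi_top: "ephi (Suc r) (Suc s) (1, r + s + 2) = mvar (BVar (Suc s)) * mvar (CVar (Suc r))"
proof -
  let ?f = "\<lambda>l. dc (Suc s) (\<lambda>k. mvar (BVar k)) l * dc (Suc r) (\<lambda>k. mvar (CVar k)) (r + s + 2 - l)"
  have "sum ?f {..r + s + 2} = sum ?f {Suc s}"
    by (rule sum.mono_neutral_right) (auto simp: dc_def)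
  also have "\<dots> = mvar (BVar (Suc s)) * mvar (CVar (Suc r))"
  proof -
    have "r + s + 2 - Suc s = Suc r" by simp
    then show ?thesis by (simp only: sum.insert finite.emptyI empty_iff if_False not_False_eq_True sum.empty dc_def) simp
  qed
  finally show ?thesis by (simp add: ephi_def)
qed

lemma ephi_beyond: "ephi r s (1, Suc (r + s)) = 0"
  unfolding ephi_def by (auto simp: dc_def intro!: sum.neutral)

text \<open>Setting \<open>c_r = 0\<close> makes \<open>h\<close> divisible by x, and dividing by x
  leaves the coefficients counted from the top unchanged.\<close>

lemma res_ephi_C: "res (CVar (Suc r)) (ephi (Suc r) s v) = ephi r s v"
  by (cases v) (auto simp: ephi_def res.hom_sum res_mult res_mvar dc_def intro!: sum.cong)

lemma res_ephi_B: "res (BVar (Suc s)) (ephi r (Suc s) v) = ephi r s v"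
  by (cases v) (auto simp: ephi_def res.hom_sum res_mult res_mvar dc_def intro!: sum.cong)


lemma unphi_ps: "v \<in> sub_vars m r s \<Longrightarrow> unphi v \<in> ps (par_vars m (r + s))"
  by (auto simp: unphi_def sub_vars_def par_vars_def c_vars_def intro!: ps_mvar)

lemma ephi_unphi:
  assumes "r = 0 \<or> s = 0" "F \<in> ps (sub_vars m r s)"
  shows "msubst (ephi r s) (msubst unphi F) = (F :: 'a::comm_ring_1 sseries)"
proof -
  have "msubst (ephi r s) (msubst unphi F) = msubst (\<lambda>v. msubst (ephi r s) (unphi v)) F"
    by (rule msubst_comp[OF substitution_unphi substitution_ephi unphi_ps assms(2)])
  also have "\<dots> = msubst mvar F"
  proof (rule msubst_cong[OF assms(2)])
    fix v assume "v \<in> sub_vars m r s"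
    then show "msubst (ephi r s) (unphi v) = (mvar v :: 'a sseries)"
      using assms(1) by (auto simp: unphi_def sub_vars_def ephi_0 ephi_0' ephi_AVar)
  qed
  finally show ?thesis by (simp add: msubst_mvar_id)
qed

lemma unphi_ephi:
  assumes "r = 0 \<or> s = 0" "F \<in> ps (par_vars m (r + s))"
  shows "msubst unphi (msubst (ephi r s) F) = (F :: 'a::comm_ring_1 cseries)"
proof -
  have "msubst unphi (msubst (ephi r s) F) = msubst (\<lambda>v. msubst unphi (ephi r s v)) F"
    by (rule msubst_comp[OF substitution_ephi substitution_unphi ephi_ps assms(2)])
  also have "\<dots> = msubst mvar F"
  proof (rule msubst_cong[OF assms(2)])
    fix v assume "v \<in> par_vars m (r + s)"
    then show "msubst unphi (ephi r s v) = (mvar v :: 'a cseries)"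
      using assms(1)
      by (auto simp: par_vars_def c_vars_def ephi_AVar unphi_def ephi_0 ephi_0')
  qed
  finally show ?thesis by (simp add: msubst_mvar_id)
qed

text \<open>Once \<open>r\<close> or \<open>s\<close> has been lowered, \<open>gh\<close> has one
  coefficient fewer. The last parameter then maps to zero and can be removed, as the induction
  hypothesis for independence requires.\<close>

lemma msubst_ephi_beyond:
  assumes "p \<in> ps (par_vars m (Suc (r + s)))"
  shows "msubst (ephi r s) (res (1, Suc (r + s)) p) = msubst (ephi r s) p"
proof -
  interpret substitution "par_vars m (Suc (r + s))" "wR m" wS "ephi r s"
    by (rule substitution_ephi)
  let ?t = "(1, Suc (r + s)) :: nat \<times> nat"
  let ?T = "mvar ?t"
  have t: "?t \<in> par_vars m (Suc (r + s))" by (simp add: par_vars_def c_vars_def)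
  have "res ?t p \<in> ps (par_vars m (Suc (r + s)))"
    using assms t by (auto intro!: ps_mono[OF res_ps, of _ _ "par_vars m (Suc (r + s))"] simp: insert_absorb)
  moreover have "?T * shift ?t p \<in> ps (par_vars m (Suc (r + s)))"
    using assms t by (intro ps_times ps_mvar shift_ps)
  ultimately have "msubst (ephi r s) p = msubst (ephi r s) (res ?t p) + msubst (ephi r s) (?T * shift ?t p)"
    by (metis add res_plus_shift)
  also have "msubst (ephi r s) (?T * shift ?t p) = 0"
    using assms t by (simp add: mult ps_mvar shift_ps ephi_beyond[unfolded One_nat_def])
  finally show ?thesis by simp
qed

lemma par_vars_res:
  "p \<in> ps (par_vars m (Suc n)) \<Longrightarrow> res (1, Suc n) p \<in> ps (par_vars m n)"
  by (rule ps_mono[OF res_ps[of _ "(1, Suc n)" "par_vars m n"]])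
    (auto simp: par_vars_def c_vars_def atLeastAtMostSuc_conv elim!: ps_mono)


lemma mvar_times_eq_0: "mvar v * F = 0 \<Longrightarrow> F = 0"
  using mvar_times_cancel[of v F 0] by simp

section \<open>The basis of the ring of subdivisors\<close>

definition cmon :: "nat \<Rightarrow> nat \<Rightarrow> (nat \<Rightarrow> nat) \<Rightarrow> 'a::comm_ring_1 sseries" where
  "cmon m r = bmon m r (\<lambda>i. mvar (CVar (i - m)))"

lemma cmon_zero [simp]: "cmon m r (\<lambda>_. 0) = 1"
  by (simp add: cmon_def)

lemma cmon_Suc: "\<alpha> (m + Suc r) = 0 \<Longrightarrow> cmon m (Suc r) \<alpha> = cmon m r \<alpha>"
  by (simp add: cmon_def bmon_Suc)

lemma cmon_incr: "cmon m (Suc r) (incr (m + Suc r) \<alpha>) = mvar (CVar (Suc r)) * cmon m (Suc r) \<alpha>"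
  unfolding cmon_def bmon_incr by simp

lemma cmon_ps: "cmon m r \<alpha> \<in> ps (sub_vars m r s)"
  unfolding cmon_def bmon_def sub_vars_def by (intro ps_prod ps_power ps_mvar UnI2 imageI) auto

lemma res_cmon:
  assumes "\<And>k. 1 \<le> k \<Longrightarrow> k \<le> r \<Longrightarrow> v \<noteq> CVar k"
  shows "res v (cmon m r \<alpha>) = cmon m r \<alpha>"
  unfolding cmon_def bmon_def res.hom_prod res.hom_power
proof (intro prod.cong refl)
  fix i assume "i \<in> {m+1..m+r}"
  then have "v \<noteq> CVar (i - m)" by (intro assms) auto
  then show "res v (mvar (CVar (i - m))) ^ \<alpha> i = mvar (CVar (i - m)) ^ \<alpha> i"
    by (simp add: res_mvar)
qed

lemma res_msubst_ephi_C: "res (CVar (Suc r)) (msubst (ephi (Suc r) s) p) = msubst (ephi r s) p"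
  by (simp add: res_msubst res_ephi_C)

lemma res_msubst_ephi_B: "res (BVar (Suc s)) (msubst (ephi r (Suc s)) p) = msubst (ephi r s) p"
  by (simp add: res_msubst res_ephi_B)

lemma ephi_comb_fil:
  assumes "\<And>\<alpha>. \<alpha> \<in> A \<Longrightarrow> p \<alpha> \<in> ps (par_vars m n) \<inter> fil (wR m) (d - bwt m k \<alpha>)"
  shows "(\<Sum>\<alpha>\<in>A. msubst (ephi r s) (p \<alpha>) * cmon m k \<alpha>) \<in> fil wS d"
proof (rule fil_sum)
  interpret E: substitution "par_vars m n" "wR m" wS "ephi r s" by (rule substitution_ephi)
  fix \<alpha> assume a: "\<alpha> \<in> A"
  have "cmon m k \<alpha> \<in> fil wS (bwt m k \<alpha>)"
    unfolding cmon_def bmon_def bwt_def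
    using fil_mvar[of "CVar _" wS] by (intro fil_prod fil_power) simp
  then have "msubst (ephi r s) (p \<alpha>) * cmon m k \<alpha> \<in> fil wS ((d - bwt m k \<alpha>) + bwt m k \<alpha>)"
    using assms[OF a] by (intro fil_times E.fil_image) auto
  then show "msubst (ephi r s) (p \<alpha>) * cmon m k \<alpha> \<in> fil wS d"
    by (rule fil_mono) simp
qed

text \<open>The coefficient of a basis monomial can be chosen with the order of \<open>F\<close>
  minus the weight of the monomial. This is what makes taking coordinates compatible with the
  filtrations.\<close>

lemma ephi_span:
  fixes F :: "'a::comm_ring_1 sseries"
  assumes "F \<in> ps (sub_vars m r s)" "F \<in> fil wS d"
  shows "\<exists>p. (\<forall>\<alpha>\<in>box m r s. p \<alpha> \<in> ps (par_vars m (r + s)) \<inter> fil (wR m) (d - bwt m r \<alpha>)) \<and>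
    F = (\<Sum>\<alpha>\<in>box m r s. msubst (ephi r s) (p \<alpha>) * cmon m r \<alpha>)"
  using assms
proof (induction "r + s" arbitrary: r s F d rule: less_induct)
  case less
  show ?case
  proof (cases "r = 0 \<or> s = 0")
    case True
    interpret U: substitution "sub_vars m r s" wS "wR m" unphi by (rule substitution_unphi)
    have box: "box m r s = {\<lambda>_. 0}" using True box_0_left box_0_right by auto
    have "msubst unphi F \<in> ps (par_vars m (r + s))"
      by (rule msubst_ps[OF less.prems(1)]) (rule unphi_ps)
    moreover have "msubst unphi F \<in> fil (wR m) d"
      using less.prems by (rule U.fil_image)
    ultimately show ?thesis
      using ephi_unphi[OF True less.prems(1)]
      by (intro exI[of _ "\<lambda>_. msubst unphi F"]) (auto simp: box bwt_def)
  next
    case False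
    then obtain r' s' where rs: "r = Suc r'" "s = Suc s'" by (metis not0_implies_Suc)
    let ?n = "r' + s' + 2"
    let ?t = "(1, ?n) :: nat \<times> nat"
    let ?T = "mvar ?t :: 'a cseries"
    let ?b = "mvar (BVar s) :: 'a sseries" and ?c = "mvar (CVar r) :: 'a sseries"
    let ?V = "par_vars m (r + s)" and ?N = "sub_vars m r s"
    have n: "r + s = ?n" by (simp add: rs)
    interpret E: substitution ?V "wR m" wS "ephi r s" by (rule substitution_ephi)
    have t: "?t \<in> ?V" by (simp add: par_vars_def c_vars_def n)
    have wt: "wR m ?t = 2 * ?n" by (simp add: wR_def)
    have bc: "msubst (ephi r s) (?T) = ?b * ?c"
      using ephi_top[of r' s'] by (simp add: rs)
    have bps: "?b \<in> ps ?N" "?c \<in> ps ?N" by (auto intro!: ps_mvar simp: sub_vars_def rs)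
    have Eps: "msubst (ephi r s) p \<in> ps ?N" if "p \<in> ps ?V" for p
      using that by (rule msubst_ps) (rule ephi_ps)
    have step: "\<exists>p F'. (\<forall>\<alpha>\<in>box m r s. p \<alpha> \<in> ps ?V \<inter> fil (wR m) (d - bwt m r \<alpha>)) \<and>
        F' \<in> ps ?N \<inter> fil wS (d - 2 * ?n) \<and>
        F = (\<Sum>\<alpha>\<in>box m r s. msubst (ephi r s) (p \<alpha>) * cmon m r \<alpha>) + msubst (ephi r s) (?T) * F'"
      if F: "F \<in> ps ?N \<inter> fil wS d" for F :: "'a sseries" and d
    proof -
      have "res (CVar r) F \<in> ps (sub_vars m r' s)"
        by (rule ps_mono[OF res_ps[of _ _ ?N]]) (use F in \<open>auto simp: sub_vars_def rs elim!: ps_mono\<close>)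
      from less.hyps[OF _ this, of d] F obtain p where
        p: "\<And>\<alpha>. \<alpha> \<in> box m r' s \<Longrightarrow> p \<alpha> \<in> ps (par_vars m (r' + s)) \<inter> fil (wR m) (d - bwt m r' \<alpha>)"
        and Fp: "res (CVar r) F = (\<Sum>\<alpha>\<in>box m r' s. msubst (ephi r' s) (p \<alpha>) * cmon m r' \<alpha>)"
        by (auto simp: rs res_fil)
      have pV: "p \<alpha> \<in> ps ?V" if "\<alpha> \<in> box m r' s" for \<alpha>
        using p[OF that] by (auto elim!: ps_mono simp: par_vars_def c_vars_def rs)
      \<comment> \<open>The coefficients found for \<open>r'\<close> are reused with the map for
        \<open>r\<close>. The two maps agree modulo \<open>c_r\<close>, hence so do \<open>W\<close>
        and \<open>F\<close>.\<close>
      define W where "W = (\<Sum>\<alpha>\<in>box m r' s. msubst (ephi r s) (p \<alpha>) * cmon m r' \<alpha>)"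
      have Wps: "W \<in> ps ?N"
      proof -
        have "cmon m r' \<alpha> \<in> ps ?N" for \<alpha>
          by (rule ps_mono[OF cmon_ps[of m r' \<alpha> s]]) (auto simp: sub_vars_def rs)
        then show ?thesis
          unfolding W_def using pV by (intro ps_sum ps_times Eps)
      qed
      have Wfil: "W \<in> fil wS d"
        unfolding W_def using p by (rule ephi_comb_fil)
      have "res (CVar r) W = res (CVar r) F"
        unfolding W_def Fp unfolding res.hom_sum res_mult rs res_msubst_ephi_C
        by (subst res_cmon) auto
      then have "res (CVar r) (F - W) = 0" by (simp add: res_diff)
      then have F1: "F - W = ?c * shift (CVar r) (F - W)" by (rule res_eq_0)
      define F1 where "F1 = shift (CVar r) (F - W)"
      have F1ps: "F1 \<in> ps ?N" unfolding F1_def using F Wps by (intro shift_ps ps_diff) auto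
      have F1fil: "F1 \<in> fil wS (d - 2 * r)"
        using shift_fil[of "F - W" wS d "CVar r"] F Wfil by (auto simp: F1_def fil_diff)
      have "res (BVar s) F1 \<in> ps (sub_vars m r s')"
        by (rule ps_mono[OF res_ps[of _ _ ?N]]) (use F1ps in \<open>auto simp: sub_vars_def rs elim!: ps_mono\<close>)
      from less.hyps[OF _ this, of "d - 2 * r"] F1fil obtain q where
        q: "\<And>\<alpha>. \<alpha> \<in> box m r s' \<Longrightarrow> q \<alpha> \<in> ps (par_vars m (r + s')) \<inter> fil (wR m) (d - 2 * r - bwt m r \<alpha>)"
        and Fq: "res (BVar s) F1 = (\<Sum>\<alpha>\<in>box m r s'. msubst (ephi r s') (q \<alpha>) * cmon m r \<alpha>)"
        by (auto simp: rs res_fil)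
      have qV: "q \<alpha> \<in> ps ?V" if "\<alpha> \<in> box m r s'" for \<alpha>
        using q[OF that] by (auto elim!: ps_mono simp: par_vars_def c_vars_def rs)
      \<comment> \<open>The same lift from \<open>s'\<close> to \<open>s\<close>: \<open>F1\<close>
        and \<open>Z\<close> agree modulo \<open>b_s\<close>. Hence \<open>F\<close> is
        \<open>W + c_r Z\<close> up to a multiple of \<open>b_s c_r\<close>, the image of
        \<open>?T\<close>.\<close>
      define Z where "Z = (\<Sum>\<alpha>\<in>box m r s'. msubst (ephi r s) (q \<alpha>) * cmon m r \<alpha>)"
      have Zps: "Z \<in> ps ?N"
        unfolding Z_def using qV by (intro ps_sum ps_times Eps cmon_ps)
      have Zfil: "Z \<in> fil wS (d - 2 * r)"
        unfolding Z_def using q by (rule ephi_comb_fil)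
      have "res (BVar s) Z = res (BVar s) F1"
        unfolding Z_def Fq unfolding res.hom_sum res_mult rs res_msubst_ephi_B
        by (subst res_cmon) auto
      then have "res (BVar s) (F1 - Z) = 0" by (simp add: res_diff)
      then have F2: "F1 - Z = ?b * shift (BVar s) (F1 - Z)" by (rule res_eq_0)
      define F2 where "F2 = shift (BVar s) (F1 - Z)"
      have F2ps: "F2 \<in> ps ?N" unfolding F2_def using F1ps Zps by (intro shift_ps ps_diff) auto
      have F2fil: "F2 \<in> fil wS (d - 2 * ?n)"
        using shift_fil[of "F1 - Z" wS "d - 2 * r" "BVar s"] F1fil Zfil
        by (auto simp: F2_def fil_diff rs algebra_simps)
      obtain P where Plast: "\<And>\<alpha>. \<alpha> \<in> box m r' s \<Longrightarrow> P \<alpha> = p \<alpha>"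
        and Pincr: "\<And>\<beta>. P (incr (m + Suc r') \<beta>) = q \<beta>"
        using box_merge[of m r' s'] unfolding rs by blast
      have "\<forall>\<alpha>\<in>box m r s. P \<alpha> \<in> ps ?V \<inter> fil (wR m) (d - bwt m r \<alpha>)"
      proof
        fix \<alpha> assume "\<alpha> \<in> box m r s"
        then consider "\<alpha> \<in> box m r' s" | \<beta> where "\<beta> \<in> box m r s'" "\<alpha> = incr (m + Suc r') \<beta>"
          unfolding rs box_Suc by blast
        then show "P \<alpha> \<in> ps ?V \<inter> fil (wR m) (d - bwt m r \<alpha>)"
        proof cases
          case 1
          then show ?thesis using p[OF 1] pV[OF 1] box_last[OF 1] by (simp add: Plast rs bwt_Suc)
        next
          case 2
          have "bwt m r \<alpha> = 2 * r + bwt m r \<beta>"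
            unfolding 2(2) rs by (rule bwt_incr)
          moreover have "P \<alpha> = q \<beta>" by (simp only: 2(2) Pincr)
          ultimately show ?thesis using q[OF 2(1)] qV[OF 2(1)] by simp
        qed
      qed
      moreover have "(\<Sum>\<alpha>\<in>box m r s. msubst (ephi r s) (P \<alpha>) * cmon m r \<alpha>) = W + ?c * Z"
      proof -
        have "(\<Sum>\<alpha>\<in>box m r s. msubst (ephi r s) (P \<alpha>) * cmon m r \<alpha>)
          = (\<Sum>\<alpha>\<in>box m r' s. msubst (ephi r s) (P \<alpha>) * cmon m r \<alpha>)
            + (\<Sum>\<alpha>\<in>box m r s'. msubst (ephi r s) (P (incr (m + Suc r') \<alpha>)) * cmon m r (incr (m + Suc r') \<alpha>))"
          using sum_box_Suc[where m = m and r = r' and s = s'] by (simp add: rs)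
        moreover have "(\<Sum>\<alpha>\<in>box m r' s. msubst (ephi r s) (P \<alpha>) * cmon m r \<alpha>) = W"
          unfolding W_def using box_last by (intro sum.cong) (auto simp: Plast rs cmon_Suc)
        moreover have "(\<Sum>\<alpha>\<in>box m r s'. msubst (ephi r s) (P (incr (m + Suc r') \<alpha>)) * cmon m r (incr (m + Suc r') \<alpha>)) = ?c * Z"
          unfolding Z_def sum_distrib_left Pincr
          by (intro sum.cong) (simp_all add: rs cmon_incr del: add_Suc_right)
        ultimately show ?thesis by simp
      qed
      moreover have "F = (W + ?c * Z) + ?b * ?c * F2"
      proof -
        have "F1 = Z + ?b * F2" using F2 by (simp add: F2_def algebra_simps)
        moreover have "F = W + ?c * F1" using F1 by (simp add: F1_def algebra_simps)
        ultimately show ?thesis by (simp add: algebra_simps)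
      qed
      ultimately show ?thesis
        using F2ps F2fil bc by (intro exI[of _ P] exI[of _ F2]) simp
    qed
    show ?thesis
    proof (rule successive_approximation[where V = ?V and w = "wR m" and w' = wS and t = "?T" and e = "2 * ?n"
          and C = "\<lambda>\<alpha> d. ps ?V \<inter> fil (wR m) (d - bwt m r \<alpha>)" and X = "\<lambda>d. ps ?N \<inter> fil wS d"])
      show "?T \<in> fil (wR m) (2 * ?n)" unfolding wt[symmetric] by (rule fil_mvar)
    next
      fix d \<alpha> and G :: "nat \<Rightarrow> 'a cseries"
      assume G: "\<And>i. G i \<in> ps ?V \<inter> fil (wR m) (d - i * (2 * ?n) - bwt m r \<alpha>)"
      have "?T ^ i * G i \<in> fil (wR m) (d - bwt m r \<alpha>)" for i
      proof -
        have "?T ^ i * G i \<in> fil (wR m) (2 * ?n * i + (d - i * (2 * ?n) - bwt m r \<alpha>))"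
          using G fil_mvar[of ?t "wR m"] by (intro fil_times fil_power) (simp_all only: wt Int_iff)
        then show ?thesis by (rule fil_mono) (simp add: mult.commute)
      qed
      then show "isum (wR m) (\<lambda>i. ?T ^ i * G i) \<in> ps ?V \<inter> fil (wR m) (d - bwt m r \<alpha>)"
        using G t by (auto intro!: isum_ps isum_fil ps_times ps_power ps_mvar)
    next
      show "F \<in> ps ?N \<inter> fil wS d" using less.prems by simp
    qed (use t step E.substitution_axioms in \<open>auto intro: ps_mvar\<close>)
  qed
qed

lemma ephi_independent:
  fixes p :: "(nat \<Rightarrow> nat) \<Rightarrow> 'a::comm_ring_1 cseries"
  assumes "\<And>\<alpha>. \<alpha> \<in> box m r s \<Longrightarrow> p \<alpha> \<in> ps (par_vars m (r + s))"
    and "(\<Sum>\<alpha>\<in>box m r s. msubst (ephi r s) (p \<alpha>) * cmon m r \<alpha>) = 0"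
    and "\<alpha> \<in> box m r s"
  shows "p \<alpha> = 0"
  using assms
proof (induction "r + s" arbitrary: r s p \<alpha> rule: less_induct)
  case less
  show ?case
  proof (cases "r = 0 \<or> s = 0")
    case True
    have box: "box m r s = {\<lambda>_. 0}" using True box_0_left box_0_right by auto
    then have a: "\<alpha> = (\<lambda>_. 0)" using less.prems by simp
    then have "msubst (ephi r s) (p \<alpha>) = 0"
      using less.prems(2) by (simp add: box)
    then have "p \<alpha> = msubst unphi 0"
      using unphi_ephi[OF True less.prems(1)[OF less.prems(3)]] by simp
    then show ?thesis
      by (simp add: msubst_zero)
  next
    case False
    then obtain r' s' where rs: "r = Suc r'" "s = Suc s'" by (metis not0_implies_Suc)
    let ?n = "r' + s' + 2"
    let ?t = "(1, ?n) :: nat \<times> nat"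
    let ?T = "mvar ?t :: 'a cseries"
    let ?b = "mvar (BVar s) :: 'a sseries" and ?c = "mvar (CVar r) :: 'a sseries"
    let ?V = "par_vars m (r + s)"
    have n: "r + s = ?n" by (simp add: rs)
    interpret E: substitution ?V "wR m" wS "ephi r s" by (rule substitution_ephi)
    have t: "?t \<in> ?V" by (simp add: par_vars_def c_vars_def n)
    have bc: "msubst (ephi r s) (?T) = ?b * ?c"
      using ephi_top[of r' s'] by (simp add: rs)
    \<comment> \<open>Setting \<open>c_r = 0\<close> shows that the coefficients on
      \<open>box m r' s\<close> are divisible by \<open>?T\<close>. Their contribution is then a
      multiple of \<open>b_s c_r\<close>, so \<open>c_r\<close> cancels from the whole relation, and
      setting \<open>b_s = 0\<close> treats the other coefficients. Finally \<open>b_s c_r\<close>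
      cancels, leaving the same relation for the quotients.\<close>
    have step: "(\<forall>\<alpha>\<in>box m r s. p \<alpha> = ?T * shift ?t (p \<alpha>)) \<and>
        (\<Sum>\<alpha>\<in>box m r s. msubst (ephi r s) (shift ?t (p \<alpha>)) * cmon m r \<alpha>) = 0"
      if p: "\<And>\<alpha>. \<alpha> \<in> box m r s \<Longrightarrow> p \<alpha> \<in> ps ?V"
        and 0: "(\<Sum>\<alpha>\<in>box m r s. msubst (ephi r s) (p \<alpha>) * cmon m r \<alpha>) = 0"
      for p :: "(nat \<Rightarrow> nat) \<Rightarrow> 'a cseries"
    proof -
      let ?i = "incr (m + Suc r')"
      have split: "(\<Sum>\<alpha>\<in>box m r s. msubst (ephi r s) (p \<alpha>) * cmon m r \<alpha>)
          = (\<Sum>\<alpha>\<in>box m r' s. msubst (ephi r s) (p \<alpha>) * cmon m r' \<alpha>)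
            + ?c * (\<Sum>\<alpha>\<in>box m r s'. msubst (ephi r s) (p (?i \<alpha>)) * cmon m r \<alpha>)"
        for p :: "(nat \<Rightarrow> nat) \<Rightarrow> 'a cseries"
      proof -
        have "(\<Sum>\<alpha>\<in>box m r s. msubst (ephi r s) (p \<alpha>) * cmon m r \<alpha>)
          = (\<Sum>\<alpha>\<in>box m r' s. msubst (ephi r s) (p \<alpha>) * cmon m r \<alpha>)
            + (\<Sum>\<alpha>\<in>box m r s'. msubst (ephi r s) (p (?i \<alpha>)) * cmon m r (?i \<alpha>))"
          using sum_box_Suc[where m = m and r = r' and s = s'] by (simp add: rs)
        moreover have "(\<Sum>\<alpha>\<in>box m r' s. msubst (ephi r s) (p \<alpha>) * cmon m r \<alpha>)
            = (\<Sum>\<alpha>\<in>box m r' s. msubst (ephi r s) (p \<alpha>) * cmon m r' \<alpha>)"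
          using box_last by (intro sum.cong) (auto simp: rs cmon_Suc)
        moreover have "(\<Sum>\<alpha>\<in>box m r s'. msubst (ephi r s) (p (?i \<alpha>)) * cmon m r (?i \<alpha>))
            = ?c * (\<Sum>\<alpha>\<in>box m r s'. msubst (ephi r s) (p (?i \<alpha>)) * cmon m r \<alpha>)"
          unfolding sum_distrib_left by (intro sum.cong) (simp_all add: rs cmon_incr del: add_Suc_right)
        ultimately show ?thesis by simp
      qed
      have box1: "\<alpha> \<in> box m r s" if "\<alpha> \<in> box m r' s" for \<alpha>
        using that by (simp add: rs box_Suc)
      have box2: "?i \<alpha> \<in> box m r s" if "\<alpha> \<in> box m r s'" for \<alpha>
        using that by (simp add: rs box_Suc)
      have resV: "res ?t (p \<alpha>) \<in> ps (par_vars m (r' + s))" "res ?t (p \<alpha>) \<in> ps (par_vars m (r + s'))"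
        if "\<alpha> \<in> box m r s" for \<alpha>
        using par_vars_res[of "p \<alpha>" m "Suc (r' + s')"] p[OF that] by (simp_all add: rs)
      have "(\<Sum>\<alpha>\<in>box m r' s. msubst (ephi r' s) (p \<alpha>) * cmon m r' \<alpha>) = 0"
      proof -
        have "res (CVar r) (\<Sum>\<alpha>\<in>box m r' s. msubst (ephi r s) (p \<alpha>) * cmon m r' \<alpha>)
          = (\<Sum>\<alpha>\<in>box m r' s. msubst (ephi r' s) (p \<alpha>) * cmon m r' \<alpha>)"
          unfolding res.hom_sum res_mult rs res_msubst_ephi_C by (subst res_cmon) auto
        moreover have "res (CVar r) (?c * Y) = 0" for Y
          by (simp add: res_mult res_mvar)
        ultimately show ?thesis
          using arg_cong[OF 0, of "res (CVar r)"] unfolding split res_add by simp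
      qed
      then have "(\<Sum>\<alpha>\<in>box m r' s. msubst (ephi r' s) (res ?t (p \<alpha>)) * cmon m r' \<alpha>) = 0"
        using msubst_ephi_beyond[of "p _" m r' s] p[OF box1] by (simp add: rs)
      then have "res ?t (p \<alpha>) = 0" if "\<alpha> \<in> box m r' s" for \<alpha>
        using less.hyps[of r' s "\<lambda>\<alpha>. res ?t (p \<alpha>)" \<alpha>] resV[OF box1] that by (auto simp: rs)
      then have d1: "p \<alpha> = ?T * shift ?t (p \<alpha>)" if "\<alpha> \<in> box m r' s" for \<alpha>
        using that by (intro res_eq_0)
      have Eshift: "msubst (ephi r s) (p \<alpha>) = ?b * ?c * msubst (ephi r s) (shift ?t (p \<alpha>))"
        if "p \<alpha> = ?T * shift ?t (p \<alpha>)" "\<alpha> \<in> box m r s" for \<alpha>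
        using that p[OF that(2)] t bc by (metis E.mult ps_mvar shift_ps)
      have "?c * (?b * (\<Sum>\<alpha>\<in>box m r' s. msubst (ephi r s) (shift ?t (p \<alpha>)) * cmon m r' \<alpha>)
          + (\<Sum>\<alpha>\<in>box m r s'. msubst (ephi r s) (p (?i \<alpha>)) * cmon m r \<alpha>)) = 0"
      proof -
        have "(\<Sum>\<alpha>\<in>box m r' s. msubst (ephi r s) (p \<alpha>) * cmon m r' \<alpha>)
          = ?c * (?b * (\<Sum>\<alpha>\<in>box m r' s. msubst (ephi r s) (shift ?t (p \<alpha>)) * cmon m r' \<alpha>))"
          unfolding sum_distrib_left
          by (intro sum.cong refl) (simp add: Eshift[OF d1 box1] mult_ac)
        then show ?thesis using 0 unfolding split by (simp add: distrib_left)
      qed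
      then have "?b * (\<Sum>\<alpha>\<in>box m r' s. msubst (ephi r s) (shift ?t (p \<alpha>)) * cmon m r' \<alpha>)
          + (\<Sum>\<alpha>\<in>box m r s'. msubst (ephi r s) (p (?i \<alpha>)) * cmon m r \<alpha>) = 0"
        by (rule mvar_times_eq_0)
      note 1 = this
      have "(\<Sum>\<alpha>\<in>box m r s'. msubst (ephi r s') (p (?i \<alpha>)) * cmon m r \<alpha>) = 0"
      proof -
        have "res (BVar s) (\<Sum>\<alpha>\<in>box m r s'. msubst (ephi r s) (p (?i \<alpha>)) * cmon m r \<alpha>)
          = (\<Sum>\<alpha>\<in>box m r s'. msubst (ephi r s') (p (?i \<alpha>)) * cmon m r \<alpha>)"
          unfolding res.hom_sum res_mult rs res_msubst_ephi_B by (subst res_cmon) auto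
        moreover have "res (BVar s) (?b * Y) = 0" for Y
          by (simp add: res_mult res_mvar)
        ultimately show ?thesis
          using arg_cong[OF 1, of "res (BVar s)"] unfolding res_add by simp
      qed
      then have "(\<Sum>\<alpha>\<in>box m r s'. msubst (ephi r s') (res ?t (p (?i \<alpha>))) * cmon m r \<alpha>) = 0"
        using msubst_ephi_beyond[of "p (?i _)" m r s'] p[OF box2] by (simp add: rs)
      then have "res ?t (p (?i \<alpha>)) = 0" if "\<alpha> \<in> box m r s'" for \<alpha>
        using less.hyps[of r s' "\<lambda>\<alpha>. res ?t (p (?i \<alpha>))" \<alpha>] resV[OF box2] that by (auto simp: rs)
      then have d2: "p (?i \<alpha>) = ?T * shift ?t (p (?i \<alpha>))" if "\<alpha> \<in> box m r s'" for \<alpha>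
        using that by (intro res_eq_0)
      have d: "p \<alpha> = ?T * shift ?t (p \<alpha>)" if "\<alpha> \<in> box m r s" for \<alpha>
        using that d1 d2 unfolding rs box_Suc by blast
      have "?c * (?b * (\<Sum>\<alpha>\<in>box m r s. msubst (ephi r s) (shift ?t (p \<alpha>)) * cmon m r \<alpha>)) = 0"
      proof -
        have "(\<Sum>\<alpha>\<in>box m r s. msubst (ephi r s) (p \<alpha>) * cmon m r \<alpha>)
          = ?c * (?b * (\<Sum>\<alpha>\<in>box m r s. msubst (ephi r s) (shift ?t (p \<alpha>)) * cmon m r \<alpha>))"
          unfolding sum_distrib_left
          by (intro sum.cong refl) (simp add: Eshift[OF d] mult_ac)
        then show ?thesis using 0 by simp
      qed
      then have "(\<Sum>\<alpha>\<in>box m r s. msubst (ephi r s) (shift ?t (p \<alpha>)) * cmon m r \<alpha>) = 0"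
        by (rule mvar_times_eq_0[THEN mvar_times_eq_0])
      with d show ?thesis by blast
    qed
    \<comment> \<open>The quotients satisfy the hypotheses again, so a factor \<open>?T\<close> can
      be split off any number of times.\<close>
    have "\<forall>\<alpha>\<in>box m r s. p \<alpha> \<in> fil (wR m) N"
      if "\<And>\<alpha>. \<alpha> \<in> box m r s \<Longrightarrow> p \<alpha> \<in> ps ?V"
        and "(\<Sum>\<alpha>\<in>box m r s. msubst (ephi r s) (p \<alpha>) * cmon m r \<alpha>) = 0"
      for N and p :: "(nat \<Rightarrow> nat) \<Rightarrow> 'a cseries"
      using that
    proof (induction N arbitrary: p)
      case (Suc N)
      note st = step[OF Suc.prems]
      have "\<forall>\<alpha>\<in>box m r s. shift ?t (p \<alpha>) \<in> fil (wR m) N"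
        using st Suc.prems(1) by (intro Suc.IH[of "\<lambda>\<alpha>. shift ?t (p \<alpha>)"] shift_ps) auto
      moreover have "?T \<in> fil (wR m) 1"
        by (rule fil_mono[OF fil_mvar]) (simp add: wR_def)
      ultimately show ?case
      proof -
        assume *: "\<forall>\<alpha>\<in>box m r s. shift ?t (p \<alpha>) \<in> fil (wR m) N" "?T \<in> fil (wR m) 1"
        show ?thesis
        proof
          fix \<alpha> assume a: "\<alpha> \<in> box m r s"
          have "?T * shift ?t (p \<alpha>) \<in> fil (wR m) (1 + N)"
            using * a by (intro fil_times) blast+
          moreover have "p \<alpha> = ?T * shift ?t (p \<alpha>)" using st a by blast
          ultimately show "p \<alpha> \<in> fil (wR m) (Suc N)" by simp
        qed
      qed
    qed simp
    then show ?thesis using less.prems by (intro fil_all_imp_0[of _ "wR m"]) blast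
  qed
qed

section \<open>Minors with arbitrary index functions\<close>

lemma det_first_row:
  assumes B: "B \<in> carrier_mat (Suc q) (Suc q)" and 0: "\<And>j. j < q \<Longrightarrow> B $$ (0, Suc j) = 0"
  shows "det B = B $$ (0, 0) * det (mat q q (\<lambda>(i, j). B $$ (Suc i, Suc j)))"
proof -
  have "det B = (\<Sum>j<Suc q. B $$ (0, j) * cofactor B 0 j)"
    using B by (intro laplace_expansion_row) auto
  also have "\<dots> = B $$ (0, 0) * cofactor B 0 0"
    unfolding sum.lessThan_Suc_shift using 0 by simp
  also have "mat_delete B 0 0 = mat q q (\<lambda>(i, j). B $$ (Suc i, Suc j))"
    using B by (auto simp: mat_delete_def)
  then have "cofactor B 0 0 = det (mat q q (\<lambda>(i, j). B $$ (Suc i, Suc j)))"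
    by (simp add: cofactor_def)
  finally show ?thesis .
qed

lemma det_zero_col:
  assumes B: "B \<in> carrier_mat q q" and k: "k < q" and 0: "\<And>i. i < q \<Longrightarrow> B $$ (i, k) = 0"
  shows "det B = (0 :: 'b::comm_ring_1)"
  using laplace_expansion_column[OF B k] 0 by simp

text \<open>\<open>submatrix\<close> lists its rows in increasing order; any injective listing
  differs from it by a permutation, which costs a sign. With this a row or column can be adjoined in
  front without sorting.\<close>

lemma det_rows_pick:
  fixes f :: "nat \<Rightarrow> nat \<Rightarrow> 'b::comm_ring_1"
  assumes inj: "inj_on \<rho> {..<q}"
  shows "\<exists>\<epsilon>\<in>{1, -1}. det (mat q q (\<lambda>(i, j). f (\<rho> i) j))
    = \<epsilon> * det (mat q q (\<lambda>(i, j). f (pick (\<rho> ` {..<q}) i) j))"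
proof -
  let ?P = "\<rho> ` {..<q}"
  have card: "card ?P = q" using inj by (simp add: card_image)
  \<comment> \<open>The rank of \<open>\<rho> i\<close> within the image of \<open>\<rho>\<close>;
    the identity beyond \<open>q\<close> makes it a permutation in the sense of
    \<open>permutes\<close>.\<close>
  define \<sigma> where "\<sigma> i = (if i < q then card {a \<in> ?P. a < \<rho> i} else i)" for i
  have pick: "pick ?P (\<sigma> i) = \<rho> i" if "i < q" for i
    using that pick_card_in_set[of "\<rho> i" ?P] by (simp add: \<sigma>_def)
  have lt: "\<sigma> i < q" if "i < q" for i
  proof -
    have "{a \<in> ?P. a < \<rho> i} \<subset> ?P" using that by auto
    then have "card {a \<in> ?P. a < \<rho> i} < card ?P" by (rule psubset_card_mono[rotated]) simp
    then show ?thesis using that card by (simp add: \<sigma>_def)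
  qed
  have inj\<sigma>: "inj_on \<sigma> {0..<q}"
  proof (rule inj_onI)
    fix x y assume "x \<in> {0..<q}" "y \<in> {0..<q}" "\<sigma> x = \<sigma> y"
    then have xy: "x < q" "y < q" "\<sigma> x = \<sigma> y" by auto
    then have "\<rho> x = \<rho> y" using pick[OF xy(1)] pick[OF xy(2)] by (simp only:)
    then show "x = y" by (rule inj_onD[OF inj]) (use xy in auto)
  qed
  have "\<sigma> ` {0..<q} = {0..<q}"
    by (rule endo_inj_surj) (use lt inj\<sigma> in auto)
  then have "bij_betw \<sigma> {0..<q} {0..<q}" using inj\<sigma> by (simp add: bij_betw_def)
  then have perm: "\<sigma> permutes {0..<q}"
    by (rule bij_imp_permutes) (simp add: \<sigma>_def)
  let ?B = "mat q q (\<lambda>(i, j). f (pick ?P i) j)"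
  have "mat q q (\<lambda>(i, j). f (\<rho> i) j) = mat q q (\<lambda>(i, j). ?B $$ (\<sigma> i, j))"
    by (rule eq_matI) (simp_all add: lt pick)
  also have "det \<dots> = signof \<sigma> * det ?B"
    by (rule det_permute_rows[OF _ perm]) simp
  finally have "det (mat q q (\<lambda>(i, j). f (\<rho> i) j)) = signof \<sigma> * det ?B" .
  moreover have "(signof \<sigma> :: 'b) \<in> {1, -1}"
    by (cases \<sigma> rule: sign_cases) simp_all
  ultimately show ?thesis by (rule bexI)
qed

lemma det_cols_pick:
  fixes f :: "nat \<Rightarrow> nat \<Rightarrow> 'b::comm_ring_1"
  assumes inj: "inj_on \<kappa> {..<q}"
  shows "\<exists>\<epsilon>\<in>{1, -1}. det (mat q q (\<lambda>(i, j). f i (\<kappa> j)))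
    = \<epsilon> * det (mat q q (\<lambda>(i, j). f i (pick (\<kappa> ` {..<q}) j)))"
proof -
  have tr: "det (mat q q (\<lambda>(i, j). h i j)) = det (mat q q (\<lambda>(i, j). h j i))" for h :: "nat \<Rightarrow> nat \<Rightarrow> 'b"
  proof -
    have "transpose_mat (mat q q (\<lambda>(i, j). h j i)) = mat q q (\<lambda>(i, j). h i j)" by auto
    then show ?thesis using det_transpose[of "mat q q (\<lambda>(i, j). h j i)" q] by simp
  qed
  show ?thesis
    using det_rows_pick[OF inj, of "\<lambda>i j. f j i"] tr[of "\<lambda>i j. f i (\<kappa> j)"]
      tr[of "\<lambda>i j. f i (pick (\<kappa> ` {..<q}) j)"] by simp
qed

lemma submatrix_eq:
  assumes "P \<subseteq> {..<dim_row A}" "Q \<subseteq> {..<dim_col A}"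
  shows "submatrix A P Q = mat (card P) (card Q) (\<lambda>(i, j). A $$ (pick P i, pick Q j))"
proof -
  have "{i. i < dim_row A \<and> i \<in> P} = P" "{j. j < dim_col A \<and> j \<in> Q} = Q" using assms by auto
  then show ?thesis by (simp add: submatrix_def)
qed

lemma index_minor:
  fixes A :: "'b::comm_ring_1 mat"
  assumes \<rho>: "inj_on \<rho> {..<q}" "\<rho> ` {..<q} \<subseteq> {..<dim_row A}"
    and \<kappa>: "inj_on \<kappa> {..<q}" "\<kappa> ` {..<q} \<subseteq> {..<dim_col A}"
  shows "\<exists>\<epsilon>\<in>{1, -1}. \<exists>g\<in>minors q A. det (mat q q (\<lambda>(i, j). A $$ (\<rho> i, \<kappa> j))) = \<epsilon> * g"
proof -
  let ?P = "\<rho> ` {..<q}" and ?Q = "\<kappa> ` {..<q}"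
  have card: "card ?P = q" "card ?Q = q" using \<rho> \<kappa> by (simp_all add: card_image)
  obtain e1 where e1: "e1 \<in> {1, -1}" "det (mat q q (\<lambda>(i, j). A $$ (\<rho> i, \<kappa> j)))
      = e1 * det (mat q q (\<lambda>(i, j). A $$ (pick ?P i, \<kappa> j)))"
    using det_rows_pick[OF \<rho>(1), of "\<lambda>i j. A $$ (i, \<kappa> j)"] by (rule bexE)
  obtain e2 where e2: "e2 \<in> {1, -1}" "det (mat q q (\<lambda>(i, j). A $$ (pick ?P i, \<kappa> j)))
      = e2 * det (mat q q (\<lambda>(i, j). A $$ (pick ?P i, pick ?Q j)))"
    using det_cols_pick[OF \<kappa>(1), of "\<lambda>i j. A $$ (pick ?P i, j)"] by (rule bexE)
  have "det (submatrix A ?P ?Q) \<in> minors q A"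
    unfolding minors_def using \<rho> \<kappa> card by blast
  then have "det (mat q q (\<lambda>(i, j). A $$ (pick ?P i, pick ?Q j))) \<in> minors q A"
    using submatrix_eq[OF \<rho>(2) \<kappa>(2)] card by simp
  moreover have "e1 * e2 \<in> {1, -1}" using e1 e2 by auto
  ultimately show ?thesis using e1(2) e2(2)
    by (intro bexI[of _ "e1 * e2"] bexI[of _ "det (mat q q (\<lambda>(i, j). A $$ (pick ?P i, pick ?Q j)))"])
      (simp_all add: mult.assoc)
qed

lemma minorsE:
  assumes "g \<in> minors q A"
  obtains \<rho> \<kappa> where "inj_on \<rho> {..<q}" "\<rho> ` {..<q} \<subseteq> {..<dim_row A}"
    "inj_on \<kappa> {..<q}" "\<kappa> ` {..<q} \<subseteq> {..<dim_col A}"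
    "g = det (mat q q (\<lambda>(i, j). A $$ (\<rho> i, \<kappa> j)))"
proof -
  obtain P Q where PQ: "g = det (submatrix A P Q)" "P \<subseteq> {..<dim_row A}" "Q \<subseteq> {..<dim_col A}"
    "card P = q" "card Q = q"
    using assms by (auto simp: minors_def)
  have inj: "inj_on (pick S) {..<q}" and sub: "pick S ` {..<q} \<subseteq> S" if "card S = q" for S
  proof -
    show "inj_on (pick S) {..<q}"
    proof (rule inj_onI)
      fix x y assume "x \<in> {..<q}" "y \<in> {..<q}" "pick S x = pick S y"
      then show "x = y" using pick_mono[of x S y] pick_mono[of y S x] that
        by (cases x y rule: linorder_cases) auto
    qed
    show "pick S ` {..<q} \<subseteq> S" using that pick_in_set by auto
  qed
  show thesis
  proof (rule that[of "pick P" "pick Q"])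
    show "g = det (mat q q (\<lambda>(i, j). A $$ (pick P i, pick Q j)))"
      using PQ submatrix_eq[OF PQ(2,3)] by simp
  qed (use inj sub[OF PQ(4)] sub[OF PQ(5)] PQ in auto)
qed

lemma finite_minors: "finite (minors q A)"
proof -
  have "minors q A \<subseteq> (\<lambda>(P, Q). det (submatrix A P Q)) ` (Pow {..<dim_row A} \<times> Pow {..<dim_col A})"
    by (auto simp: minors_def)
  then show ?thesis by (rule finite_subset) auto
qed

lemma inj_on_case_nat:
  assumes "inj_on f {..<q}" "\<And>i. i < q \<Longrightarrow> f i \<noteq> a"
  shows "inj_on (case_nat a f) {..<Suc q}"
proof (rule inj_onI)
  fix x y assume "x \<in> {..<Suc q}" "y \<in> {..<Suc q}" "case_nat a f x = case_nat a f y"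
  then show "x = y"
    using assms(2)[of "x - 1"] assms(2)[of "y - 1"] inj_onD[OF assms(1), of "x - 1" "y - 1"]
    by (cases x; cases y) auto
qed

lemma image_case_nat: "a < N \<Longrightarrow> (\<And>i. i < q \<Longrightarrow> f i < N) \<Longrightarrow> case_nat a f ` {..<Suc q} \<subseteq> {..<N}"
  by (auto split: nat.split)

section \<open>Ideals of power series rings\<close>

lemma psring_simps [simp]:
  "monoid.mult (psring V) = (*)" "one (psring V) = 1" "ring.zero (psring V) = 0" "add (psring V) = (+)"
  by (simp_all add: psring_def)

lemma cring_psring: "cring (psring V)"
proof (rule cringI)
  show "abelian_group (psring V)"
  proof (rule abelian_groupI)
    fix x assume "x \<in> carrier (psring V)"
    then show "\<exists>y\<in>carrier (psring V). y \<oplus>\<^bsub>psring V\<^esub> x = \<zero>\<^bsub>psring V\<^esub>"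
      by (intro bexI[of _ "- x"]) (auto simp: carrier_psring ps_uminus)
  qed (auto simp: carrier_psring ps_add algebra_simps)
  show "Group.comm_monoid (psring V)"
    by (rule Group.comm_monoidI) (auto simp: carrier_psring ps_times algebra_simps)
qed (auto simp: algebra_simps)

text \<open>For finite \<open>S\<close> this is the generated ideal
  (\<open>genideal_psring\<close>), written with one coefficient per generator so that elements can
  be lifted and approximated through their coefficients.\<close>

definition lin :: "'v set \<Rightarrow> ('v, 'a::comm_ring_1) mfps set \<Rightarrow> ('v, 'a) mfps set" where
  "lin V S = {\<Sum>g\<in>S. x g * g | x. \<forall>g\<in>S. x g \<in> ps V}"

lemma lin_add: "F \<in> lin V S \<Longrightarrow> G \<in> lin V S \<Longrightarrow> F + G \<in> lin V S"
proof -
  assume "F \<in> lin V S" "G \<in> lin V S"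
  then obtain x y where *: "F = (\<Sum>g\<in>S. x g * g)" "\<forall>g\<in>S. x g \<in> ps V"
    "G = (\<Sum>g\<in>S. y g * g)" "\<forall>g\<in>S. y g \<in> ps V"
    by (auto simp: lin_def)
  then have "F + G = (\<Sum>g\<in>S. (x g + y g) * g)" by (simp add: algebra_simps sum.distrib)
  then show ?thesis using * unfolding lin_def by (fastforce intro: ps_add)
qed

lemma lin_mult: "F \<in> lin V S \<Longrightarrow> G \<in> ps V \<Longrightarrow> G * F \<in> lin V S"
proof -
  assume G: "G \<in> ps V" and "F \<in> lin V S"
  then obtain x where *: "F = (\<Sum>g\<in>S. x g * g)" "\<forall>g\<in>S. x g \<in> ps V"
    by (auto simp: lin_def)
  then have "G * F = (\<Sum>g\<in>S. (G * x g) * g)" by (simp add: mult.assoc sum_distrib_left)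
  then show ?thesis using * G unfolding lin_def by (fastforce intro: ps_times)
qed

lemma lin_0: "0 \<in> lin V S"
  unfolding lin_def by (auto intro!: exI[of _ "\<lambda>_. 0"])

lemma lin_uminus: "F \<in> lin V S \<Longrightarrow> - F \<in> lin V S"
  using lin_mult[of F V S "- 1"] by (simp add: ps_uminus)

lemma lin_gen: "finite S \<Longrightarrow> g \<in> S \<Longrightarrow> g \<in> lin V S"
  unfolding lin_def by (auto intro!: exI[of _ "\<lambda>h. if h = g then 1 else 0"] simp: if_distrib[of "\<lambda>x. x * _"] cong: if_cong)

lemma lin_sum: "(\<And>i. i \<in> A \<Longrightarrow> F i \<in> lin V S) \<Longrightarrow> (\<Sum>i\<in>A. F i) \<in> lin V S"
  by (induction A rule: infinite_finite_induct) (auto intro: lin_add lin_0)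

lemma lin_ps: "S \<subseteq> ps V \<Longrightarrow> F \<in> lin V S \<Longrightarrow> F \<in> ps V"
  unfolding lin_def by (auto intro!: ps_sum ps_times)

lemma genideal_psring:
  assumes "finite S" "S \<subseteq> ps V"
  shows "genideal (psring V) S = lin V S"
proof
  interpret cring "psring V" by (rule cring_psring)
  have idl: "ideal (lin V S) (psring V)"
  proof (rule idealI)
    show "subgroup (lin V S) (add_monoid (psring V))"
    proof (rule subgroup.intro)
      fix x assume x: "x \<in> lin V S"
      have "inv\<^bsub>add_monoid (psring V)\<^esub> x = \<ominus>\<^bsub>psring V\<^esub> x" by (simp add: a_inv_def)
      also have "\<dots> = - x"
        using x lin_ps[OF assms(2)] by (intro minus_equality) (auto simp: carrier_psring ps_uminus)
      finally show "inv\<^bsub>add_monoid (psring V)\<^esub> x \<in> lin V S" using x by (simp add: lin_uminus)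
    qed (use lin_ps[OF assms(2)] in \<open>auto simp: carrier_psring lin_add lin_0\<close>)
  qed (use lin_mult ring_axioms in \<open>auto simp: carrier_psring mult.commute\<close>)
  show "genideal (psring V) S \<subseteq> lin V S"
    by (rule genideal_minimal[OF idl]) (use lin_gen assms in auto)
  show "lin V S \<subseteq> genideal (psring V) S"
  proof
    have S: "S \<subseteq> carrier (psring V)" using assms by (simp add: carrier_psring)
    interpret I: ideal "genideal (psring V) S" "psring V" by (rule genideal_ideal[OF S])
    fix F assume "F \<in> lin V S"
    then obtain x where x: "F = (\<Sum>g\<in>S. x g * g)" "\<forall>g\<in>S. x g \<in> ps V" by (auto simp: lin_def)
    have "(\<Sum>g\<in>T. x g * g) \<in> genideal (psring V) S" if "T \<subseteq> S" for T
      using finite_subset[OF that assms(1)] that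
    proof (induction T rule: finite_induct)
      case empty
      then show ?case using I.zero_closed by simp
    next
      case (insert g T)
      have "g \<in> genideal (psring V) S" using genideal_self[OF S] insert by auto
      then have "x g * g \<in> genideal (psring V) S"
        using I.I_l_closed[of g "x g"] x insert by (simp add: carrier_psring)
      then show ?case using I.a_closed insert by simp
    qed
    then show "F \<in> genideal (psring V) S" using x by simp
  qed
qed

lemma det_ps:
  assumes "\<And>i j. i < dim_row A \<Longrightarrow> j < dim_col A \<Longrightarrow> A $$ (i, j) \<in> ps V"
  shows "det A \<in> ps V"
proof (cases "dim_row A = dim_col A")
  case True
  have "signof p * (\<Prod>i = 0..<dim_row A. A $$ (i, p i)) \<in> ps V" if p: "p permutes {0..<dim_row A}" for p
  proof (rule ps_times)
    show "signof p \<in> ps V" by (cases p rule: sign_cases) (simp_all add: ps_uminus)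
    show "(\<Prod>i = 0..<dim_row A. A $$ (i, p i)) \<in> ps V"
    proof (rule ps_prod)
      fix i assume i: "i \<in> {0..<dim_row A}"
      then have "p i \<in> {0..<dim_row A}" using permutes_in_image[OF p] by blast
      then show "A $$ (i, p i) \<in> ps V" using i True by (intro assms) auto
    qed
  qed
  then show ?thesis using True by (auto simp: det_def intro!: ps_sum)
qed (simp add: det_def)

section \<open>The Sylvester matrix\<close>

definition tc :: "nat \<Rightarrow> nat \<Rightarrow> nat \<Rightarrow> 'a::comm_ring_1 cseries" where
  "tc k d l = (if l < d then mvar (k, d - l) else if l = d then 1 else 0)"

text \<open>The Sylvester entries as a function of all index pairs, so that matrices for different
  degrees are compared without range conditions. Here \<open>tc k d l\<close> is the coefficient of
  \<open>x^l\<close> in \<open>f_k\<close>.\<close>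

definition syl :: "nat \<Rightarrow> nat \<Rightarrow> nat \<Rightarrow> nat \<Rightarrow> 'a::comm_ring_1 cseries" where
  "syl d0 d1 i j = (if j < d1 then if j \<le> i then tc 0 d0 (i - j) else 0
     else if j - d1 \<le> i then tc 1 d1 (i - (j - d1)) else 0)"

lemma coeff_taut_eqn: "Polynomial.coeff (taut_eqn k d) l = tc k d l"
  by (auto simp: taut_eqn_def coeff_divisor_eqn dc_def tc_def)

lemma sylvester_index:
  "i < d0 + d1 \<Longrightarrow> j < d0 + d1 \<Longrightarrow> sylvester d0 d1 $$ (i, j) = syl d0 d1 i j"
  by (auto simp: sylvester_def syl_def coeff_monom_mult coeff_taut_eqn)

lemma dim_sylvester [simp]: "dim_row (sylvester d0 d1) = d0 + d1" "dim_col (sylvester d0 d1) = d0 + d1"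
  by (simp_all add: sylvester_def)

lemma tc_ps: "k = 0 \<and> d = d0 \<or> k = 1 \<and> d = d1 \<Longrightarrow> tc k d l \<in> ps (par_vars d0 d1)"
  by (auto simp: tc_def par_vars_def c_vars_def intro!: ps_mvar)

lemma syl_ps: "syl d0 d1 i j \<in> ps (par_vars d0 d1)"
  by (simp add: syl_def tc_ps)

definition sminor :: "nat \<Rightarrow> nat \<Rightarrow> nat \<Rightarrow> (nat \<Rightarrow> nat) \<Rightarrow> (nat \<Rightarrow> nat) \<Rightarrow> 'a::comm_ring_1 cseries" where
  "sminor d0 d1 q \<rho> \<kappa> = det (mat q q (\<lambda>(i, j). syl d0 d1 (\<rho> i) (\<kappa> j)))"

abbreviation sideal :: "nat \<Rightarrow> nat \<Rightarrow> nat \<Rightarrow> 'a::comm_ring_1 cseries set" where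
  "sideal d0 d1 q \<equiv> lin (par_vars d0 d1) (minors q (sylvester d0 d1))"

lemma sminor_in_sideal:
  fixes d0 d1 q :: nat
  assumes "inj_on \<rho> {..<q}" "\<rho> ` {..<q} \<subseteq> {..<d0 + d1}" "inj_on \<kappa> {..<q}" "\<kappa> ` {..<q} \<subseteq> {..<d0 + d1}"
  shows "sminor d0 d1 q \<rho> \<kappa> \<in> (sideal d0 d1 q :: 'a::comm_ring_1 cseries set)"
proof -
  have "(sminor d0 d1 q \<rho> \<kappa> :: 'a cseries) = det (mat q q (\<lambda>(i, j). sylvester d0 d1 $$ (\<rho> i, \<kappa> j)))"
    unfolding sminor_def using assms(2,4)
    by (intro arg_cong[where f = det] eq_matI) (auto simp: sylvester_index image_subset_iff)
  moreover have "\<exists>\<epsilon>\<in>{1, -1}. \<exists>g\<in>minors q (sylvester d0 d1).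
      det (mat q q (\<lambda>(i, j). sylvester d0 d1 $$ (\<rho> i, \<kappa> j))) = (\<epsilon> * g :: 'a cseries)"
    by (rule index_minor) (use assms in simp_all)
  then obtain e g where "e \<in> {1, -1}" "g \<in> minors q (sylvester d0 d1)"
    "det (mat q q (\<lambda>(i, j). sylvester d0 d1 $$ (\<rho> i, \<kappa> j))) = (e * g :: 'a cseries)"
    by blast
  ultimately show ?thesis
    using lin_gen[OF finite_minors, of g] lin_uminus[OF lin_gen[OF finite_minors, of g]] by auto
qed

lemma minor_sylvesterE:
  assumes "g \<in> minors q (sylvester d0 d1)"
  obtains \<rho> \<kappa> where "inj_on \<rho> {..<q}" "\<rho> ` {..<q} \<subseteq> {..<d0 + d1}" "inj_on \<kappa> {..<q}" "\<kappa> ` {..<q} \<subseteq> {..<d0 + d1}"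
    "g = sminor d0 d1 q \<rho> \<kappa>"
proof -
  obtain \<rho> \<kappa> where *: "inj_on \<rho> {..<q}" "\<rho> ` {..<q} \<subseteq> {..<d0 + d1}" "inj_on \<kappa> {..<q}" "\<kappa> ` {..<q} \<subseteq> {..<d0 + d1}"
    "g = det (mat q q (\<lambda>(i, j). sylvester d0 d1 $$ (\<rho> i, \<kappa> j)))"
    using minorsE[OF assms] by auto
  have "g = sminor d0 d1 q \<rho> \<kappa>"
    unfolding sminor_def *(5) using *(2,4)
    by (intro arg_cong[where f = det] eq_matI) (auto simp: sylvester_index image_subset_iff)
  with * that show thesis by blast
qed

lemma sminor_ps: "sminor d0 d1 q \<rho> \<kappa> \<in> ps (par_vars d0 d1)"
  unfolding sminor_def by (rule det_ps) (auto simp: syl_ps)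

lemma minors_sylvester_ps: "minors q (sylvester d0 d1) \<subseteq> ps (par_vars d0 d1)"
  using sminor_ps by (metis minor_sylvesterE subsetI)

lemma res_tc: "res (k, Suc d) (tc k (Suc d) l) = (if l = 0 then 0 else tc k d (l - 1))"
  by (auto simp: tc_def res_mvar)

lemma res_tc_other: "k \<noteq> k' \<Longrightarrow> res (k, d) (tc k' d' l) = tc k' d' l"
  by (auto simp: tc_def res_mvar)

lemma res_sminor: "res v (sminor d0 d1 q \<rho> \<kappa>) = det (mat q q (\<lambda>(i, j). res v (syl d0 d1 (\<rho> i) (\<kappa> j))))"
proof -
  have "res v (sminor d0 d1 q \<rho> \<kappa>) = det (map_mat (res v) (mat q q (\<lambda>(i, j). syl d0 d1 (\<rho> i) (\<kappa> j))))"
    unfolding sminor_def by (rule res.hom_det[symmetric])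
  also have "map_mat (res v) (mat q q (\<lambda>(i, j). syl d0 d1 (\<rho> i) (\<kappa> j))) = mat q q (\<lambda>(i, j). res v (syl d0 d1 (\<rho> i) (\<kappa> j)))"
    by (rule eq_matI) auto
  finally show ?thesis .
qed

text \<open>
  If \<open>f\<^sub>0\<close> and \<open>f\<^sub>1\<close> are both divisible by \<open>x\<close>, the minors of the quotients are minors for
  \<open>f\<^sub>0\<close> and \<open>f\<^sub>1\<close>: adjoin the column of \<open>x\<^bsup>d\<^sub>1-1\<^esup>f\<^sub>0\<close> and the top row.
\<close>

lemma minor_both:
  assumes "inj_on \<rho> {..<q}" "\<rho> ` {..<q} \<subseteq> {..<c + e}" "inj_on \<kappa> {..<q}" "\<kappa> ` {..<q} \<subseteq> {..<c + e}"
  shows "\<exists>g\<in>sideal (Suc c) (Suc e) (Suc q).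
    res (0, Suc c) (res (1, Suc e) g) = (sminor c e q \<rho> \<kappa> :: 'a::comm_ring_1 cseries)"
proof
  define \<rho>' where "\<rho>' = case_nat (Suc (c + e)) (\<lambda>k. Suc (\<rho> k))"
  \<comment> \<open>Column \<open>e\<close> is \<open>x^e f_0\<close>, of full degree. The columns
    of \<open>f_1\<close> move up by one and avoid \<open>x^c f_1\<close>, the other column of full
    degree, so the new top row has a single nonzero entry, a leading coefficient 1.\<close>
  define \<kappa>' where "\<kappa>' = case_nat e (\<lambda>k. if \<kappa> k < e then \<kappa> k else Suc (\<kappa> k))"
  have \<rho>lt: "\<rho> i < c + e" and \<kappa>lt: "\<kappa> i < c + e" if "i < q" for i
    using assms(2,4) that by auto
  have "inj_on \<rho>' {..<Suc q}"
    unfolding \<rho>'_def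
  proof (rule inj_on_case_nat)
    show "Suc (\<rho> i) \<noteq> Suc (c + e)" if "i < q" for i using \<rho>lt[OF that] by simp
  qed (use assms(1) in \<open>simp add: inj_on_def\<close>)
  moreover have "\<rho>' ` {..<Suc q} \<subseteq> {..<Suc c + Suc e}"
    unfolding \<rho>'_def by (intro image_case_nat) (use \<rho>lt in force)+
  moreover have "inj_on \<kappa>' {..<Suc q}"
    unfolding \<kappa>'_def using assms(3)
    by (intro inj_on_case_nat inj_onI) (auto simp: inj_on_def split: if_splits)
  moreover have "\<kappa>' ` {..<Suc q} \<subseteq> {..<Suc c + Suc e}"
    unfolding \<kappa>'_def by (intro image_case_nat) (use \<kappa>lt in force)+
  ultimately show "sminor (Suc c) (Suc e) (Suc q) \<rho>' \<kappa>' \<in> sideal (Suc c) (Suc e) (Suc q)"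
    by (rule sminor_in_sideal)
  let ?R = "\<lambda>i j. res (0, Suc c) (res (1, Suc e) (syl (Suc c) (Suc e) (\<rho>' i) (\<kappa>' j))) :: 'a cseries"
  let ?M = "mat (Suc q) (Suc q) (\<lambda>(i, j). ?R i j)"
  have "res (0, Suc c) (res (1, Suc e) (sminor (Suc c) (Suc e) (Suc q) \<rho>' \<kappa>')) = det ?M"
  proof -
    have "map_mat (res (0, Suc c)) (mat (Suc q) (Suc q) (\<lambda>(i, j). res (1, Suc e) (syl (Suc c) (Suc e) (\<rho>' i) (\<kappa>' j)))) = ?M"
      by (rule eq_matI) auto
    then show ?thesis unfolding res_sminor by (metis res.hom_det)
  qed
  also have "\<dots> = ?M $$ (0, 0) * det (mat q q (\<lambda>(i, j). ?M $$ (Suc i, Suc j)))"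
  proof (rule det_first_row)
    fix j assume j: "j < q"
    have "(syl (Suc c) (Suc e) (Suc (c + e)) (\<kappa>' (Suc j)) :: 'a cseries) = 0"
      using \<kappa>lt[OF j] by (auto simp: \<kappa>'_def syl_def tc_def)
    then show "?M $$ (0, Suc j) = 0" using j by (simp add: \<rho>'_def)
  qed simp
  also have "?M $$ (0, 0) = 1"
    by (simp add: \<rho>'_def \<kappa>'_def syl_def tc_def)
  also have "mat q q (\<lambda>(i, j). ?M $$ (Suc i, Suc j)) = mat q q (\<lambda>(i, j). syl c e (\<rho> i) (\<kappa> j))"
    by (rule eq_matI)
      (auto simp: \<rho>'_def \<kappa>'_def syl_def res_tc[unfolded One_nat_def] res_tc_other Suc_diff_le)
  finally show "res (0, Suc c) (res (1, Suc e) (sminor (Suc c) (Suc e) (Suc q) \<rho>' \<kappa>'))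
      = (sminor c e q \<rho> \<kappa> :: 'a cseries)"
    by (simp add: sminor_def)
qed

text \<open>
  If only \<open>f\<^sub>1\<close> is divisible by \<open>x\<close>, then the constant term of \<open>f\<^sub>0\<close> times a minor for \<open>f\<^sub>0\<close> and
  \<open>f\<^sub>1/x\<close> is a minor for \<open>f\<^sub>0\<close> and \<open>f\<^sub>1\<close>: adjoin the column of \<open>f\<^sub>0\<close> and the bottom row.
\<close>

lemma minor_one:
  assumes "inj_on \<rho> {..<q}" "\<rho> ` {..<q} \<subseteq> {..<c + e}" "inj_on \<kappa> {..<q}" "\<kappa> ` {..<q} \<subseteq> {..<c + e}" "0 < c"
  shows "\<exists>g\<in>sideal c (Suc e) (Suc q). res (1, Suc e) g = mvar (0, c) * sminor c e q \<rho> \<kappa>"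
proof
  define \<rho>' where "\<rho>' = case_nat 0 (\<lambda>k. Suc (\<rho> k))"
  define \<kappa>' where "\<kappa>' = case_nat 0 (\<lambda>k. Suc (\<kappa> k))"
  have \<rho>lt: "\<rho> i < c + e" and \<kappa>lt: "\<kappa> i < c + e" if "i < q" for i
    using assms(2,4) that by auto
  have "inj_on \<rho>' {..<Suc q}"
    unfolding \<rho>'_def using assms(1) by (intro inj_on_case_nat) (auto simp: inj_on_def)
  moreover have "\<rho>' ` {..<Suc q} \<subseteq> {..<c + Suc e}"
    unfolding \<rho>'_def by (intro image_case_nat) (use \<rho>lt in force)+
  moreover have "inj_on \<kappa>' {..<Suc q}"
    unfolding \<kappa>'_def using assms(3) by (intro inj_on_case_nat) (auto simp: inj_on_def)
  moreover have "\<kappa>' ` {..<Suc q} \<subseteq> {..<c + Suc e}"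
    unfolding \<kappa>'_def by (intro image_case_nat) (use \<kappa>lt in force)+
  ultimately show "sminor c (Suc e) (Suc q) \<rho>' \<kappa>' \<in> sideal c (Suc e) (Suc q)"
    by (rule sminor_in_sideal)
  let ?M = "mat (Suc q) (Suc q) (\<lambda>(i, j). res (1, Suc e) (syl c (Suc e) (\<rho>' i) (\<kappa>' j)))"
  have "res (1, Suc e) (sminor c (Suc e) (Suc q) \<rho>' \<kappa>') = det ?M"
    by (rule res_sminor)
  also have "\<dots> = ?M $$ (0, 0) * det (mat q q (\<lambda>(i, j). ?M $$ (Suc i, Suc j)))"
    by (rule det_first_row) (auto simp: \<rho>'_def \<kappa>'_def syl_def res_tc[unfolded One_nat_def])
  also have "?M $$ (0, 0) = mvar (0, c)"
    using assms(5) by (simp add: \<rho>'_def \<kappa>'_def syl_def tc_def res_mvar)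
  also have "mat q q (\<lambda>(i, j). ?M $$ (Suc i, Suc j)) = mat q q (\<lambda>(i, j). syl c e (\<rho> i) (\<kappa> j))"
    by (rule eq_matI)
      (auto simp: \<rho>'_def \<kappa>'_def syl_def res_tc[unfolded One_nat_def] res_tc_other Suc_diff_le)
  finally show "res (1, Suc e) (sminor c (Suc e) (Suc q) \<rho>' \<kappa>') = mvar (0, c) * sminor c e q \<rho> \<kappa>"
    by (simp add: sminor_def)
qed

text \<open>The columns \<open>x^j f_1\<close> and the rows from exponent \<open>e\<close> on form a
  triangular matrix with the leading coefficients of \<open>f_1\<close> on the diagonal. This is the
  base case \<open>s = 0\<close>, where \<open>f_1\<close> divided by x has degree below
  \<open>r\<close> and the ideal of minors is the unit ideal.\<close>

lemma unit_minor: "sminor c e c (\<lambda>i. e + i) (\<lambda>j. e + j) = 1"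
proof -
  let ?M = "mat c c (\<lambda>(i, j). syl c e (e + i) (e + j))"
  have "det ?M = prod_list (diag_mat ?M)"
    by (rule det_upper_triangular[of _ c]) (auto simp: upper_triangular_def syl_def tc_def)
  also have "\<dots> = (\<Prod>i=0..<c. ?M $$ (i, i))" by (simp add: prod_list_diag_prod)
  also have "\<dots> = 1" by (rule prod.neutral) (auto simp: syl_def tc_def)
  finally show ?thesis by (simp add: sminor_def)
qed


section \<open>The monomials generate the ring of intersections\<close>

definition ymon :: "nat \<Rightarrow> nat \<Rightarrow> (nat \<Rightarrow> nat) \<Rightarrow> 'a::comm_ring_1 cseries" where
  "ymon m r = bmon m r (\<lambda>i. mvar (0, i))"

lemma ymon_ps: "ymon m r \<alpha> \<in> ps (par_vars (m + r) n)"
  unfolding ymon_def bmon_def par_vars_def c_vars_def by (intro ps_prod ps_power ps_mvar) auto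

lemma ymon_Suc: "\<alpha> (m + Suc r) = 0 \<Longrightarrow> ymon m (Suc r) \<alpha> = ymon m r \<alpha>"
  by (simp add: ymon_def bmon_Suc)

lemma ymon_incr: "ymon m (Suc r) (incr (m + Suc r) \<alpha>) = mvar (0, m + Suc r) * ymon m (Suc r) \<alpha>"
  unfolding ymon_def bmon_incr by simp

lemma par_vars_mono: "m \<le> m' \<Longrightarrow> n \<le> n' \<Longrightarrow> par_vars m n \<subseteq> par_vars m' n'"
  by (auto simp: par_vars_def c_vars_def)

lemma res_par_ident:
  assumes "F \<in> ps (par_vars d0 d1)"
  shows "res (0, Suc d0) F = F" "res (1, Suc d1) F = F"
  by (rule res_ident[OF assms]; simp add: par_vars_def c_vars_def)+

lemma res_par:
  shows "F \<in> ps (par_vars (Suc d0) d1) \<Longrightarrow> res (0, Suc d0) F \<in> ps (par_vars d0 d1)"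
    and "F \<in> ps (par_vars d0 (Suc d1)) \<Longrightarrow> res (1, Suc d1) F \<in> ps (par_vars d0 d1)"
proof -
  show "F \<in> ps (par_vars (Suc d0) d1) \<Longrightarrow> res (0, Suc d0) F \<in> ps (par_vars d0 d1)"
    by (rule ps_mono[OF res_ps[of _ "(0, Suc d0)" "par_vars d0 d1"]])
      (auto simp: par_vars_def c_vars_def atLeastAtMostSuc_conv elim!: ps_mono)
qed (rule par_vars_res)

text \<open>Each minor is lifted by \<open>minor_both\<close>; the coefficients of the combination
  can be kept because they do not involve the two variables set to zero.\<close>

lemma sideal_lift_both:
  fixes F :: "'a::comm_ring_1 cseries"
  assumes F: "F \<in> sideal c e q"
  shows "\<exists>G\<in>sideal (Suc c) (Suc e) (Suc q). res (0, Suc c) (res (1, Suc e) G) = F"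
proof -
  let ?S = "minors q (sylvester c e) :: 'a cseries set"
  obtain x where x: "F = (\<Sum>g\<in>?S. x g * g)" "\<forall>g\<in>?S. x g \<in> ps (par_vars c e)"
    using F by (auto simp: lin_def)
  have "\<forall>g\<in>?S. \<exists>G\<in>(sideal (Suc c) (Suc e) (Suc q) :: 'a cseries set). res (0, Suc c) (res (1, Suc e) G) = g"
    by (auto elim!: minor_sylvesterE intro!: minor_both[unfolded One_nat_def])
  then obtain G where G: "\<And>g. g \<in> ?S \<Longrightarrow> G g \<in> sideal (Suc c) (Suc e) (Suc q)"
    "\<And>g. g \<in> ?S \<Longrightarrow> res (0, Suc c) (res (1, Suc e) (G g)) = g"
    by metis
  have "(\<Sum>g\<in>?S. x g * G g) \<in> sideal (Suc c) (Suc e) (Suc q)"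
    by (intro lin_sum lin_mult G)
      (use x in \<open>auto intro: ps_mono[OF _ par_vars_mono]\<close>)
  moreover have "res (0, Suc c) (res (1, Suc e) (\<Sum>g\<in>?S. x g * G g)) = F"
    unfolding x(1) res.hom_sum res_mult
    by (intro sum.cong refl) (use x(2) in \<open>simp add: G(2)[unfolded One_nat_def] res_par_ident[of _ c e, unfolded One_nat_def]\<close>)
  ultimately show ?thesis by blast
qed

lemma sideal_lift_one:
  fixes F :: "'a::comm_ring_1 cseries"
  assumes F: "F \<in> sideal c e q" and c: "0 < c"
  shows "\<exists>G\<in>sideal c (Suc e) (Suc q). res (1, Suc e) G = mvar (0, c) * F"
proof -
  let ?S = "minors q (sylvester c e) :: 'a cseries set"
  obtain x where x: "F = (\<Sum>g\<in>?S. x g * g)" "\<forall>g\<in>?S. x g \<in> ps (par_vars c e)"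
    using F by (auto simp: lin_def)
  have "\<forall>g\<in>?S. \<exists>G\<in>(sideal c (Suc e) (Suc q) :: 'a cseries set). res (1, Suc e) G = mvar (0, c) * g"
    using c by (auto elim!: minor_sylvesterE intro!: minor_one[unfolded One_nat_def])
  then obtain G where G: "\<And>g. g \<in> ?S \<Longrightarrow> G g \<in> sideal c (Suc e) (Suc q)"
    "\<And>g. g \<in> ?S \<Longrightarrow> res (1, Suc e) (G g) = mvar (0, c) * g"
    by metis
  have "(\<Sum>g\<in>?S. x g * G g) \<in> sideal c (Suc e) (Suc q)"
    by (intro lin_sum lin_mult G)
      (use x in \<open>auto intro: ps_mono[OF _ par_vars_mono]\<close>)
  moreover have "res (1, Suc e) (\<Sum>g\<in>?S. x g * G g) = mvar (0, c) * F"
    unfolding x(1) res.hom_sum res_mult sum_distrib_left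
    by (intro sum.cong refl) (use x(2) in \<open>simp add: G(2)[unfolded One_nat_def] res_par_ident[of _ c e, unfolded One_nat_def] mult_ac\<close>)
  ultimately show ?thesis by blast
qed

lemma substitution_mvar: "finite V \<Longrightarrow> (\<And>v. v \<in> V \<Longrightarrow> 0 < w v) \<Longrightarrow> substitution V w w mvar"
  by unfold_locales (auto intro: fil_mvar)

text \<open>The two constant terms play different roles. \<open>?T\<close> belongs to the base ring,
  so multiples of it go into the next round of approximation. \<open>?Y\<close> does not: a multiple
  of it must become a monomial containing \<open>?Y\<close> or be absorbed by the ideal.\<close>

lemma sylvester_span:
  fixes F :: "'a::comm_ring_1 cseries"
  assumes "F \<in> ps (par_vars (m + r) (r + s))"
  shows "\<exists>p. (\<forall>\<alpha>\<in>box m r s. p \<alpha> \<in> ps (par_vars m (r + s))) \<and>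
    F - (\<Sum>\<alpha>\<in>box m r s. p \<alpha> * ymon m r \<alpha>) \<in> sideal (m + r) (r + s) (m + r + s + 1)"
  using assms
proof (induction "r + s" arbitrary: r s F rule: less_induct)
  case less
  show ?case
  proof (cases r)
    case 0
    then show ?thesis
      using less.prems by (intro exI[of _ "\<lambda>_. F"]) (simp add: box_0_left ymon_def lin_0)
  next
    case (Suc r')
    let ?d = "m + r'" and ?e = "r' + s"
    let ?y = "(0, Suc ?d) :: nat \<times> nat" and ?t = "(1, Suc ?e) :: nat \<times> nat"
    let ?Y = "mvar ?y :: 'a cseries" and ?T = "mvar ?t :: 'a cseries"
    let ?V = "par_vars (Suc ?d) (Suc ?e)" and ?P = "par_vars m (Suc ?e)"
    let ?J = "sideal (Suc ?d) (Suc ?e) (Suc (Suc (?d + s))) :: 'a cseries set"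
    let ?S = "minors (Suc (Suc (?d + s))) (sylvester (Suc ?d) (Suc ?e)) :: 'a cseries set"
    have dims: "m + r = Suc ?d" "r + s = Suc ?e" "m + r + s + 1 = Suc (Suc (?d + s))" by (simp_all add: Suc)
    have yt: "?y \<in> ?V" "?t \<in> ?V" "?t \<in> ?P" by (simp_all add: par_vars_def c_vars_def)
    have Jps: "G \<in> ps ?V" if "G \<in> ?J" for G
      using that by (rule lin_ps[OF minors_sylvester_ps])
    have PV: "?P \<subseteq> ?V" by (rule par_vars_mono) simp_all
    have step: "\<exists>p G F'. (\<forall>\<alpha>\<in>box m r s. p \<alpha> \<in> ps ?P) \<and> G \<in> ?J \<and> F' \<in> ps ?V \<and>
        F = (\<Sum>\<alpha>\<in>box m r s. p \<alpha> * ymon m r \<alpha>) + G + ?T * F'"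
      if F: "F \<in> ps ?V" for F :: "'a cseries"
    proof -
      have F0ps: "res ?y (res ?t F) \<in> ps (par_vars ?d ?e)" using F by (intro res_par)
      obtain p where p: "\<And>\<alpha>. \<alpha> \<in> box m r' s \<Longrightarrow> p \<alpha> \<in> ps (par_vars m ?e)"
        and pF: "res ?y (res ?t F) - (\<Sum>\<alpha>\<in>box m r' s. p \<alpha> * ymon m r' \<alpha>) \<in> sideal ?d ?e (Suc (?d + s))"
        using less.hyps[OF _ F0ps] by (auto simp: Suc)
      obtain G0 where G0: "G0 \<in> ?J"
        "res ?y (res ?t G0) = res ?y (res ?t F) - (\<Sum>\<alpha>\<in>box m r' s. p \<alpha> * ymon m r' \<alpha>)"
        using sideal_lift_both[OF pF] by blast
      define W where "W = (\<Sum>\<alpha>\<in>box m r' s. p \<alpha> * ymon m r' \<alpha>)"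
      have Wps: "W \<in> ps (par_vars ?d ?e)"
        unfolding W_def
      proof (intro ps_sum ps_times ymon_ps)
        show "p \<alpha> \<in> ps (par_vars ?d ?e)" if "\<alpha> \<in> box m r' s" for \<alpha>
          by (rule ps_mono[OF p[OF that] par_vars_mono]) simp_all
      qed
      have WV: "W \<in> ps ?V" by (rule ps_mono[OF Wps par_vars_mono]) simp_all
      define D where "D = F - W - G0"
      have DV: "D \<in> ps ?V" unfolding D_def using F WV Jps[OF G0(1)] by (intro ps_diff)
      have "res ?y (res ?t D) = 0"
        using G0(2) res_par_ident[OF Wps] by (simp add: D_def res_diff W_def)
      then have D1: "res ?t D = ?Y * shift ?y (res ?t D)" by (rule res_eq_0)
      define D1 where "D1 = shift ?y (res ?t D)"
      have D1ps: "D1 \<in> ps (par_vars (Suc ?d) ?e)"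
        unfolding D1_def using DV by (intro shift_ps res_par)
      \<comment> \<open>\<open>D\<close> vanishes when both constant terms are set to zero, so
        modulo \<open>?T\<close> it is a multiple of \<open>?Y\<close>.\<close>
      have DD: "D = ?Y * D1 + ?T * shift ?t D"
        using res_plus_shift[of D ?t] D1 by (simp add: D1_def)
      have FD: "F = W + G0 + ?Y * D1 + ?T * shift ?t D"
        using DD by (simp add: D_def algebra_simps)
      show ?thesis
      proof (cases s)
        case 0
        \<comment> \<open>For \<open>s = 0\<close> no monomial containing \<open>?Y\<close> is
          allowed. Lifting the unit minor shows that \<open>?Y\<close> itself lies in the ideal
          modulo \<open>?T\<close>.\<close>
        have "inj_on (\<lambda>i. ?e + i) {..<Suc ?d}" "(\<lambda>i. ?e + i) ` {..<Suc ?d} \<subseteq> {..<Suc ?d + ?e}"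
          by (auto simp: inj_on_def)
        then obtain G1 where G1: "G1 \<in> ?J" "res ?t G1 = ?Y"
        proof -
          have u: "sminor (Suc ?d) ?e (Suc ?d) (\<lambda>i. ?e + i) (\<lambda>j. ?e + j) = (1 :: 'a cseries)"
            by (rule unit_minor)
          assume *: "inj_on (\<lambda>i. ?e + i) {..<Suc ?d}" "(\<lambda>i. ?e + i) ` {..<Suc ?d} \<subseteq> {..<Suc ?d + ?e}"
            and that: "\<And>G1. G1 \<in> ?J \<Longrightarrow> res ?t G1 = ?Y \<Longrightarrow> thesis"
          have "\<exists>g\<in>sideal (Suc ?d) (Suc ?e) (Suc (Suc ?d)).
              res ?t g = ?Y * sminor (Suc ?d) ?e (Suc ?d) (\<lambda>i. ?e + i) (\<lambda>j. ?e + j)"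
            using * by (intro minor_one) auto
          then show thesis using that unfolding u by (auto simp: 0)
        qed
        have box: "box m r s = {\<lambda>_. 0}" "box m r' s = {\<lambda>_. 0}" by (simp_all add: 0 box_0_right)
        have D1V: "D1 \<in> ps ?V" by (rule ps_mono[OF D1ps par_vars_mono]) simp_all
        have "G1 = ?Y + ?T * shift ?t G1"
          using res_plus_shift[of G1 ?t] unfolding G1(2) .
        then have "?Y = G1 - ?T * shift ?t G1"
          by (metis add_diff_cancel_right')
        then have "?Y * D1 = (G1 - ?T * shift ?t G1) * D1" by (rule arg_cong)
        then have "F = W + (G0 + D1 * G1) + ?T * (shift ?t D - shift ?t G1 * D1)"
          using FD by (simp only:) (simp only: algebra_simps)
        moreover have "W = (\<Sum>\<alpha>\<in>box m r s. p \<alpha> * ymon m r \<alpha>)"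
          by (simp add: W_def box ymon_def)
        moreover have "\<forall>\<alpha>\<in>box m r s. p \<alpha> \<in> ps ?P"
          using p box by (auto intro: ps_mono[OF _ par_vars_mono])
        moreover have "G0 + D1 * G1 \<in> ?J" using G0 G1 D1V by (intro lin_add lin_mult)
        moreover have "shift ?t D - shift ?t G1 * D1 \<in> ps ?V"
          using DV D1V Jps[OF G1(1)] by (intro ps_diff ps_times shift_ps)
        ultimately show ?thesis by blast
      next
        case s: (Suc s')
        \<comment> \<open>Setting \<open>?T\<close> to zero removed the last variable of
          \<open>f_1\<close>, so \<open>D1\<close> falls under the induction hypothesis for
          \<open>r\<close> and \<open>s'\<close>.\<close>
        have D1ps': "D1 \<in> ps (par_vars (m + r) (r + s'))" using D1ps by (simp add: Suc s)
        obtain q where q: "\<And>\<alpha>. \<alpha> \<in> box m r s' \<Longrightarrow> q \<alpha> \<in> ps (par_vars m (r + s'))"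
          and qD: "D1 - (\<Sum>\<alpha>\<in>box m r s'. q \<alpha> * ymon m r \<alpha>) \<in> sideal (m + r) (r + s') (m + r + s' + 1)"
          using less.hyps[OF _ D1ps'] by (auto simp: s)
        define Z where "Z = (\<Sum>\<alpha>\<in>box m r s'. q \<alpha> * ymon m r \<alpha>)"
        obtain G1 where G1: "G1 \<in> ?J" "res ?t G1 = ?Y * (D1 - Z)"
          using sideal_lift_one[OF qD[folded Z_def]] by (auto simp: Suc s)
        have "G1 = ?Y * (D1 - Z) + ?T * shift ?t G1"
          using res_plus_shift[of G1 ?t] unfolding G1(2) .
        then have "G1 - ?T * shift ?t G1 = ?Y * (D1 - Z)"
          by (metis add_diff_cancel_right')
        then have "?Y * D1 = ?Y * Z + (G1 - ?T * shift ?t G1)"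
          by (simp only: algebra_simps)
        then have F2: "F = (W + ?Y * Z) + (G0 + G1) + ?T * (shift ?t D - shift ?t G1)"
          using FD by (simp only:) (simp only: algebra_simps)
        obtain P where Plast: "\<And>\<alpha>. \<alpha> \<in> box m r' s \<Longrightarrow> P \<alpha> = p \<alpha>"
          and Pincr: "\<And>\<beta>. P (incr (m + Suc r') \<beta>) = q \<beta>"
          using box_merge[of m r' s'] unfolding s by blast
        have "\<forall>\<alpha>\<in>box m r s. P \<alpha> \<in> ps ?P"
        proof
          fix \<alpha> assume "\<alpha> \<in> box m r s"
          then consider "\<alpha> \<in> box m r' s" | \<beta> where "\<beta> \<in> box m r s'" "\<alpha> = incr (m + Suc r') \<beta>"
            unfolding Suc s box_Suc by blast
          then show "P \<alpha> \<in> ps ?P"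
          proof cases
            case 1
            then show ?thesis using ps_mono[OF p[OF 1] par_vars_mono] by (simp add: Plast)
          next
            case 2
            then have "P \<alpha> = q \<beta>" by (simp only: 2(2) Pincr)
            then show ?thesis using ps_mono[OF q[OF 2(1)] par_vars_mono] by (simp add: Suc s)
          qed
        qed
        moreover have "(\<Sum>\<alpha>\<in>box m r s. P \<alpha> * ymon m r \<alpha>) = W + ?Y * Z"
        proof -
          have "(\<Sum>\<alpha>\<in>box m r s. P \<alpha> * ymon m r \<alpha>) = (\<Sum>\<alpha>\<in>box m r' s. P \<alpha> * ymon m r \<alpha>)
              + (\<Sum>\<alpha>\<in>box m r s'. P (incr (m + Suc r') \<alpha>) * ymon m r (incr (m + Suc r') \<alpha>))"
            unfolding Suc s by (rule sum_box_Suc)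
          moreover have "(\<Sum>\<alpha>\<in>box m r' s. P \<alpha> * ymon m r \<alpha>) = W"
            unfolding W_def using box_last by (intro sum.cong) (auto simp: Plast Suc ymon_Suc)
          moreover have "(\<Sum>\<alpha>\<in>box m r s'. P (incr (m + Suc r') \<alpha>) * ymon m r (incr (m + Suc r') \<alpha>)) = ?Y * Z"
            unfolding Z_def sum_distrib_left Pincr
            by (intro sum.cong) (simp_all add: Suc ymon_incr[unfolded add_Suc_right] mult_ac)
          ultimately show ?thesis by simp
        qed
        moreover have "G0 + G1 \<in> ?J" using G0 G1 by (intro lin_add)
        moreover have "shift ?t D - shift ?t G1 \<in> ps ?V"
          using DV Jps[OF G1(1)] by (intro ps_diff shift_ps)
        ultimately show ?thesis
          using F2 by (intro exI[of _ P] exI[of _ "G0 + G1"] exI[of _ "shift ?t D - shift ?t G1"] conjI) (simp_all only:)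
      qed
    qed
    \<comment> \<open>The minors are added as generators with coefficients in the full ring. It is
      then the coefficients that converge, and the limit lies in the ideal without any appeal to the
      ideal being closed.\<close>
    let ?K = "Inl ` box m r s \<union> Inr ` ?S"
    let ?\<gamma> = "case_sum (ymon m r) (\<lambda>g. g)"
    have sumK: "(\<Sum>k\<in>?K. f k * ?\<gamma> k) = (\<Sum>\<alpha>\<in>box m r s. f (Inl \<alpha>) * ymon m r \<alpha>) + (\<Sum>g\<in>?S. f (Inr g) * g)"
      for f :: "(nat \<Rightarrow> nat) + 'a cseries \<Rightarrow> 'a cseries"
      by (subst sum.union_disjoint) (auto simp: finite_box finite_minors sum.reindex)
    have "\<exists>p. (\<forall>k\<in>?K. p k \<in> (case k of Inl _ \<Rightarrow> ps ?P | Inr _ \<Rightarrow> ps ?V)) \<and> F = (\<Sum>k\<in>?K. msubst mvar (p k) * ?\<gamma> k)"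
    proof (rule successive_approximation[where V = ?V and w = "\<lambda>_. 1" and w' = "\<lambda>_. 1" and t = ?T and e = 1
          and C = "\<lambda>k _. (case k of Inl _ \<Rightarrow> ps ?P | Inr _ \<Rightarrow> ps ?V)" and X = "\<lambda>_. ps ?V"])
      show "substitution ?V (\<lambda>_. 1) (\<lambda>_. 1) mvar" by (rule substitution_mvar) (auto simp: finite_par_vars)
      show "?T \<in> ps ?V" using yt by (intro ps_mvar)
      show "?T \<in> fil (\<lambda>_. 1) 1" by (rule fil_mvar)
      show "F \<in> ps ?V" using less.prems by (simp add: dims)
      show "(case k of Inl _ \<Rightarrow> ps ?P | Inr _ \<Rightarrow> ps ?V) \<subseteq> ps ?V" for k :: "(nat \<Rightarrow> nat) + 'a cseries"
        using PV by (auto split: sum.splits intro: ps_mono)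
      show "isum (\<lambda>_. 1) (\<lambda>i. ?T ^ i * G i) \<in> (case k of Inl _ \<Rightarrow> ps ?P | Inr _ \<Rightarrow> ps ?V)"
        if "\<And>i. G i \<in> (case k of Inl _ \<Rightarrow> ps ?P | Inr _ \<Rightarrow> ps ?V)"
        for k :: "(nat \<Rightarrow> nat) + 'a cseries" and G
        using that yt by (cases k) (auto intro!: isum_ps ps_times ps_power ps_mvar)
      fix F :: "'a cseries" assume "F \<in> ps ?V"
      then obtain p G F' where pG: "\<forall>\<alpha>\<in>box m r s. p \<alpha> \<in> ps ?P" "G \<in> ?J" "F' \<in> ps ?V"
        "F = (\<Sum>\<alpha>\<in>box m r s. p \<alpha> * ymon m r \<alpha>) + G + ?T * F'"
        using step by blast
      obtain x where x: "G = (\<Sum>g\<in>?S. x g * g)" "\<forall>g\<in>?S. x g \<in> ps ?V"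
        using pG(2) by (auto simp: lin_def)
      show "\<exists>p F'. (\<forall>k\<in>?K. p k \<in> (case k of Inl _ \<Rightarrow> ps ?P | Inr _ \<Rightarrow> ps ?V)) \<and> F' \<in> ps ?V
          \<and> F = (\<Sum>k\<in>?K. msubst mvar (p k) * ?\<gamma> k) + msubst mvar ?T * F'"
        unfolding msubst_mvar_id sumK
        by (rule exI[of _ "case_sum p x"], rule exI[of _ F']) (use pG x in auto)
    qed simp
    then obtain p where p: "\<forall>k\<in>?K. p k \<in> (case k of Inl _ \<Rightarrow> ps ?P | Inr _ \<Rightarrow> ps ?V)"
      "F = (\<Sum>\<alpha>\<in>box m r s. p (Inl \<alpha>) * ymon m r \<alpha>) + (\<Sum>g\<in>?S. p (Inr g) * g)"
      unfolding msubst_mvar_id sumK by blast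
    then have "F - (\<Sum>\<alpha>\<in>box m r s. p (Inl \<alpha>) * ymon m r \<alpha>) = (\<Sum>g\<in>?S. p (Inr g) * g)" by simp
    moreover have "\<forall>g\<in>?S. p (Inr g) \<in> ps ?V"
    proof
      fix g assume "g \<in> ?S"
      then have "Inr g \<in> ?K" by blast
      then show "p (Inr g) \<in> ps ?V" using bspec[OF p(1), of "Inr g"] by simp
    qed
    then have "(\<Sum>g\<in>?S. p (Inr g) * g) \<in> ?J" unfolding lin_def by (auto intro!: exI[of _ "\<lambda>g. p (Inr g)"])
    moreover have "\<forall>\<alpha>\<in>box m r s. p (Inl \<alpha>) \<in> ps ?P"
    proof
      fix \<alpha> assume "\<alpha> \<in> box m r s"
      then have "Inl \<alpha> \<in> ?K" by blast
      then show "p (Inl \<alpha>) \<in> ps ?P" using bspec[OF p(1), of "Inl \<alpha>"] by simp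
    qed
    ultimately show ?thesis unfolding dims by (intro exI[of _ "\<lambda>\<alpha>. p (Inl \<alpha>)"]) simp
  qed
qed

section \<open>The ring map to the ring of subdivisors\<close>

abbreviation "all_vars m r s \<equiv> par_vars (m + r) (r + s)"
abbreviation "simg m r s \<equiv> sub_image (m + r) (r + s) r"

lemma sub_image_eq:
  assumes "v \<in> all_vars m r s"
  shows "simg m r s v = (if fst v = 0
    then \<Sum>l\<le>snd v. dc m (\<lambda>k. mvar (AVar k)) l * dc r (\<lambda>k. mvar (CVar k)) (snd v - l) else ephi r s v)"
proof -
  obtain i j where v: "v = (i, j)" by (cases v)
  show ?thesis
  proof (cases "i = 0")
    case True
    then have "j \<le> m + r" using assms v by (auto simp: par_vars_def c_vars_def)
    then show ?thesis
      using True by (simp add: v sub_image_def sub_f_def sub_h_def coeff_divisor_eqn_mult)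
  next
    case False
    then have "j \<le> s + r" using assms v by (auto simp: par_vars_def c_vars_def)
    then show ?thesis
      using False coeff_divisor_eqn_mult[of j s r]
      by (simp add: v sub_image_def sub_g_def sub_h_def ephi_def add.commute[of r s])
  qed
qed

lemma sub_image_ps: "v \<in> all_vars m r s \<Longrightarrow> simg m r s v \<in> ps (sub_vars m r s)"
proof -
  assume v: "v \<in> all_vars m r s"
  have "ephi r s v \<in> ps (sub_vars m r s)" if "fst v \<noteq> 0"
    by (rule ephi_ps[of _ m "r + s"]) (use v that in \<open>auto simp: par_vars_def c_vars_def\<close>)
  then show ?thesis
    unfolding sub_image_eq[OF v]
    by (auto intro!: ps_sum ps_times dc_ps ps_mvar simp: sub_vars_def)
qed

text \<open>The part of lowest weight in the image of each variable: for \<open>c_0j\<close> the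
  term with \<open>l = min j m\<close> of the convolution, for \<open>c_1j\<close> the whole image,
  which is homogeneous.\<close>

definition lead :: "nat \<Rightarrow> nat \<Rightarrow> nat \<Rightarrow> nat \<times> nat \<Rightarrow> 'a::comm_ring_1 sseries" where
  "lead m r s v = (if fst v = 0
    then dc m (\<lambda>k. mvar (AVar k)) (min (snd v) m) * dc r (\<lambda>k. mvar (CVar k)) (snd v - min (snd v) m)
    else ephi r s v)"

lemma wR_0: "wR m (0, j) = 2 * j - min j m"
  by (auto simp: wR_def min_def)

lemma dcdc_fil: "l \<le> j \<Longrightarrow> dc m (\<lambda>k. mvar (AVar k)) l * dc r (\<lambda>k. mvar (CVar k)) (j - l) \<in> fil wS (2 * j - l)"
proof -
  assume l: "l \<le> j"
  have "dc m (\<lambda>k. mvar (AVar k)) l * dc r (\<lambda>k. mvar (CVar k)) (j - l) \<in> fil wS (1 * l + 2 * (j - l))"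
    by (intro fil_times dc_fil) (use fil_mvar[of "AVar _" wS] fil_mvar[of "CVar _" wS] in simp_all)
  then show ?thesis by (rule fil_mono) (use l in simp)
qed

lemma lead_fil: "v \<in> all_vars m r s \<Longrightarrow> lead m r s v \<in> fil wS (wR m v)"
proof -
  assume v: "v \<in> all_vars m r s"
  show ?thesis
  proof (cases "fst v = 0")
    case True
    then obtain j where j: "v = (0, j)" by (cases v) auto
    show ?thesis using dcdc_fil[of "min j m" j m r] by (simp add: j lead_def wR_0)
  next
    case False
    then have "v \<in> par_vars m (r + s)" using v by (auto simp: par_vars_def c_vars_def)
    then show ?thesis using False by (simp add: lead_def ephi_fil)
  qed
qed

text \<open>The term with index \<open>l\<close> has weight \<open>2 * j - l\<close>, and terms with
  \<open>l > m\<close> vanish, so every term other than \<open>l = min j m\<close> lies strictly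
  higher.\<close>

lemma sub_lead_near:
  assumes "v \<in> all_vars m r s"
  shows "simg m r s v - lead m r s v \<in> (fil wS (Suc (wR m v)) :: 'a::comm_ring_1 sseries set)"
proof (cases "fst v = 0")
  case True
  then obtain j where j: "v = (0, j)" by (cases v) auto
  let ?f = "\<lambda>l. dc m (\<lambda>k. mvar (AVar k)) l * dc r (\<lambda>k. mvar (CVar k)) (j - l) :: 'a sseries"
  have "simg m r s v - lead m r s v = (\<Sum>l\<in>{..j} - {min j m}. ?f l)"
    unfolding sub_image_eq[OF assms] by (simp add: j lead_def sum_diff1)
  moreover have "(\<Sum>l\<in>{..j} - {min j m}. ?f l) \<in> fil wS (Suc (wR m v))"
  proof (rule fil_sum)
    fix l assume l: "l \<in> {..j} - {min j m}"
    show "?f l \<in> fil wS (Suc (wR m v))"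
    proof (cases "l \<le> m")
      case True
      then show ?thesis
        using l by (intro fil_mono[OF dcdc_fil[of l j]]) (auto simp: j wR_0)
    qed (simp add: dc_def)
  qed
  ultimately show ?thesis by simp
next
  case False
  then show ?thesis unfolding sub_image_eq[OF assms] by (simp add: lead_def)
qed

lemma wR_pos: "v \<in> par_vars d0 d1 \<Longrightarrow> 0 < wR m v"
  by (auto simp: par_vars_def c_vars_def wR_def)

lemma substitution_lead: "substitution (all_vars m r s) (wR m) wS (lead m r s)"
  by unfold_locales (auto simp: finite_par_vars lead_fil wR_pos)

lemma substitution_sub:
  "substitution (all_vars m r s) (wR m) wS (simg m r s)"
proof unfold_locales
  fix v assume v: "v \<in> all_vars m r s"
  have "simg m r s v = (simg m r s v - lead m r s v) + lead m r s v" by simp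
  then show "simg m r s v \<in> fil wS (wR m v)"
    using fil_mono[OF sub_lead_near[OF v]] lead_fil[OF v] by (metis fil_add le_SucI order_refl)
qed (auto simp: finite_par_vars wR_pos)

text \<open>The matrix factors through a free module of rank \<open>L\<close>.\<close>

lemma det_factor_zero:
  fixes h :: "'b::comm_ring_1 poly" and P :: "nat \<Rightarrow> 'b poly"
  assumes deg: "\<And>j l. j < q \<Longrightarrow> L \<le> l \<Longrightarrow> Polynomial.coeff (P j) l = 0" and q: "L < q"
  shows "det (mat q q (\<lambda>(i, j). Polynomial.coeff (P j * h) (\<rho> i))) = 0"
proof -
  \<comment> \<open>\<open>X\<close> is padded with zero columns from \<open>L\<close> to
    \<open>q\<close>, so that both factors are square and the determinant is multiplicative; a zero
    column exists as \<open>L < q\<close>.\<close>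
  define X where "X = mat q q (\<lambda>(i, l). if l < L \<and> l \<le> \<rho> i then Polynomial.coeff h (\<rho> i - l) else 0)"
  define Y where "Y = mat q q (\<lambda>(l, j). Polynomial.coeff (P j) l)"
  have X: "X \<in> carrier_mat q q" and Y: "Y \<in> carrier_mat q q" by (auto simp: X_def Y_def)
  have "mat q q (\<lambda>(i, j). Polynomial.coeff (P j * h) (\<rho> i)) = X * Y"
  proof (rule eq_matI)
    fix i j assume "i < dim_row (X * Y)" "j < dim_col (X * Y)"
    then have ij: "i < q" "j < q" using X Y by auto
    have supp: "l < L" if "Polynomial.coeff (P j) l \<noteq> 0" for l
      using deg[OF ij(2)] that not_le by blast
    have "Polynomial.coeff (P j * h) (\<rho> i) = (\<Sum>l\<le>\<rho> i. Polynomial.coeff (P j) l * Polynomial.coeff h (\<rho> i - l))"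
      by (rule coeff_mult)
    also have "\<dots> = (\<Sum>l\<in>{l. l < L \<and> l \<le> \<rho> i}. Polynomial.coeff h (\<rho> i - l) * Polynomial.coeff (P j) l)"
      by (rule sum.mono_neutral_cong_right) (auto simp: mult.commute intro: supp)
    also have "\<dots> = (\<Sum>l\<in>{0..<q}. (if l < L \<and> l \<le> \<rho> i then Polynomial.coeff h (\<rho> i - l) else 0) * Polynomial.coeff (P j) l)"
      by (rule sum.mono_neutral_cong_left) (use q in auto)
    also have "\<dots> = (X * Y) $$ (i, j)"
      using ij by (simp add: X_def Y_def scalar_prod_def)
    finally show "mat q q (\<lambda>(i, j). Polynomial.coeff (P j * h) (\<rho> i)) $$ (i, j) = (X * Y) $$ (i, j)"
      using ij by simp
  qed (auto simp: X_def Y_def)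
  moreover have "det X = 0"
    by (rule det_zero_col[OF X, of "q - 1"]) (use q in \<open>auto simp: X_def\<close>)
  ultimately show ?thesis using det_mult[OF X Y] by simp
qed

lemma coeff_divisor_eqn_mult_top:
  "Polynomial.coeff (divisor_eqn d u * divisor_eqn e v) (d + e) = 1"
  using coeff_divisor_eqn_mult[of 0 d e u v] by (simp add: dc_def)

lemma coeff_divisor_eqn_mult_beyond:
  assumes "d + e < l"
  shows "Polynomial.coeff (divisor_eqn d u * divisor_eqn e v) l = 0"
  unfolding coeff_mult coeff_divisor_eqn using assms by (intro sum.neutral) auto

lemma sub_tc:
  assumes "k = 0 \<and> d = m + r \<or> k = 1 \<and> d = r + s"
  shows "msubst (simg m r s) (tc k d l)
    = Polynomial.coeff ((if k = 0 then sub_f (m + r) r else sub_g (r + s) r) * sub_h r) l"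
proof -
  consider "l < d" | "l = d" | "d < l" by linarith
  then show ?thesis
  proof cases
    case 1
    then show ?thesis using assms by (auto simp: tc_def sub_image_def)
  next
    case 2
    then show ?thesis
      using assms coeff_divisor_eqn_mult_top[where d = m and e = r] coeff_divisor_eqn_mult_top[where d = s and e = r]
      by (auto simp: tc_def msubst_one sub_f_def sub_g_def sub_h_def add.commute[of r s])
  next
    case 3
    then show ?thesis
      using assms coeff_divisor_eqn_mult_beyond[of m r l] coeff_divisor_eqn_mult_beyond[of s r l]
      by (auto simp: tc_def msubst_zero sub_f_def sub_g_def sub_h_def)
  qed
qed

lemma det_mat_expand:
  "det (mat q q (\<lambda>(i, j). f i j)) = (\<Sum>p | p permutes {0..<q}. signof p * (\<Prod>i=0..<q. f i (p i)))"
proof -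
  have "(\<Prod>i=0..<q. mat q q (\<lambda>(i, j). f i j) $$ (i, p i)) = (\<Prod>i=0..<q. f i (p i))"
    if "p permutes {0..<q}" for p
    using permutes_in_image[OF that] by (intro prod.cong) auto
  then show ?thesis unfolding det_def by (auto intro!: sum.cong)
qed

text \<open>Each column becomes \<open>h\<close> times a polynomial of degree below
  \<open>m + r + s\<close>: \<open>f\<close> has degree \<open>m\<close> and is multiplied by less
  than \<open>x^(r+s)\<close>, \<open>g\<close> has degree \<open>s\<close> and is multiplied by
  less than \<open>x^(m+r)\<close>. A minor with more columns than that vanishes.\<close>

lemma sub_sminor:
  assumes "\<kappa> ` {..<q} \<subseteq> {..<(m + r) + (r + s)}" "m + r + s < q"
  shows "msubst (simg m r s) (sminor (m + r) (r + s) q \<rho> \<kappa>)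
    = (0 :: 'a::comm_ring_1 sseries)"
proof -
  let ?\<sigma> = "simg m r s :: nat \<times> nat \<Rightarrow> 'a sseries" and ?V = "all_vars m r s"
  interpret S: substitution ?V "wR m" wS ?\<sigma> by (rule substitution_sub)
  let ?syl = "\<lambda>i j. syl (m + r) (r + s) (\<rho> i) (\<kappa> j) :: 'a cseries"
  have "msubst ?\<sigma> (sminor (m + r) (r + s) q \<rho> \<kappa>) = det (mat q q (\<lambda>(i, j). msubst ?\<sigma> (?syl i j)))"
  proof -
    have "msubst ?\<sigma> (signof p * (\<Prod>i=0..<q. ?syl i (p i))) = signof p * (\<Prod>i=0..<q. msubst ?\<sigma> (?syl i (p i)))"
      for p :: "nat \<Rightarrow> nat"
    proof -
      have "msubst ?\<sigma> (signof p) = signof p" "(signof p :: 'a cseries) \<in> ps ?V"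
        by (cases p rule: sign_cases; simp add: msubst_one S.uminus ps_uminus)+
      then show ?thesis by (simp add: S.mult S.prod ps_prod syl_ps)
    qed
    moreover have "signof p * (\<Prod>i=0..<q. ?syl i (p i)) \<in> ps ?V" for p :: "nat \<Rightarrow> nat"
      by (intro ps_times ps_prod syl_ps) (cases p rule: sign_cases; simp add: ps_uminus)
    ultimately show ?thesis
      unfolding sminor_def det_mat_expand by (simp add: S.sum)
  qed
  also have "mat q q (\<lambda>(i, j). msubst ?\<sigma> (?syl i j)) = mat q q (\<lambda>(i, j). Polynomial.coeff
     ((if \<kappa> j < r + s then Polynomial.monom 1 (\<kappa> j) * sub_f (m + r) r
       else Polynomial.monom 1 (\<kappa> j - (r + s)) * sub_g (r + s) r) * sub_h r) (\<rho> i))" (is "_ = ?M")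
  proof (rule eq_matI)
    fix i j assume "i < dim_row ?M" "j < dim_col ?M"
    then have ij: "i < q" "j < q" by auto
    have "msubst ?\<sigma> (?syl i j) = Polynomial.coeff
     ((if \<kappa> j < r + s then Polynomial.monom 1 (\<kappa> j) * sub_f (m + r) r
       else Polynomial.monom 1 (\<kappa> j - (r + s)) * sub_g (r + s) r) * sub_h r) (\<rho> i)"
      by (auto simp: syl_def mult.assoc coeff_monom_mult msubst_zero sub_tc)
    then show "mat q q (\<lambda>(i, j). msubst ?\<sigma> (?syl i j)) $$ (i, j) = ?M $$ (i, j)" using ij by simp
  qed auto
  also have "det ?M = 0"
  proof (rule det_factor_zero[OF _ assms(2)])
    fix j l assume j: "j < q" and l: "m + r + s \<le> l"
    have "\<kappa> j < (m + r) + (r + s)" using assms(1) j by auto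
    then show "Polynomial.coeff (if \<kappa> j < r + s then Polynomial.monom 1 (\<kappa> j) * sub_f (m + r) r
       else Polynomial.monom 1 (\<kappa> j - (r + s)) * sub_g (r + s) r) l = 0"
      using l by (auto simp: coeff_monom_mult sub_f_def sub_g_def coeff_divisor_eqn)
  qed
  finally show ?thesis .
qed

lemma sub_sideal:
  assumes "F \<in> sideal (m + r) (r + s) (m + r + s + 1)"
  shows "msubst (simg m r s) F = 0"
proof -
  let ?S = "minors (m + r + s + 1) (sylvester (m + r) (r + s))"
  interpret S: substitution "all_vars m r s" "wR m" wS "simg m r s"
    by (rule substitution_sub)
  obtain x where x: "F = (\<Sum>g\<in>?S. x g * g)" "\<forall>g\<in>?S. x g \<in> ps (all_vars m r s)"
    using assms by (auto simp: lin_def)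
  have "msubst (simg m r s) (x g * g) = 0" if g: "g \<in> ?S" for g
  proof -
    have "msubst (simg m r s) g = 0"
      by (rule minor_sylvesterE[OF g]) (simp add: sub_sminor)
    then show ?thesis
      using x(2) g minors_sylvester_ps[of "m + r + s + 1" "m + r" "r + s"] by (subst S.mult) auto
  qed
  then show ?thesis
    unfolding x(1) using x(2) minors_sylvester_ps[of "m + r + s + 1" "m + r" "r + s"]
    by (subst S.sum) (auto intro!: ps_times)
qed

section \<open>A retraction\<close>

definition bdeg :: "nat \<Rightarrow> nat \<Rightarrow> (nat \<Rightarrow> nat) \<Rightarrow> nat" where
  "bdeg m r \<alpha> = (\<Sum>i=m+1..m+r. \<alpha> i)"

context
  fixes m r s :: nat
begin

abbreviation "PP \<equiv> ps (par_vars m (r + s))"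
abbreviation "NN \<equiv> ps (sub_vars m r s)"
abbreviation "BB \<equiv> ps (c_vars 1 (r + s))"
abbreviation "sub \<equiv> msubst (simg m r s)"
text \<open>The weight under \<open>wR\<close> of the monomial \<alpha> in the variables
  \<open>c_(0,m+i)\<close>. Each factor weighs \<open>m + 2 * i\<close>, where \<open>m\<close> is
  contributed by \<open>a_m\<close> in its leading term.\<close>

abbreviation "top_wt \<alpha> \<equiv> m * bdeg m r \<alpha> + bwt m r \<alpha>"

section \<open>Coordinates in the ring of subdivisors\<close>

definition coord :: "'a::comm_ring_1 sseries \<Rightarrow> (nat \<Rightarrow> nat) \<Rightarrow> 'a cseries" where
  "coord F = (SOME p. (\<forall>\<alpha>. p \<alpha> \<in> PP) \<and> (\<forall>\<alpha>. \<alpha> \<notin> box m r s \<longrightarrow> p \<alpha> = 0) \<and>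
     F = (\<Sum>\<alpha>\<in>box m r s. msubst (ephi r s) (p \<alpha>) * cmon m r \<alpha>))"

lemma coord_exists:
  assumes "F \<in> NN" "F \<in> fil wS d"
  shows "\<exists>p. (\<forall>\<alpha>. p \<alpha> \<in> PP) \<and> (\<forall>\<alpha>. p \<alpha> \<in> fil (wR m) (d - bwt m r \<alpha>)) \<and> (\<forall>\<alpha>. \<alpha> \<notin> box m r s \<longrightarrow> p \<alpha> = 0) \<and>
     F = (\<Sum>\<alpha>\<in>box m r s. msubst (ephi r s) (p \<alpha>) * cmon m r \<alpha>)"
proof -
  obtain p where p: "\<forall>\<alpha>\<in>box m r s. p \<alpha> \<in> PP \<inter> fil (wR m) (d - bwt m r \<alpha>)"
    "F = (\<Sum>\<alpha>\<in>box m r s. msubst (ephi r s) (p \<alpha>) * cmon m r \<alpha>)"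
    using ephi_span[OF assms] by blast
  have "F = (\<Sum>\<alpha>\<in>box m r s. msubst (ephi r s) (if \<alpha> \<in> box m r s then p \<alpha> else 0) * cmon m r \<alpha>)"
    unfolding p(2) by (intro sum.cong) auto
  then show ?thesis
    using p(1) by (intro exI[of _ "\<lambda>\<alpha>. if \<alpha> \<in> box m r s then p \<alpha> else 0"]) auto
qed

lemma coord_props:
  assumes "F \<in> NN"
  shows "coord F \<alpha> \<in> PP" "\<alpha> \<notin> box m r s \<Longrightarrow> coord F \<alpha> = 0"
    "F = (\<Sum>\<alpha>\<in>box m r s. msubst (ephi r s) (coord F \<alpha>) * cmon m r \<alpha>)"
proof -
  have "(\<forall>\<alpha>. coord F \<alpha> \<in> PP) \<and> (\<forall>\<alpha>. \<alpha> \<notin> box m r s \<longrightarrow> coord F \<alpha> = 0) \<and>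
     F = (\<Sum>\<alpha>\<in>box m r s. msubst (ephi r s) (coord F \<alpha>) * cmon m r \<alpha>)"
  proof -
    have "\<exists>p. (\<forall>\<alpha>. p \<alpha> \<in> PP) \<and> (\<forall>\<alpha>. \<alpha> \<notin> box m r s \<longrightarrow> p \<alpha> = 0) \<and>
        F = (\<Sum>\<alpha>\<in>box m r s. msubst (ephi r s) (p \<alpha>) * cmon m r \<alpha>)"
      using coord_exists[OF assms fil_0] by blast
    from someI_ex[OF this] show ?thesis unfolding coord_def .
  qed
  then show "coord F \<alpha> \<in> PP" "\<alpha> \<notin> box m r s \<Longrightarrow> coord F \<alpha> = 0"
    "F = (\<Sum>\<alpha>\<in>box m r s. msubst (ephi r s) (coord F \<alpha>) * cmon m r \<alpha>)" by blast+
qed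

text \<open>Being zero outside \<open>box\<close> makes the coordinates unique as a function, so
  additivity and linearity follow by exhibiting a candidate.\<close>

lemma coord_unique:
  assumes F: "F \<in> NN" and p: "\<And>\<alpha>. p \<alpha> \<in> PP" "\<And>\<alpha>. \<alpha> \<notin> box m r s \<Longrightarrow> p \<alpha> = 0"
    and eq: "F = (\<Sum>\<alpha>\<in>box m r s. msubst (ephi r s) (p \<alpha>) * cmon m r \<alpha>)"
  shows "coord F = p"
proof
  interpret E: substitution "par_vars m (r + s)" "wR m" wS "ephi r s" by (rule substitution_ephi)
  fix \<alpha>
  show "coord F \<alpha> = p \<alpha>"
  proof (cases "\<alpha> \<in> box m r s")
    case True
    have "(\<Sum>\<alpha>\<in>box m r s. msubst (ephi r s) (coord F \<alpha> - p \<alpha>) * cmon m r \<alpha>)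
      = (\<Sum>\<alpha>\<in>box m r s. msubst (ephi r s) (coord F \<alpha>) * cmon m r \<alpha>) - (\<Sum>\<alpha>\<in>box m r s. msubst (ephi r s) (p \<alpha>) * cmon m r \<alpha>)"
      using coord_props(1)[OF F] p(1) by (simp add: E.diff algebra_simps sum_subtractf)
    also have "\<dots> = 0"
      using coord_props(3)[OF F] eq by simp
    finally have "coord F \<alpha> - p \<alpha> = 0"
      using coord_props(1)[OF F] p(1) True
      by (intro ephi_independent[where p = "\<lambda>\<alpha>. coord F \<alpha> - p \<alpha>"]) (auto intro: ps_diff)
    then show ?thesis by simp
  qed (use coord_props(2)[OF F] p(2) in simp)
qed

lemma coord_add:
  assumes "F \<in> NN" "G \<in> NN"
  shows "coord (F + G) \<alpha> = coord F \<alpha> + coord G \<alpha>"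
proof -
  interpret E: substitution "par_vars m (r + s)" "wR m" wS "ephi r s" by (rule substitution_ephi)
  have "coord (F + G) = (\<lambda>\<alpha>. coord F \<alpha> + coord G \<alpha>)"
  proof (rule coord_unique)
    show "F + G = (\<Sum>\<alpha>\<in>box m r s. msubst (ephi r s) (coord F \<alpha> + coord G \<alpha>) * cmon m r \<alpha>)"
      using coord_props[OF assms(1)] coord_props[OF assms(2)]
      by (simp add: E.add algebra_simps sum.distrib)
  qed (use coord_props[OF assms(1)] coord_props[OF assms(2)] assms in \<open>auto intro: ps_add\<close>)
  then show ?thesis by simp
qed

lemma BB_PP: "b \<in> BB \<Longrightarrow> b \<in> PP"
  by (erule ps_mono) (auto simp: par_vars_def)

text \<open>On the variables of D_1 the true map coincides with \<open>ephi\<close>. This is the one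
  place where the two algebra structures meet, and it yields linearity of the coordinates along the
  true map.\<close>

lemma sub_BB: "b \<in> BB \<Longrightarrow> sub b = msubst (ephi r s) b"
  by (rule msubst_cong, assumption, subst sub_image_eq) (auto simp: par_vars_def c_vars_def)

lemma sub_ps: "F \<in> ps (all_vars m r s) \<Longrightarrow> sub F \<in> NN"
  by (rule msubst_ps[where V = "all_vars m r s"]) (auto intro: sub_image_ps)

lemma PP_big: "p \<in> PP \<Longrightarrow> p \<in> ps (all_vars m r s)"
  by (erule ps_mono[OF _ par_vars_mono]) simp_all

lemma coord_mult:
  assumes b: "b \<in> BB" and F: "F \<in> NN"
  shows "coord (sub b * F) \<alpha> = b * coord F \<alpha>"
proof -
  interpret E: substitution "par_vars m (r + s)" "wR m" wS "ephi r s" by (rule substitution_ephi)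
  have "coord (sub b * F) = (\<lambda>\<alpha>. b * coord F \<alpha>)"
  proof (rule coord_unique)
    show "sub b * F = (\<Sum>\<alpha>\<in>box m r s. msubst (ephi r s) (b * coord F \<alpha>) * cmon m r \<alpha>)"
    proof -
      have "sub b * F = msubst (ephi r s) b * (\<Sum>\<alpha>\<in>box m r s. msubst (ephi r s) (coord F \<alpha>) * cmon m r \<alpha>)"
        unfolding sub_BB[OF b] by (rule arg_cong[OF coord_props(3)[OF F]])
      then show ?thesis
        using coord_props(1)[OF F] BB_PP[OF b] by (simp add: E.mult sum_distrib_left mult.assoc)
    qed
    show "sub b * F \<in> NN" by (intro ps_times sub_ps PP_big BB_PP b F)
  qed (use coord_props[OF F] BB_PP[OF b] in \<open>auto intro: ps_times\<close>)
  then show ?thesis by simp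
qed

text \<open>By uniqueness the coordinates are those that \<open>ephi_span\<close> provides with
  controlled order.\<close>

lemma coord_fil:
  assumes "F \<in> NN" "F \<in> fil wS d"
  shows "coord F \<alpha> \<in> fil (wR m) (d - bwt m r \<alpha>)"
proof -
  obtain p where "\<forall>\<alpha>. p \<alpha> \<in> PP" "\<forall>\<alpha>. p \<alpha> \<in> fil (wR m) (d - bwt m r \<alpha>)" "\<forall>\<alpha>. \<alpha> \<notin> box m r s \<longrightarrow> p \<alpha> = 0"
     "F = (\<Sum>\<alpha>\<in>box m r s. msubst (ephi r s) (p \<alpha>) * cmon m r \<alpha>)"
    using coord_exists[OF assms] by blast
  moreover from this have "coord F = p" by (intro coord_unique assms(1)) auto
  ultimately show ?thesis by simp
qed

section \<open>Division by the variable that \<open>ephi\<close> sends to \<open>a_m\<close>\<close>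

definition top_var :: "'a::comm_ring_1 cseries" where
  "top_var = (if m = 0 then 1 else mvar (0, m))"

text \<open>For \<open>m = 0\<close> the role of \<open>a_m\<close> is played by the leading
  coefficient \<open>a_0 = 1\<close>, so nothing is divided.\<close>

definition dv :: "'a::comm_ring_1 cseries \<Rightarrow> 'a cseries" where
  "dv F = (if m = 0 then F else shift (0, m) F)"

lemma dv_add: "dv (F + G) = dv F + dv G"
  by (simp add: dv_def shift_add)

lemma dv_ps: "F \<in> ps V \<Longrightarrow> dv F \<in> ps V"
  by (simp add: dv_def shift_ps)

lemma dv_mult: "b \<in> BB \<Longrightarrow> dv (b * F) = b * dv F"
  by (auto simp: dv_def c_vars_def intro: shift_mult)

lemma dv_fil: "F \<in> fil (wR m) d \<Longrightarrow> dv F \<in> fil (wR m) (d - m)"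
  using shift_fil[of F "wR m" d "(0, m)"] by (auto simp: dv_def wR_0)

lemma dv_top: "dv (top_var * F) = F"
  by (simp add: dv_def top_var_def shift_mvar_times)

lemma top_ps: "top_var \<in> PP"
  by (auto simp: top_var_def par_vars_def c_vars_def intro!: ps_mvar)

lemma dv_funpow:
  shows "(dv ^^ k) (F + G) = (dv ^^ k) F + (dv ^^ k) G"
    and "F \<in> ps V \<Longrightarrow> (dv ^^ k) F \<in> ps V"
    and "b \<in> BB \<Longrightarrow> (dv ^^ k) (b * F) = b * (dv ^^ k) F"
    and "F \<in> fil (wR m) d \<Longrightarrow> (dv ^^ k) F \<in> fil (wR m) (d - m * k)"
    and "(dv ^^ k) (top_var ^ k * F) = F"
proof -
  show "(dv ^^ k) (F + G) = (dv ^^ k) F + (dv ^^ k) G" by (induction k) (simp_all add: dv_add)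
  show "F \<in> ps V \<Longrightarrow> (dv ^^ k) F \<in> ps V" by (induction k) (simp_all add: dv_ps)
  show "b \<in> BB \<Longrightarrow> (dv ^^ k) (b * F) = b * (dv ^^ k) F" by (induction k) (simp_all add: dv_mult)
  show "F \<in> fil (wR m) d \<Longrightarrow> (dv ^^ k) F \<in> fil (wR m) (d - m * k)"
    by (induction k) (auto dest: dv_fil simp: algebra_simps)
  show "(dv ^^ k) (top_var ^ k * F) = F"
    by (induction k) (simp_all add: funpow_Suc_right dv_top mult.assoc del: funpow.simps)
qed

text \<open>The retraction of the leading map (see \<open>\<tau>_lead\<close>): the coordinate at
  \<alpha> is divided by the power of \<open>a_m\<close> that the leading map puts in front of the
  basis monomial \<alpha>.\<close>

definition \<tau> :: "'a::comm_ring_1 sseries \<Rightarrow> (nat \<Rightarrow> nat) \<Rightarrow> 'a cseries" where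
  "\<tau> F \<alpha> = (dv ^^ bdeg m r \<alpha>) (coord F \<alpha>)"

text \<open>Coefficient families filtered by the order of the resulting combination, hence the shift
  by \<open>top_wt \<alpha>\<close>. Taking coordinates loses \<open>bwt m r \<alpha>\<close> and
  dividing loses \<open>m * bdeg m r \<alpha>\<close>, so \<open>\<tau>\<close> preserves the
  filtration.\<close>

definition fam :: "nat \<Rightarrow> ((nat \<Rightarrow> nat) \<Rightarrow> 'a::comm_ring_1 cseries) set" where
  "fam d = {p. \<forall>\<alpha>. p \<alpha> \<in> PP \<and> p \<alpha> \<in> fil (wR m) (d - top_wt \<alpha>) \<and> (\<alpha> \<notin> box m r s \<longrightarrow> p \<alpha> = 0)}"

definition comb :: "((nat \<Rightarrow> nat) \<Rightarrow> 'a::comm_ring_1 cseries) \<Rightarrow> 'a cseries" where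
  "comb p = (\<Sum>\<alpha>\<in>box m r s. p \<alpha> * ymon m r \<alpha>)"

lemma comb_ps: "p \<in> fam d \<Longrightarrow> comb p \<in> ps (all_vars m r s)"
  unfolding comb_def fam_def by (intro ps_sum ps_times ymon_ps) (auto intro: PP_big)

lemma ymon_fil: "ymon m r \<alpha> \<in> fil (wR m) (top_wt \<alpha>)"
proof -
  have "ymon m r \<alpha> \<in> fil (wR m) (\<Sum>i=m+1..m+r. wR m (0, i) * \<alpha> i)"
    unfolding ymon_def bmon_def by (intro fil_prod fil_power fil_mvar)
  also have "(\<Sum>i=m+1..m+r. wR m (0, i) * \<alpha> i) = top_wt \<alpha>"
    unfolding bdeg_def bwt_def sum_distrib_left sum.distrib[symmetric]
    by (rule sum.cong) (auto simp: wR_def algebra_simps)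
  finally show ?thesis .
qed

lemma comb_fil: "p \<in> fam d \<Longrightarrow> comb p \<in> fil (wR m) d"
  unfolding comb_def
proof (rule fil_sum)
  fix \<alpha> assume "p \<in> fam d"
  then have "p \<alpha> * ymon m r \<alpha> \<in> fil (wR m) ((d - top_wt \<alpha>) + top_wt \<alpha>)"
    unfolding fam_def by (intro fil_times ymon_fil) blast
  then show "p \<alpha> * ymon m r \<alpha> \<in> fil (wR m) d" by (rule fil_mono) simp
qed

lemma \<tau>_fam: "F \<in> NN \<Longrightarrow> F \<in> fil wS d \<Longrightarrow> \<tau> F \<in> fam d"
proof -
  assume F: "F \<in> NN" "F \<in> fil wS d"
  have "(dv ^^ k) 0 = (0 :: 'a cseries)" for k
    using dv_funpow(1)[of k 0 0] by simp
  moreover have "\<tau> F \<alpha> \<in> fil (wR m) (d - top_wt \<alpha>)" for \<alpha>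
    using dv_funpow(4)[OF coord_fil[OF F], of "bdeg m r \<alpha>" \<alpha>]
    by (simp add: \<tau>_def add.commute)
  ultimately show ?thesis
    using coord_props[OF F(1)] by (auto simp: fam_def \<tau>_def dv_funpow(2))
qed

lemma \<tau>_add: "F \<in> NN \<Longrightarrow> G \<in> NN \<Longrightarrow> \<tau> (F + G) \<alpha> = \<tau> F \<alpha> + \<tau> G \<alpha>"
  by (simp add: \<tau>_def coord_add dv_funpow(1))

lemma \<tau>_mult: "b \<in> BB \<Longrightarrow> F \<in> NN \<Longrightarrow> \<tau> (sub b * F) \<alpha> = b * \<tau> F \<alpha>"
  by (simp add: \<tau>_def coord_mult dv_funpow(3))

lemma \<tau>_diff: "F \<in> NN \<Longrightarrow> G \<in> NN \<Longrightarrow> \<tau> (F - G) \<alpha> = \<tau> F \<alpha> - \<tau> G \<alpha>"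
  using \<tau>_add[of "F - G" G \<alpha>] by (simp add: ps_diff)

text \<open>On \<open>PP\<close> the leading map is \<open>ephi\<close>, and it sends
  \<open>c_(0,m+i)\<close> to \<open>a_m c_i\<close>; a monomial of degree k thus acquires the k-th
  power of \<open>a_m\<close>.\<close>

lemma lead_comb:
  assumes "p \<in> fam d"
  shows "msubst (lead m r s) (comb p)
    = (\<Sum>\<alpha>\<in>box m r s. msubst (ephi r s) (top_var ^ bdeg m r \<alpha> * p \<alpha>) * cmon m r \<alpha>)"
proof -
  interpret L: substitution "all_vars m r s" "wR m" wS "lead m r s" by (rule substitution_lead)
  interpret E: substitution "par_vars m (r + s)" "wR m" wS "ephi r s" by (rule substitution_ephi)
  have p: "p \<alpha> \<in> PP" for \<alpha> using assms by (auto simp: fam_def)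
  have lp: "msubst (lead m r s) F = msubst (ephi r s) F" if "F \<in> PP" for F
    by (rule msubst_cong[OF that]) (auto simp: lead_def ephi_def par_vars_def c_vars_def dc_def)
  have top: "msubst (ephi r s) top_var = dc m (\<lambda>k. mvar (AVar k)) m"
    by (simp add: top_var_def msubst_one dc_def ephi_AVar)
  have ly: "msubst (lead m r s) (ymon m r \<alpha>) = msubst (ephi r s) (top_var ^ bdeg m r \<alpha>) * cmon m r \<alpha>" for \<alpha>
  proof -
    have "mvar (0, i) \<in> ps (all_vars m r s)" if "i \<in> {m+1..m+r}" for i
      using that by (intro ps_mvar) (auto simp: par_vars_def c_vars_def)
    then have "msubst (lead m r s) (ymon m r \<alpha>) = (\<Prod>i=m+1..m+r. lead m r s (0, i) ^ \<alpha> i)"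
      unfolding ymon_def bmon_def by (subst L.prod) (auto intro!: ps_power prod.cong simp: L.power)
    also have "\<dots> = (\<Prod>i=m+1..m+r. msubst (ephi r s) top_var ^ \<alpha> i * mvar (CVar (i - m)) ^ \<alpha> i)"
      by (rule prod.cong) (auto simp: top lead_def dc_def power_mult_distrib)
    also have "\<dots> = msubst (ephi r s) top_var ^ bdeg m r \<alpha> * cmon m r \<alpha>"
      by (simp add: prod.distrib cmon_def bmon_def bdeg_def power_sum)
    finally show ?thesis by (simp add: E.power top_ps)
  qed
  have "msubst (lead m r s) (comb p) = (\<Sum>\<alpha>\<in>box m r s. msubst (lead m r s) (p \<alpha>) * msubst (lead m r s) (ymon m r \<alpha>))"
    unfolding comb_def using PP_big[OF p]
    by (subst L.sum) (auto intro!: ps_times ymon_ps sum.cong L.mult)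
  then show ?thesis
    using p by (simp add: lp ly E.mult top_ps ps_power mult_ac)
qed

lemma lead_ps: "v \<in> all_vars m r s \<Longrightarrow> lead m r s v \<in> NN"
proof -
  assume v: "v \<in> all_vars m r s"
  have "ephi r s v \<in> NN" if "fst v \<noteq> 0"
    by (rule ephi_ps[of _ m "r + s"]) (use v that in \<open>auto simp: par_vars_def c_vars_def\<close>)
  then show ?thesis
    unfolding lead_def by (auto intro!: ps_times dc_ps ps_mvar simp: sub_vars_def)
qed

lemma \<tau>_lead:
  assumes "p \<in> fam d"
  shows "\<tau> (msubst (lead m r s) (comb p)) = p"
proof
  fix \<alpha>
  have "coord (msubst (lead m r s) (comb p)) = (\<lambda>\<alpha>. top_var ^ bdeg m r \<alpha> * p \<alpha>)"
  proof (rule coord_unique[OF _ _ _ lead_comb[OF assms]])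
    show "msubst (lead m r s) (comb p) \<in> NN"
      by (rule msubst_ps[OF comb_ps[OF assms]]) (rule lead_ps)
  qed (use assms in \<open>auto simp: fam_def intro!: ps_times ps_power top_ps\<close>)
  then show "\<tau> (msubst (lead m r s) (comb p)) \<alpha> = p \<alpha>"
    by (simp add: \<tau>_def dv_funpow(5))
qed

section \<open>The deviation from the leading map and its Neumann series\<close>

definition \<nu> :: "((nat \<Rightarrow> nat) \<Rightarrow> 'a::comm_ring_1 cseries) \<Rightarrow> (nat \<Rightarrow> nat) \<Rightarrow> 'a cseries" where
  "\<nu> p = (\<lambda>\<alpha>. p \<alpha> - \<tau> (sub (comb p)) \<alpha>)"

text \<open>Since \<open>\<tau>\<close> inverts the leading map, \<open>\<nu> p\<close> is
  \<open>\<tau>\<close> of the difference between the leading and the true image, and this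
  difference has higher order.\<close>

lemma \<nu>_fam:
  assumes "p \<in> fam d"
  shows "\<nu> p \<in> fam (Suc d)"
proof -
  have L: "msubst (lead m r s) (comb p) \<in> NN"
    by (rule msubst_ps[OF comb_ps[OF assms]]) (rule lead_ps)
  have S: "sub (comb p) \<in> NN" by (rule sub_ps[OF comb_ps[OF assms]])
  have "\<nu> p = \<tau> (msubst (lead m r s) (comb p) - sub (comb p))"
    using \<tau>_diff[OF L S] by (auto simp: \<nu>_def \<tau>_lead[OF assms])
  moreover have "sub (comb p) - msubst (lead m r s) (comb p) \<in> fil wS (Suc d)"
    by (rule msubst_diff_fil[OF substitution_sub substitution_lead sub_lead_near comb_ps[OF assms] comb_fil[OF assms]])
  then have "msubst (lead m r s) (comb p) - sub (comb p) \<in> fil wS (Suc d)"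
    using fil_uminus by fastforce
  ultimately show ?thesis using \<tau>_fam ps_diff[OF L S] by simp
qed

lemma fam_mono: "p \<in> fam d \<Longrightarrow> p \<in> fam 0"
  by (auto simp: fam_def)

lemma \<nu>_add:
  assumes "p \<in> fam 0" "q \<in> fam 0"
  shows "\<nu> (\<lambda>\<alpha>. p \<alpha> + q \<alpha>) = (\<lambda>\<alpha>. \<nu> p \<alpha> + \<nu> q \<alpha>)"
proof -
  interpret S: substitution "all_vars m r s" "wR m" wS "simg m r s"
    by (rule substitution_sub)
  have "comb (\<lambda>\<alpha>. p \<alpha> + q \<alpha>) = comb p + comb q"
    by (simp add: comb_def algebra_simps sum.distrib)
  then show ?thesis
    using assms by (simp add: \<nu>_def S.add comb_ps \<tau>_add sub_ps fun_eq_iff)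
qed

lemma \<nu>_mult:
  assumes "b \<in> BB" "p \<in> fam 0"
  shows "\<nu> (\<lambda>\<alpha>. b * p \<alpha>) = (\<lambda>\<alpha>. b * \<nu> p \<alpha>)"
proof -
  interpret S: substitution "all_vars m r s" "wR m" wS "simg m r s"
    by (rule substitution_sub)
  have "comb (\<lambda>\<alpha>. b * p \<alpha>) = b * comb p"
    by (simp add: comb_def sum_distrib_left mult.assoc)
  then show ?thesis
    using assms by (simp add: \<nu>_def S.mult comb_ps \<tau>_mult sub_ps PP_big BB_PP fun_eq_iff algebra_simps)
qed

lemma fam_add: "p \<in> fam d \<Longrightarrow> q \<in> fam d \<Longrightarrow> (\<lambda>\<alpha>. p \<alpha> + q \<alpha>) \<in> fam d"
  by (auto simp: fam_def intro: ps_add fil_add)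

lemma fam_mult: "b \<in> BB \<Longrightarrow> p \<in> fam d \<Longrightarrow> (\<lambda>\<alpha>. b * p \<alpha>) \<in> fam d"
  using BB_PP[of b] by (auto simp: fam_def intro: ps_times fil_mult_left)

lemma \<nu>_funpow_fam: "p \<in> fam d \<Longrightarrow> (\<nu> ^^ k) p \<in> fam (d + k)"
  by (induction k) (auto dest: \<nu>_fam)

lemma \<nu>_funpow_add:
  "p \<in> fam 0 \<Longrightarrow> q \<in> fam 0 \<Longrightarrow> (\<nu> ^^ k) (\<lambda>\<alpha>. p \<alpha> + q \<alpha>) = (\<lambda>\<alpha>. (\<nu> ^^ k) p \<alpha> + (\<nu> ^^ k) q \<alpha>)"
  by (induction k) (simp_all add: \<nu>_add fam_mono[OF \<nu>_funpow_fam])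

lemma \<nu>_funpow_mult:
  "b \<in> BB \<Longrightarrow> p \<in> fam 0 \<Longrightarrow> (\<nu> ^^ k) (\<lambda>\<alpha>. b * p \<alpha>) = (\<lambda>\<alpha>. b * (\<nu> ^^ k) p \<alpha>)"
  by (induction k) (simp_all add: \<nu>_mult fam_mono[OF \<nu>_funpow_fam])

text \<open>
  The Neumann series of \<open>\<nu>\<close>.  Its \<open>k\<close>-th term has order only at least \<open>k - top_wt \<alpha>\<close>, so the first
  terms are lumped together.
\<close>

definition lump :: "nat \<Rightarrow> (nat \<Rightarrow> 'b) \<Rightarrow> nat \<Rightarrow> 'b::comm_monoid_add" where
  "lump c G i = (if i = 0 then \<Sum>k\<le>c. G k else G (c + i))"

lemma lump_sum: "(\<Sum>i<Suc N. lump c G i) = (\<Sum>k\<le>c + N. G k)"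
  by (induction N) (simp_all add: lump_def)

definition neumann :: "((nat \<Rightarrow> nat) \<Rightarrow> 'a::comm_ring_1 cseries) \<Rightarrow> (nat \<Rightarrow> nat) \<Rightarrow> 'a cseries" where
  "neumann p \<alpha> = isum (wR m) (lump (top_wt \<alpha>) (\<lambda>k. (\<nu> ^^ k) p \<alpha>))"

lemma lump_fil: "p \<in> fam 0 \<Longrightarrow> lump (top_wt \<alpha>) (\<lambda>k. (\<nu> ^^ k) p \<alpha>) i \<in> fil (wR m) i"
proof -
  assume p: "p \<in> fam 0"
  have "(\<nu> ^^ (top_wt \<alpha> + i)) p \<alpha> \<in> fil (wR m) i"
    using \<nu>_funpow_fam[OF p, of "top_wt \<alpha> + i"] unfolding fam_def by (auto dest!: spec[of _ \<alpha>])
  then show ?thesis by (simp add: lump_def)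
qed

lemma neumann_ps: "p \<in> fam 0 \<Longrightarrow> neumann p \<alpha> \<in> PP"
  unfolding neumann_def
  by (rule isum_ps) (use \<nu>_funpow_fam[of p 0] in \<open>auto simp: lump_def fam_def intro!: ps_sum\<close>)

lemma neumann_add: "p \<in> fam 0 \<Longrightarrow> q \<in> fam 0 \<Longrightarrow> neumann (\<lambda>\<alpha>. p \<alpha> + q \<alpha>) \<alpha> = neumann p \<alpha> + neumann q \<alpha>"
proof -
  assume pq: "p \<in> fam 0" "q \<in> fam 0"
  have "lump c (\<lambda>k. G k + H k) = (\<lambda>i. lump c G i + lump c H i)"
    for c and G H :: "nat \<Rightarrow> 'a cseries"
    by (simp add: lump_def sum.distrib fun_eq_iff)
  then show ?thesis
    unfolding neumann_def \<nu>_funpow_add[OF pq] by (simp add: isum_add)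
qed

lemma neumann_mult: "b \<in> BB \<Longrightarrow> p \<in> fam 0 \<Longrightarrow> neumann (\<lambda>\<alpha>. b * p \<alpha>) \<alpha> = b * neumann p \<alpha>"
proof -
  assume bp: "b \<in> BB" "p \<in> fam 0"
  have "lump c (\<lambda>k. b * G k) = (\<lambda>i. b * lump c G i)" for c and G :: "nat \<Rightarrow> 'a cseries"
    by (simp add: lump_def sum_distrib_left fun_eq_iff)
  then show ?thesis
    unfolding neumann_def \<nu>_funpow_mult[OF bp] using isum_mult[OF lump_fil[OF bp(2)]] by simp
qed

text \<open>The series telescopes on \<open>p - \<nu> p\<close>, and \<open>\<tau>\<close> composed
  with the true map is the identity minus \<open>\<nu>\<close>.\<close>

lemma neumann_inverse:
  assumes p: "p \<in> fam 0"
  shows "neumann (\<lambda>\<alpha>. p \<alpha> - \<nu> p \<alpha>) \<alpha> = p \<alpha>"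
proof -
  let ?c = "top_wt \<alpha>"
  have "- 1 \<in> BB" by (simp add: ps_uminus)
  then have mfam: "(\<lambda>\<alpha>. - 1 * \<nu> p \<alpha>) \<in> fam 0"
    by (rule fam_mult) (rule fam_mono[OF \<nu>_fam[OF p]])
  have qf: "(\<lambda>\<alpha>. p \<alpha> - \<nu> p \<alpha>) \<in> fam 0"
    using fam_add[OF p mfam] by simp
  have pow: "(\<nu> ^^ k) (\<lambda>\<alpha>. p \<alpha> - \<nu> p \<alpha>) \<alpha> = (\<nu> ^^ k) p \<alpha> - (\<nu> ^^ Suc k) p \<alpha>" for k
  proof -
    have "(\<nu> ^^ k) (\<lambda>\<alpha>. p \<alpha> + - 1 * \<nu> p \<alpha>) \<alpha> = (\<nu> ^^ k) p \<alpha> + - 1 * (\<nu> ^^ k) (\<nu> p) \<alpha>"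
      using \<nu>_funpow_add[OF p mfam, of k] \<nu>_funpow_mult[OF \<open>- 1 \<in> BB\<close> fam_mono[OF \<nu>_fam[OF p]], of k]
      by simp
    then show ?thesis by (simp add: funpow_swap1)
  qed
  have "neumann (\<lambda>\<alpha>. p \<alpha> - \<nu> p \<alpha>) \<alpha> - p \<alpha> \<in> fil (wR m) N" for N
  proof -
    \<comment> \<open>Summing up to \<open>?c + N\<close> leaves a remainder of order
      \<open>Suc N\<close> at \<alpha>, because \<open>?c = top_wt \<alpha>\<close> is exactly the
      loss allowed in \<open>fam\<close>.\<close>
    have "(\<Sum>k\<le>?c + N. (\<nu> ^^ k) (\<lambda>\<alpha>. p \<alpha> - \<nu> p \<alpha>) \<alpha>) = p \<alpha> - (\<nu> ^^ Suc (?c + N)) p \<alpha>"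
      unfolding pow by (subst sum_telescope) simp
    then have "neumann (\<lambda>\<alpha>. p \<alpha> - \<nu> p \<alpha>) \<alpha> - (p \<alpha> - (\<nu> ^^ Suc (?c + N)) p \<alpha>) \<in> fil (wR m) (Suc N)"
      using isum_approx[of "lump ?c (\<lambda>k. (\<nu> ^^ k) (\<lambda>\<alpha>. p \<alpha> - \<nu> p \<alpha>) \<alpha>)" "wR m" "Suc N", OF lump_fil[OF qf]]
      unfolding lump_sum neumann_def by simp
    moreover have "(\<nu> ^^ Suc (?c + N)) p \<alpha> \<in> fil (wR m) (Suc N)"
      using \<nu>_funpow_fam[OF p, of "Suc (?c + N)"] unfolding fam_def
      by (auto dest!: spec[of _ \<alpha>] elim: fil_mono)
    ultimately have "(neumann (\<lambda>\<alpha>. p \<alpha> - \<nu> p \<alpha>) \<alpha> - (p \<alpha> - (\<nu> ^^ Suc (?c + N)) p \<alpha>)) - (\<nu> ^^ Suc (?c + N)) p \<alpha> \<in> fil (wR m) (Suc N)"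
      by (rule fil_diff)
    then have "neumann (\<lambda>\<alpha>. p \<alpha> - \<nu> p \<alpha>) \<alpha> - p \<alpha> \<in> fil (wR m) (Suc N)" by simp
    then show ?thesis by (rule fil_mono) simp
  qed
  then have "neumann (\<lambda>\<alpha>. p \<alpha> - \<nu> p \<alpha>) \<alpha> - p \<alpha> = 0" by (rule fil_all_imp_0)
  then show ?thesis by simp
qed

definition retr :: "'a::comm_ring_1 sseries \<Rightarrow> (nat \<Rightarrow> nat) \<Rightarrow> 'a cseries" where
  "retr F = neumann (\<tau> F)"

lemma retr_ps: "F \<in> NN \<Longrightarrow> retr F \<alpha> \<in> PP"
  unfolding retr_def by (intro neumann_ps \<tau>_fam) auto

lemma retr_add:
  assumes "F \<in> NN" "G \<in> NN"
  shows "retr (F + G) \<alpha> = retr F \<alpha> + retr G \<alpha>"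
proof -
  have "\<tau> (F + G) = (\<lambda>\<alpha>. \<tau> F \<alpha> + \<tau> G \<alpha>)" using \<tau>_add[OF assms] by blast
  then show ?thesis unfolding retr_def using assms by (simp add: neumann_add \<tau>_fam)
qed

lemma retr_mult:
  assumes "b \<in> BB" "F \<in> NN"
  shows "retr (sub b * F) \<alpha> = b * retr F \<alpha>"
proof -
  have "\<tau> (sub b * F) = (\<lambda>\<alpha>. b * \<tau> F \<alpha>)" using \<tau>_mult[OF assms] by blast
  then show ?thesis unfolding retr_def using assms by (simp add: neumann_mult \<tau>_fam)
qed

text \<open>The coefficients of a combination are recovered from its image in the ring of
  subdivisors. This gives both the independence of the monomials modulo the ideal and the section of
  \<open>pi_star\<close>.\<close>

lemma retr_sub:
  assumes "\<And>\<alpha>. \<alpha> \<in> box m r s \<Longrightarrow> p \<alpha> \<in> PP" "\<alpha> \<in> box m r s"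
  shows "retr (sub (\<Sum>\<alpha>\<in>box m r s. p \<alpha> * ymon m r \<alpha>)) \<alpha> = p \<alpha>"
proof -
  define q where "q \<alpha> = (if \<alpha> \<in> box m r s then p \<alpha> else 0)" for \<alpha>
  have q: "q \<in> fam 0" using assms(1) by (auto simp: fam_def q_def)
  have c: "(\<Sum>\<alpha>\<in>box m r s. p \<alpha> * ymon m r \<alpha>) = comb q"
    unfolding comb_def by (rule sum.cong) (simp_all add: q_def)
  have "\<tau> (sub (comb q)) = (\<lambda>\<alpha>. q \<alpha> - \<nu> q \<alpha>)" by (simp add: \<nu>_def fun_eq_iff)
  then show ?thesis
    unfolding c retr_def using neumann_inverse[OF q] assms(2) by (simp add: q_def)
qed

end

section \<open>Modules along ring maps\<close>

lemma module_along_simps [simp]: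
  "carrier (module_along \<phi> Q) = carrier Q" "add (module_along \<phi> Q) = add Q"
  "ring.zero (module_along \<phi> Q) = ring.zero Q"
  "module.smult (module_along \<phi> Q) b u = \<phi> b \<otimes>\<^bsub>Q\<^esub> u"
  by (simp_all add: module_along_def)

lemma module_module_along:
  assumes "cring B" "cring Q" and hom: "\<phi> \<in> Ring.ring_hom B Q"
  shows "Module.module B (module_along \<phi> Q)"
proof -
  interpret B: cring B by fact
  interpret Q: cring Q by fact
  have cl: "\<phi> b \<in> carrier Q" if "b \<in> carrier B" for b using ring_hom_closed[OF hom that] .
  show ?thesis
  proof (rule Module.moduleI)
    show "abelian_group (module_along \<phi> Q)"
    proof (rule abelian_groupI)
      fix x assume "x \<in> carrier (module_along \<phi> Q)"
      then show "\<exists>y\<in>carrier (module_along \<phi> Q). y \<oplus>\<^bsub>module_along \<phi> Q\<^esub> x = \<zero>\<^bsub>module_along \<phi> Q\<^esub>"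
        using Q.l_neg[of x] Q.a_inv_closed[of x] by auto
    qed (simp_all add: Q.a_ac)
  qed (use assms cl in \<open>simp_all add: ring_hom_add[OF hom] ring_hom_mult[OF hom] ring_hom_one[OF hom]
      Q.l_distr Q.r_distr Q.m_assoc\<close>)
qed

lemma psring_subring_hom:
  fixes \<phi> :: "('v, 'a::comm_ring_1) mfps \<Rightarrow> 'c"
  assumes "\<phi> \<in> Ring.ring_hom (psring W) Q" "V \<subseteq> W"
  shows "\<phi> \<in> Ring.ring_hom (psring V) Q"
proof -
  have sub: "x \<in> carrier (psring W)" if "x \<in> carrier (psring V)" for x :: "('v, 'a) mfps"
    using that assms(2) by (auto simp: carrier_psring elim: ps_mono)
  show ?thesis
    by (rule ring_hom_memI)
      (use sub ring_hom_closed[OF assms(1)] ring_hom_mult[OF assms(1)] ring_hom_add[OF assms(1)] ring_hom_one[OF assms(1)] in simp_all)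
qed

section \<open>The ring of intersections and the projection\<close>

lemma O_DivDiv_eq: "O_DivDiv T d0 d1 = psring (par_vars d0 d1)"
  by (simp add: O_DivDiv_def par_vars_def)

lemma O_Sub_eq: "O_Sub T (m + r) (r + s) r = psring (sub_vars m r s)"
  by (simp add: O_Sub_def sub_vars_def)

context
  fixes m r s :: nat
begin

abbreviation "psA \<equiv> psring (all_vars m r s)"
abbreviation "psS \<equiv> psring (sub_vars m r s)"
abbreviation "RR \<equiv> ps (all_vars m r s)"
abbreviation "II \<equiv> sideal (m + r) (r + s) (m + r + s + 1)"
abbreviation "QQ T \<equiv> O_Int T (m + r) (r + s) r"
abbreviation "pist \<equiv> pi_star (m + r) (r + s) r"
abbreviation "subm \<equiv> sub_map (m + r) (r + s) r"
abbreviation "cmono \<equiv> c0_monomial (m + r) r"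
abbreviation "cls T \<equiv> int_class T (m + r) (r + s) r"
abbreviation "MM T \<equiv> module_along (cls T) (QQ T)"

lemma int_ideal_eq: "int_ideal T (m + r) (r + s) r = II"
proof -
  have "m + r + (r + s) - r + 1 = m + r + s + 1" by simp
  then show ?thesis
    unfolding int_ideal_def O_DivDiv_eq
    by (simp only: genideal_psring[OF finite_minors minors_sylvester_ps])
qed

lemma II_RR: "F \<in> II \<Longrightarrow> F \<in> RR"
  by (rule lin_ps[OF minors_sylvester_ps])

lemma II_ideal: "ideal II (psA)"
proof -
  interpret cring "psA" by (rule cring_psring)
  have "ideal (genideal (psA) (minors (m + r + s + 1) (sylvester (m + r) (r + s))))
      (psA)"
    by (rule genideal_ideal) (simp add: carrier_psring minors_sylvester_ps)
  then show ?thesis by (simp only: genideal_psring[OF finite_minors minors_sylvester_ps])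
qed

lemma O_Int_eq: "QQ T = psA Quot II"
  by (simp add: O_Int_def int_ideal_eq O_DivDiv_eq)

lemma cls_eq: "cls T F = (\<lambda>h. h + F) ` II"
  by (auto simp: int_class_def int_ideal_eq O_DivDiv_eq a_r_coset_def')

lemma cring_QQ: "cring (QQ T)"
  unfolding O_Int_eq by (rule ideal.quotient_is_cring[OF II_ideal cring_psring])

lemma cls_hom: "cls T \<in> Ring.ring_hom (psA) (QQ T)"
proof -
  have "cls T = (\<lambda>F. II +>\<^bsub>psA\<^esub> F)"
    by (simp add: fun_eq_iff int_class_def int_ideal_eq O_DivDiv_eq)
  then show ?thesis
    unfolding O_Int_eq using ideal.rcos_ring_hom[OF II_ideal] by simp
qed

lemma cls_simps:
  assumes "F \<in> RR" "G \<in> RR"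
  shows "cls T F \<in> carrier (QQ T)" "cls T F \<otimes>\<^bsub>QQ T\<^esub> cls T G = cls T (F * G)"
    "cls T F \<oplus>\<^bsub>QQ T\<^esub> cls T G = cls T (F + G)"
  using ring_hom_closed[OF cls_hom[of T]] ring_hom_mult[OF cls_hom[of T]] ring_hom_add[OF cls_hom[of T]] assms
  by (simp_all add: carrier_psring)

lemma cls_one: "cls T 1 = \<one>\<^bsub>QQ T\<^esub>"
  using ring_hom_one[OF cls_hom[of T]] by simp

lemma cls_zero: "cls T 0 = \<zero>\<^bsub>QQ T\<^esub>"
proof -
  interpret R: cring "psA" by (rule cring_psring)
  interpret Q: cring "QQ T" by (rule cring_QQ)
  show ?thesis
    using ring_hom_zero[OF cls_hom[of T] R.ring_axioms Q.ring_axioms] by simp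
qed

lemma cls_surj:
  assumes "u \<in> carrier (QQ T)"
  obtains F where "F \<in> RR" "u = cls T F"
  using assms
  by (auto simp: O_Int_eq FactRing_def A_RCOSETS_def' carrier_psring int_class_def int_ideal_eq O_DivDiv_eq)

lemma cls_cong:
  fixes F G :: "'a::comm_ring_1 cseries"
  assumes "F - G \<in> II"
  shows "cls T F = cls T G"
proof -
  have "(\<lambda>h. h + F) ` II \<subseteq> (\<lambda>h. h + G) ` II" if "F - G \<in> II"
    for F G :: "'a cseries"
  proof clarify
    fix h :: "'a cseries" assume "h \<in> II"
    then have "h + (F - G) \<in> II" using that by (rule lin_add)
    then show "h + F \<in> (\<lambda>h. h + G) ` II" by (rule rev_image_eqI) simp
  qed
  from this[of F G] this[of G F] show ?thesis
    using assms lin_uminus[OF assms] by (auto simp: cls_eq)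
qed

lemma pi_star_cls:
  assumes F: "F \<in> RR"
  shows "pist (cls T F) = subm F"
proof -
  interpret S: substitution "all_vars m r s" "wR m" wS "simg m r s"
    by (rule substitution_sub)
  have "subm (h + F) = subm F" if "h \<in> II" for h
    unfolding sub_map_def using that F II_RR[OF that] by (simp add: S.add sub_sideal)
  moreover have "0 \<in> II" by (rule lin_0)
  ultimately have "subm ` cls T F = {subm F}"
    by (auto simp: cls_eq image_image)
  then show ?thesis by (simp add: pi_star_def)
qed

lemma sub_map_simps:
  assumes "F \<in> RR" "G \<in> RR"
  shows "subm F \<in> ps (sub_vars m r s)"
    "subm (F * G) = subm F * subm G"
    "subm (F + G) = subm F + subm G"
proof -
  interpret S: substitution "all_vars m r s" "wR m" wS "simg m r s"
    by (rule substitution_sub)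
  show "subm F \<in> ps (sub_vars m r s)"
    "subm (F * G) = subm F * subm G"
    "subm (F + G) = subm F + subm G"
    unfolding sub_map_def using assms by (simp_all add: sub_ps S.mult S.add)
qed

lemma sub_map_hom: "subm \<in> Ring.ring_hom (psA) (psS)"
  by (rule ring_hom_memI) (simp_all add: carrier_psring sub_map_simps sub_map_def[symmetric] msubst_one[of "simg m r s", folded sub_map_def])

lemma pi_star_hom: "pist \<in> Ring.ring_hom (QQ T) (psS)"
proof (rule ring_hom_memI)
  fix u assume "u \<in> carrier (QQ T)"
  then obtain F where F: "F \<in> RR" "u = cls T F" by (rule cls_surj)
  then show "pist u \<in> carrier (psS)"
    by (simp add: pi_star_cls carrier_psring sub_map_simps)
  fix v assume "v \<in> carrier (QQ T)"
  then obtain G where G: "G \<in> RR" "v = cls T G" by (rule cls_surj)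
  show "pist (u \<otimes>\<^bsub>QQ T\<^esub> v)
      = pist u \<otimes>\<^bsub>psS\<^esub> pist v"
    using F G by (simp add: cls_simps pi_star_cls ps_times sub_map_simps)
  show "pist (u \<oplus>\<^bsub>QQ T\<^esub> v)
      = pist u \<oplus>\<^bsub>psS\<^esub> pist v"
    using F G by (simp add: cls_simps pi_star_cls ps_add sub_map_simps)
next
  show "pist \<one>\<^bsub>QQ T\<^esub> = \<one>\<^bsub>psS\<^esub>"
    using pi_star_cls[of 1] by (simp add: cls_one[symmetric] sub_map_def msubst_one)
qed

text \<open>Exponents in \<open>int_exponents\<close> are \<open>undefined\<close> outside the
  range; those in \<open>box\<close> are zero there.\<close>

definition ext0 :: "(nat \<Rightarrow> nat) \<Rightarrow> nat \<Rightarrow> nat" where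
  "ext0 \<alpha> i = (if i \<in> {m+1..m+r} then \<alpha> i else 0)"

lemma ext0_bij: "bij_betw ext0 (int_exponents (m + r) (r + s) r) (box m r s)"
proof (rule bij_betw_byWitness[where f' = "\<lambda>\<alpha>. restrict \<alpha> {m+1..m+r}"])
  show "\<forall>\<alpha>\<in>int_exponents (m + r) (r + s) r. restrict (ext0 \<alpha>) {m+1..m+r} = \<alpha>"
    by (auto simp: int_exponents_def ext0_def fun_eq_iff restrict_def PiE_def extensional_def)
  show "\<forall>\<alpha>\<in>box m r s. ext0 (restrict \<alpha> {m+1..m+r}) = \<alpha>"
  proof
    fix \<alpha> assume a: "\<alpha> \<in> box m r s"
    have "\<alpha> i = 0" if "i \<notin> {m+1..m+r}" for i
      using box_support[OF a, of i] that by (metis Suc_eq_plus1 Suc_leI atLeastAtMost_iff)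
    then show "ext0 (restrict \<alpha> {m+1..m+r}) = \<alpha>" by (auto simp: ext0_def fun_eq_iff)
  qed
  have "(\<Sum>i=m+1..m+r. ext0 \<alpha> i) = (\<Sum>i=m+1..m+r. \<alpha> i)" for \<alpha>
    by (rule sum.cong) (auto simp: ext0_def)
  then show "ext0 ` int_exponents (m + r) (r + s) r \<subseteq> box m r s"
    by (auto simp: int_exponents_def box_def) (auto simp: ext0_def split: if_splits)
  have "(\<Sum>i=m+1..m+r. restrict \<alpha> {m+1..m+r} i) = (\<Sum>i=m+1..m+r. \<alpha> i)" for \<alpha> :: "nat \<Rightarrow> nat"
    by (rule sum.cong) auto
  then show "(\<lambda>\<alpha>. restrict \<alpha> {m+1..m+r}) ` box m r s \<subseteq> int_exponents (m + r) (r + s) r"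
    by (auto simp: int_exponents_def box_def)
qed

lemma c0_monomial_eq: "cmono \<alpha> = ymon m r (ext0 \<alpha>)"
  unfolding c0_monomial_def ymon_def bmon_def by (rule prod.cong) (auto simp: ext0_def)

lemma c0_monomial_RR: "cmono \<alpha> \<in> RR"
  by (simp add: c0_monomial_eq ymon_ps)

abbreviation "JJ \<equiv> int_exponents (m + r) (r + s) r"

lemma finite_JJ: "finite JJ"
  using bij_betw_finite[OF ext0_bij] finite_box by simp

lemma sum_JJ:
  fixes b :: "(nat \<Rightarrow> nat) \<Rightarrow> 'a::comm_ring_1 cseries"
  obtains p where "(\<Sum>\<alpha>\<in>JJ. b \<alpha> * cmono \<alpha>) = (\<Sum>\<alpha>\<in>box m r s. p \<alpha> * ymon m r \<alpha>)"
    "\<And>\<alpha>. \<alpha> \<in> JJ \<Longrightarrow> p (ext0 \<alpha>) = b \<alpha>" "\<And>\<beta>. \<beta> \<in> box m r s \<Longrightarrow> p \<beta> \<in> b ` JJ"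
proof -
  define p where "p \<beta> = b (the_inv_into JJ ext0 \<beta>)" for \<beta>
  have p: "p (ext0 \<alpha>) = b \<alpha>" if "\<alpha> \<in> JJ" for \<alpha>
    using that ext0_bij by (simp add: p_def bij_betw_def the_inv_into_f_f)
  have "(\<Sum>\<alpha>\<in>JJ. b \<alpha> * cmono \<alpha>) = (\<Sum>\<alpha>\<in>JJ. p (ext0 \<alpha>) * ymon m r (ext0 \<alpha>))"
    by (rule sum.cong) (simp_all add: p c0_monomial_eq)
  also have "\<dots> = (\<Sum>\<alpha>\<in>box m r s. p \<alpha> * ymon m r \<alpha>)"
    by (rule sum.reindex_bij_betw[OF ext0_bij])
  finally have "(\<Sum>\<alpha>\<in>JJ. b \<alpha> * cmono \<alpha>) = (\<Sum>\<alpha>\<in>box m r s. p \<alpha> * ymon m r \<alpha>)" .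
  moreover have "p \<beta> \<in> b ` JJ" if "\<beta> \<in> box m r s" for \<beta>
  proof -
    have "\<beta> \<in> ext0 ` JJ" using that bij_betw_imp_surj_on[OF ext0_bij] by simp
    then show ?thesis by (auto simp: p)
  qed
  ultimately show thesis using p by (intro that[of p])
qed

text \<open>Computed with the module structure over the full ring. The sum refers only to the
  operations of \<open>MM T\<close>, so the result also serves for scalars from the smaller base
  rings.\<close>

lemma finsum_cls:
  assumes "\<And>\<alpha>. \<alpha> \<in> A \<Longrightarrow> b \<alpha> \<in> RR" "finite A"
  shows "(\<Oplus>\<^bsub>MM T\<^esub> \<alpha>\<in>A. b \<alpha> \<odot>\<^bsub>MM T\<^esub> cls T (cmono \<alpha>))
    = cls T (\<Sum>\<alpha>\<in>A. b \<alpha> * cmono \<alpha>)"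
proof -
  interpret M: Module.module "psA" "MM T"
    by (rule module_module_along[OF cring_psring cring_QQ cls_hom])
  show ?thesis
    using assms(2,1)
  proof (induction A rule: finite_induct)
    case empty
    then show ?case by (simp add: cls_zero)
  next
    case (insert \<alpha> A)
    have cl: "cls T (b \<beta>) \<otimes>\<^bsub>QQ T\<^esub> cls T (cmono \<beta>) = cls T (b \<beta> * cmono \<beta>)"
        "b \<beta> * cmono \<beta> \<in> RR" if "\<beta> \<in> insert \<alpha> A" for \<beta>
      using insert.prems[OF that] by (simp_all add: cls_simps ps_times c0_monomial_RR)
    have S: "(\<Sum>\<alpha>\<in>A. b \<alpha> * cmono \<alpha>) \<in> RR" using cl by (intro ps_sum) auto
    show ?case
      by (subst M.finsum_insert) (use insert cl S in \<open>auto simp: cls_simps\<close>)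
  qed
qed

lemma O_Int_freely_generated:
  "freely_generated (psring (c_vars 0 m \<union> c_vars 1 (r + s))) (MM TYPE('a::comm_ring_1))
    JJ (\<lambda>\<alpha>. cls TYPE('a) (cmono \<alpha>))"
  unfolding freely_generated_def
proof (intro conjI ballI)
  let ?B = "psring (c_vars 0 m \<union> c_vars 1 (r + s)) :: 'a cseries ring"
  let ?M = "MM TYPE('a)"
  have B: "carrier ?B = ps (par_vars m (r + s))" by (simp add: carrier_psring par_vars_def)
  show "Module.module ?B ?M"
    by (rule module_module_along[OF cring_psring cring_QQ psring_subring_hom[OF cls_hom]])
      (auto simp: par_vars_def c_vars_def)
  show "(\<lambda>\<alpha>. cls TYPE('a) (cmono \<alpha>)) \<in> JJ \<rightarrow> carrier ?M"
    by (auto intro!: cls_simps(1) c0_monomial_RR)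
  fix u assume "u \<in> carrier ?M"
  then obtain F where F: "F \<in> RR" "u = cls TYPE('a) F" using cls_surj by (metis module_along_simps(1))
  obtain p where p: "\<And>\<alpha>. \<alpha> \<in> box m r s \<Longrightarrow> p \<alpha> \<in> ps (par_vars m (r + s))"
    "F - (\<Sum>\<alpha>\<in>box m r s. p \<alpha> * ymon m r \<alpha>) \<in> II"
    using sylvester_span[OF F(1)] by blast
  have eval: "(\<Oplus>\<^bsub>?M\<^esub> j\<in>{j \<in> JJ. b j \<noteq> \<zero>\<^bsub>?B\<^esub>}. b j \<odot>\<^bsub>?M\<^esub> cls TYPE('a) (cmono j))
      = cls TYPE('a) (\<Sum>\<alpha>\<in>JJ. b \<alpha> * cmono \<alpha>)" if b: "b \<in> JJ \<rightarrow>\<^sub>E carrier ?B" for b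
  proof -
    have "b \<alpha> \<in> RR" if "\<alpha> \<in> JJ" for \<alpha>
      using PiE_mem[OF b that] unfolding B by (rule PP_big)
    then have "(\<Oplus>\<^bsub>?M\<^esub> j\<in>{j \<in> JJ. b j \<noteq> \<zero>\<^bsub>?B\<^esub>}. b j \<odot>\<^bsub>?M\<^esub> cls TYPE('a) (cmono j))
      = cls TYPE('a) (\<Sum>\<alpha>\<in>{j \<in> JJ. b j \<noteq> \<zero>\<^bsub>?B\<^esub>}. b \<alpha> * cmono \<alpha>)"
      by (intro finsum_cls) (auto simp: finite_JJ)
    also have "(\<Sum>\<alpha>\<in>{j \<in> JJ. b j \<noteq> \<zero>\<^bsub>?B\<^esub>}. b \<alpha> * cmono \<alpha>) = (\<Sum>\<alpha>\<in>JJ. b \<alpha> * cmono \<alpha>)"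
      by (rule sum.mono_neutral_left) (auto simp: finite_JJ)
    finally show ?thesis .
  qed
  define b where "b = restrict (\<lambda>\<alpha>. p (ext0 \<alpha>)) JJ"
  have bJ: "b \<in> JJ \<rightarrow>\<^sub>E carrier ?B"
    unfolding B using p(1) ext0_bij by (auto simp: b_def bij_betw_def)
  have "(\<Sum>\<alpha>\<in>JJ. b \<alpha> * cmono \<alpha>) = (\<Sum>\<alpha>\<in>JJ. p (ext0 \<alpha>) * ymon m r (ext0 \<alpha>))"
    by (rule sum.cong) (simp_all add: b_def c0_monomial_eq)
  also have "\<dots> = (\<Sum>\<alpha>\<in>box m r s. p \<alpha> * ymon m r \<alpha>)"
    by (rule sum.reindex_bij_betw[OF ext0_bij])
  finally have "u = cls TYPE('a) (\<Sum>\<alpha>\<in>JJ. b \<alpha> * cmono \<alpha>)"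
    using cls_cong[OF p(2)] F(2) by simp
  moreover have "b1 = b2"
    if b1: "b1 \<in> JJ \<rightarrow>\<^sub>E carrier ?B" "u = cls TYPE('a) (\<Sum>\<alpha>\<in>JJ. b1 \<alpha> * cmono \<alpha>)"
      and b2: "b2 \<in> JJ \<rightarrow>\<^sub>E carrier ?B" "u = cls TYPE('a) (\<Sum>\<alpha>\<in>JJ. b2 \<alpha> * cmono \<alpha>)" for b1 b2
  proof -
    \<comment> \<open>The coefficients in any representation of \<open>u\<close> are values of
      \<open>retr\<close> at \<open>pist u\<close>, hence determined by \<open>u\<close>
      alone.\<close>
    have val: "b \<alpha> = retr m r s (pist u) (ext0 \<alpha>)"
      if b: "b \<in> JJ \<rightarrow>\<^sub>E carrier ?B" "u = cls TYPE('a) (\<Sum>\<alpha>\<in>JJ. b \<alpha> * cmono \<alpha>)"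
        and a: "\<alpha> \<in> JJ" for b \<alpha>
    proof -
      obtain p where p: "(\<Sum>\<alpha>\<in>JJ. b \<alpha> * cmono \<alpha>) = (\<Sum>\<alpha>\<in>box m r s. p \<alpha> * ymon m r \<alpha>)"
        "\<And>\<alpha>. \<alpha> \<in> JJ \<Longrightarrow> p (ext0 \<alpha>) = b \<alpha>" "\<And>\<beta>. \<beta> \<in> box m r s \<Longrightarrow> p \<beta> \<in> b ` JJ"
        by (rule sum_JJ[of b]) (rule that)
      have pp: "p \<beta> \<in> ps (par_vars m (r + s))" if "\<beta> \<in> box m r s" for \<beta>
        using p(3)[OF that] b(1) unfolding B by auto
      then have "(\<Sum>\<alpha>\<in>box m r s. p \<alpha> * ymon m r \<alpha>) \<in> RR"
        by (intro ps_sum ps_times ymon_ps PP_big)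
      then have "pist u = msubst (simg m r s) (\<Sum>\<alpha>\<in>box m r s. p \<alpha> * ymon m r \<alpha>)"
        unfolding b(2) p(1) by (simp add: pi_star_cls sub_map_def)
      moreover have "ext0 \<alpha> \<in> box m r s" using ext0_bij a by (auto simp: bij_betw_def)
      ultimately show ?thesis
        using retr_sub[of m r s p "ext0 \<alpha>"] pp p(2)[OF a] by simp
    qed
    show ?thesis
      by (rule PiE_ext[OF b1(1) b2(1)]) (use val[OF b1] val[OF b2] in simp)
  qed
  ultimately show "\<exists>!b. b \<in> JJ \<rightarrow>\<^sub>E carrier ?B \<and> finite {j \<in> JJ. b j \<noteq> \<zero>\<^bsub>?B\<^esub>} \<and>
      u = (\<Oplus>\<^bsub>?M\<^esub> j\<in>{j \<in> JJ. b j \<noteq> \<zero>\<^bsub>?B\<^esub>}. b j \<odot>\<^bsub>?M\<^esub> cls TYPE('a) (cmono j))"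
    using bJ finite_JJ eval by (intro ex1I[of _ b]) auto
qed

section \<open>The section of \<open>pi_star\<close>\<close>

definition section_map :: "'a itself \<Rightarrow> 'a::comm_ring_1 sseries \<Rightarrow> 'a cseries set" where
  "section_map T G = cls T (\<Sum>\<alpha>\<in>box m r s. retr m r s G \<alpha> * ymon m r \<alpha>)"

lemma retr_sum_RR:
  "G \<in> ps (sub_vars m r s) \<Longrightarrow> (\<Sum>\<alpha>\<in>box m r s. retr m r s G \<alpha> * ymon m r \<alpha>) \<in> RR"
  by (intro ps_sum ps_times ymon_ps PP_big retr_ps)

text \<open>Every class has a representative that is a combination of the monomials, by
  \<open>sylvester_span\<close>, and \<open>retr_sub\<close> returns the coefficients of that
  representative.\<close>

lemma section_map_pi_star:
  assumes "u \<in> carrier (QQ T)"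
  shows "section_map T (pist u) = u"
proof -
  obtain F where F: "F \<in> RR" "u = cls T F" using assms by (rule cls_surj)
  obtain p where p: "\<And>\<alpha>. \<alpha> \<in> box m r s \<Longrightarrow> p \<alpha> \<in> ps (par_vars m (r + s))"
    "F - (\<Sum>\<alpha>\<in>box m r s. p \<alpha> * ymon m r \<alpha>) \<in> II"
    using sylvester_span[OF F(1)] by blast
  have u: "u = cls T (\<Sum>\<alpha>\<in>box m r s. p \<alpha> * ymon m r \<alpha>)" using cls_cong[OF p(2)] F(2) by simp
  have "(\<Sum>\<alpha>\<in>box m r s. p \<alpha> * ymon m r \<alpha>) \<in> RR"
    using p(1) by (intro ps_sum ps_times ymon_ps PP_big)
  then have "pist u = msubst (simg m r s) (\<Sum>\<alpha>\<in>box m r s. p \<alpha> * ymon m r \<alpha>)"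
    unfolding u by (simp add: pi_star_cls sub_map_def)
  then show ?thesis
    unfolding section_map_def using p(1) by (simp add: retr_sub u)
qed

lemma pi_star_split:
  "split_monomorphism (psring (c_vars 1 (r + s))) (MM TYPE('a::comm_ring_1))
    (module_along (subm) (psS)) (pist)"
  unfolding split_monomorphism_def
proof (intro conjI bexI ballI)
  let ?B = "psring (c_vars 1 (r + s)) :: 'a cseries ring"
  let ?Q = "QQ TYPE('a)" and ?S = "psS :: 'a sseries ring"
  have V: "c_vars 1 (r + s) \<subseteq> all_vars m r s" by (auto simp: par_vars_def)
  have BR: "b \<in> RR" if "b \<in> carrier ?B" for b
    using that V by (auto simp: carrier_psring elim: ps_mono)
  show "Module.module ?B (MM TYPE('a))"
    by (rule module_module_along[OF cring_psring cring_QQ psring_subring_hom[OF cls_hom V]])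
  show "Module.module ?B (module_along subm ?S)"
    by (rule module_module_along[OF cring_psring cring_psring psring_subring_hom[OF sub_map_hom V]])
  have "pist (cls TYPE('a) b \<otimes>\<^bsub>?Q\<^esub> u) = subm b \<otimes>\<^bsub>?S\<^esub> pist u" if "b \<in> carrier ?B" "u \<in> carrier ?Q" for b u
    using ring_hom_mult[OF pi_star_hom cls_simps(1)[OF BR[OF that(1)] BR[OF that(1)]] that(2)]
    by (simp add: pi_star_cls BR[OF that(1)])
  then show "pist \<in> module_homs ?B (MM TYPE('a)) (module_along subm ?S)"
    using ring_hom_closed[OF pi_star_hom[of "TYPE('a)"]] ring_hom_add[OF pi_star_hom[of "TYPE('a)"]]
    by (simp add: module_homs_def)
  show "section_map TYPE('a) \<in> module_homs ?B (module_along subm ?S) (MM TYPE('a))"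
    unfolding module_homs_def
  proof (intro CollectI conjI ballI)
    show "section_map TYPE('a) \<in> carrier (module_along subm ?S) \<rightarrow> carrier (MM TYPE('a))"
      by (auto simp: carrier_psring section_map_def intro!: cls_simps(1) retr_sum_RR)
  next
    fix F G assume "F \<in> carrier (module_along subm ?S)" "G \<in> carrier (module_along subm ?S)"
    then have FG: "F \<in> ps (sub_vars m r s)" "G \<in> ps (sub_vars m r s)" by (simp_all add: carrier_psring)
    show "section_map TYPE('a) (F \<oplus>\<^bsub>module_along subm ?S\<^esub> G)
      = section_map TYPE('a) F \<oplus>\<^bsub>MM TYPE('a)\<^esub> section_map TYPE('a) G"
      using FG by (simp add: section_map_def cls_simps retr_sum_RR retr_add distrib_right sum.distrib)
  next
    fix b F assume "b \<in> carrier ?B" and "F \<in> carrier (module_along subm ?S)"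
    then have bF: "b \<in> ps (c_vars 1 (r + s))" "F \<in> ps (sub_vars m r s)" "b \<in> RR"
      using BR by (simp_all add: carrier_psring)
    have "(\<Sum>\<alpha>\<in>box m r s. retr m r s (subm b * F) \<alpha> * ymon m r \<alpha>) = b * (\<Sum>\<alpha>\<in>box m r s. retr m r s F \<alpha> * ymon m r \<alpha>)"
      unfolding sub_map_def sum_distrib_left
      by (rule sum.cong) (simp_all only: retr_mult[OF bF(1,2)] mult.assoc)
    then show "section_map TYPE('a) (b \<odot>\<^bsub>module_along subm ?S\<^esub> F)
      = b \<odot>\<^bsub>MM TYPE('a)\<^esub> section_map TYPE('a) F"
      using bF by (simp add: section_map_def cls_simps retr_sum_RR)
  qed
  fix u assume "u \<in> carrier (MM TYPE('a))"
  then show "section_map TYPE('a) (pist u) = u" by (simp add: section_map_pi_star)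
qed

lemma pi_star_inj: "inj_on (pist) (carrier (QQ T))"
  by (rule inj_on_inverseI[of _ "section_map T"]) (rule section_map_pi_star)

end

theorem theorem6p3:
  fixes G :: "(nat, 'a::comm_ring_1) mfps"
    and d0 d1 r :: nat
  assumes "formal_group_law G"
    and "r \<le> min d0 d1"
  shows
    "freely_generated
       (psring (c_vars 0 (d0 - r) \<union> c_vars 1 d1))
       (module_along (int_class TYPE('a) d0 d1 r) (O_Int TYPE('a) d0 d1 r))
       (int_exponents d0 d1 r)
       (\<lambda>\<alpha>. int_class TYPE('a) d0 d1 r (c0_monomial d0 r \<alpha>))
     \<and> (\<forall>F \<in> carrier (O_DivDiv TYPE('a) d0 d1).
          pi_star d0 d1 r (int_class TYPE('a) d0 d1 r F) = sub_map d0 d1 r F)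
     \<and> pi_star d0 d1 r \<in> Ring.ring_hom (O_Int TYPE('a) d0 d1 r) (O_Sub TYPE('a) d0 d1 r)
     \<and> split_monomorphism
       (O_Div1 TYPE('a) d1)
       (module_along (int_class TYPE('a) d0 d1 r) (O_Int TYPE('a) d0 d1 r))
       (module_along (sub_map d0 d1 r) (O_Sub TYPE('a) d0 d1 r))
       (pi_star d0 d1 r)
     \<and> inj_on (pi_star d0 d1 r) (carrier (O_Int TYPE('a) d0 d1 r))"
proof -
  define m s where "m = d0 - r" and "s = d1 - r"
  have d: "d0 = m + r" "d1 = r + s" using assms(2) by (simp_all add: m_def s_def)
  show ?thesis
    using O_Int_freely_generated[of m r s, where 'a = 'a] pi_star_cls[of _ m r s "TYPE('a)"] pi_star_hom[of m r s "TYPE('a)"]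
      pi_star_split[of r s m, where 'a = 'a] pi_star_inj[of m r s "TYPE('a)"]
    unfolding d O_Div1_def O_DivDiv_eq O_Sub_eq carrier_psring by simp
qed

end
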